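(* Let $n\in\mathbb{Z}_+$ and let $W_0,\dots,W_{n+1}$ be strongly $\tilde A$-graded generalized $V$-modules satisfying the $C_1$-cofiniteness condition with respect to $\tilde A$. Suppose that the $\tilde A$-patterns of elements in the $W_i$ are preserved by the vertex operators. For any generalized $V$-modules $\widetilde W_1,\dots,\widetilde W_{n-1}$, let $\mathcal Y_1,\mathcal Y_2,\dots,\mathcal Y_{n-1},\mathcal Y_n$ be logarithmic intertwining operators of types $$\binom{W_0}{W_1\,\widetilde W_1},\ \binom{\widetilde W_1}{W_2\,\widetilde W_2},\ \dots,\ \binom{\widetilde W_{n-2}}{W_{n-1}\,\widetilde W_{n-1}},\ \binom{\widetilde W_{n-1}}{W_n\,W_{n+1}},$$ respectively. Then for any $\tilde A$-homogeneous elements $w_{(0)}'\in W_0'$, $w_{(1)}\in W_1,\dots,w_{(n+1)}\in W_{n+1}$, there exist $m$ and $$a_{k,l}(z_1,\dots,z_n)\in\mathbb{C}[z_1^{\pm1},\dots,z_n^{\pm1},(z_1-z_2)^{-1},(z_1-z_3)^{-1},\dots,(z_{n-1}-z_n)^{-1}]$$ for $k=1,\dots,m$ and $l=1,\dots,n$ such that the series $$\langle w_{(0)}',\mathcal Y_1(w_{(1)},z_1)\cdots\mathcal Y_n(w_{(n)},z_n)w_{(n+1)}\rangle$$ satisfies the system of differential equations $$\frac{\partial^m\varphi}{\partial z_l^m}+\sum_{k=1}^m a_{k,l}(z_1,\dots,z_n)\frac{\partial^{m-k}\varphi}{\partial z_l^{m-k}}=0,\qquad l=1,\dots,n,$$ in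 the region $|z_1|>\cdots>|z_n|>0$.
   Context: **Strongly graded algebras and modules.** A conformal vertex algebra is a $\mathbb{Z}$-graded complex vector space $V=\coprod_{n\in\mathbb{Z}}V_{(n)}$ with a vertex operator map $v\mapsto Y(v,x)=\sum_{n\in\mathbb{Z}}v_nx^{-n-1}$, a vacuum $\mathbf 1\in V_{(0)}$ and a conformal vector $\omega\in V_{(2)}$ satisfying lower truncation, vacuum and creation properties, the Jacobi identity, the Virasoro relations for $L(n)=\omega_{n+1}$, the $L(-1)$-derivative property, and $L(0)=n$ on $V_{(n)}$ (no finiteness or lower-boundedness of the weight grading is required). A $V$-module is a $\mathbb{C}$-graded space $W=\coprod_{n\in\mathbb{C}}W_{(n)}$ with an action $Y$ of $V$ satisfying the corresponding axioms (lower truncation, $Y(\mathbf 1,x)=1$, Jacobi identity, Virasoro relations with the central charge of $V$, $L(-1)$-derivative property, $L(0)=n$ on $W_{(n)}$). A generalized $V$-module is defined the same way with $W=\coprod_n W_{[n]}$, where $W_{[n]}$ is the generalized $L(0)$-eigenspace with eigenvalue $n$; $n$ is called the weight ($\mathrm{wt}$) of its elements. Let $A\le\tilde A$ be abelian groups. $V$ is strongly $A$-graded if it has a second grading $V=\coprod_{\alpha\in A}V^{(\alpha)}$ compatible with the weight grading, with $V^{(\alpha)}_{(n)}=V_{(n)}\cap V^{(\alpha)}$ finite-dimensional and zero for $n$ sufficiently negative ($\alpha$ fixed), $\mathbf 1\in V^{(0)}_{(0)}$, $\omega\in V^{(0)}_{(2)}$, and $v_lV^{(\beta)}\subset V^{(\alpha+\beta)}$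 for $v\in V^{(\alpha)}$, $l\in\mathbb{Z}$. A (generalized) $V$-module $W$ is strongly $\tilde A$-graded if it has a compatible second grading $W=\coprod_{\beta\in\tilde A}W^{(\beta)}$ such that each doubly homogeneous space $W^{(\beta)}_{[n]}=W_{[n]}\cap W^{(\beta)}$ (with $W_{(n)}$ in place of $W_{[n]}$ for modules) is finite-dimensional, $W^{(\beta)}_{[n+k]}=0$ for $k\in\mathbb{Z}$ sufficiently negative ($\beta,n$ fixed), and $v_lW^{(\beta)}\subset W^{(\alpha+\beta)}$ for $v\in V^{(\alpha)}$, $l\in\mathbb{Z}$. Its contragredient is $W'=\coprod_{\beta,n}(W')^{(\beta)}_{[n]}$, $(W')^{(\beta)}_{[n]}=(W^{(-\beta)}_{[n]})^*$, with $\langle Y'(v,z)w',w\rangle=\langle w',Y(e^{zL(1)}(-z^{-2})^{L(0)}v,z^{-1})w\rangle$; it is again strongly $\tilde A$-graded. **$C_1$-cofiniteness.** With $V_+=\coprod_{n>0}V_{(n)}$, $C_1(W)$ is the span of all $u_{-1}w$, $u\in V_+$, $w\in W$; it is $\tilde A$-graded. $W$ is $C_1$-cofinite with respect to $\tilde A$ if $\dim W^{(\beta)}/(C_1(W))^{(\beta)}<\infty$ for every $\beta\in\tilde A$. **$\tilde A$-patterns.** A partition of $\beta\in\tilde A$ is a finite multiset of elements of $\tilde A$ with sum $\beta$; $\sqcup$ is union of multisets. To each $w\in W^{(\beta)}$ one associates a fixed $\tilde A$-pattern $P_w(\beta)$, a finite set of partitions of $\beta$: if $w\notin C_1(W)$,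 then $P_w(\beta)=\{\beta\}$; if $w\in C_1(W)$, one writes $w$ as a linear combination of elements $(u_i)_{-1}w_i'$ with $u_i\in V_+$ $A$-homogeneous of $A$-degree $\alpha_i$ and $w_i'\in W^{(\beta-\alpha_i)}$, and $P_w(\beta)$ consists of the partitions $\{\alpha_i\}\sqcup P_{w_i'}(\beta-\alpha_i)$. (Patterns need not be unique; one is fixed for each $w$.) By convention $P_w(\beta)$ is taken to consist of a single partition, and zero entries of partitions are disregarded. For a partition $P=\{\beta_1,\dots,\beta_n\}$ of $\beta$, $\mathcal S(P)$ is the set of partitions $\{\gamma_1,\dots,\gamma_m\}$ of $\beta$ obtained by grouping the entries of $P$ into disjoint blocks exhausting $P$ and letting each $\gamma_j$ be the sum of a block. Vertex operators preserve the $\tilde A$-patterns of elements in $W$ if for all $u\in V^{(\alpha)}$, $w\in W^{(\beta)}$ and $k\in\mathbb{Z}$, $P_{u_kw}(\alpha+\beta)\in\mathcal S(\{\alpha\}\sqcup P_w(\beta))$. **Logarithmic intertwining operators.** For generalized $V$-modules $W_1,W_2,W_3$, a logarithmic intertwining operator of type $\binom{W_3}{W_1\,W_2}$ is a linear map $\mathcal Y(\cdot,x)\cdot:W_1\otimes W_2\to W_3[\log x]\{x\}$, $w_{(1)}\otimes w_{(2)}\mapsto\sum_{n\in\mathbb{C}}\sum_{k\in\mathbb{N}}(w_{(1)})^{\mathcal Y}_{n;k}w_{(2)}x^{-n-1}(\log x)^k$, satisfying: lower truncation ($(w_{(1)})^{\mathcal Y}_{n+m;k}w_{(2)}=0$ for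 $m\in\mathbb{N}$ sufficiently large, independently of $k$); the Jacobi identity $x_0^{-1}\delta(\frac{x_1-x_2}{x_0})Y_3(v,x_1)\mathcal Y(w_{(1)},x_2)w_{(2)}-x_0^{-1}\delta(\frac{x_2-x_1}{-x_0})\mathcal Y(w_{(1)},x_2)Y_2(v,x_1)w_{(2)}=x_2^{-1}\delta(\frac{x_1-x_0}{x_2})\mathcal Y(Y_1(v,x_0)w_{(1)},x_2)w_{(2)}$; and $\mathcal Y(L(-1)w_{(1)},x)=\frac{d}{dx}\mathcal Y(w_{(1)},x)$. **Standing assumptions.** $V$ is a strongly $A$-graded conformal vertex algebra; every strongly $\tilde A$-graded (generalized) $V$-module is $\mathbb{R}$-graded by weight, is $C_1$-cofinite with respect to $\tilde A$, and has its $\tilde A$-patterns preserved by the vertex operators. **Convention.** "The series satisfies the system in the region $|z_1|>\cdots>|z_n|>0$" means that it satisfies the equations in which the coefficients $a_{k,l}$ are expanded as series in that region, i.e. $(z_i-z_j)^{-1}$, $i<j$, is expanded in nonnegative powers of $z_j$. *)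

theory Defs
  imports Complex_Main "HOL-Library.Poly_Mapping" "HOL-Library.Multiset"
begin

section \<open>Linear algebra on subspaces of an ambient vector space\<close>

text \<open>
  Modules are subspaces \<open>carrier M\<close> of an ambient complex vector space given by a type and a
  scalar multiplication. Finitely many vector spaces always embed into a common one (their direct
  sum), so using a single ambient type for a family of modules is no restriction.
\<close>

definition linear_on ::
  "(complex \<Rightarrow> 'b::ab_group_add \<Rightarrow> 'b) \<Rightarrow> (complex \<Rightarrow> 'c::ab_group_add \<Rightarrow> 'c) \<Rightarrow> 'b set \<Rightarrow> ('b \<Rightarrow> 'c) \<Rightarrow> bool"
  where "linear_on s1 s2 S f \<longleftrightarrow>
    (\<forall>x\<in>S. \<forall>y\<in>S. f (x + y) = f x + f y) \<and> (\<forall>c. \<forall>x\<in>S. f (s1 c x) = s2 c (f x))"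

definition direct_sum_on ::
  "(complex \<Rightarrow> 'b::ab_group_add \<Rightarrow> 'b) \<Rightarrow> 'b set \<Rightarrow> 'i set \<Rightarrow> ('i \<Rightarrow> 'b set) \<Rightarrow> bool"
  where "direct_sum_on s W I G \<longleftrightarrow>
    module.subspace s W \<and> (\<forall>i\<in>I. module.subspace s (G i) \<and> G i \<subseteq> W) \<and>
    (\<forall>w\<in>W. \<exists>!f. (\<forall>i\<in>I. f i \<in> G i) \<and> (\<forall>i. i \<notin> I \<longrightarrow> f i = 0) \<and>
       finite {i. f i \<noteq> 0} \<and> w = (\<Sum>i | f i \<noteq> 0. f i))"

definition finite_dim :: "(complex \<Rightarrow> 'b::ab_group_add \<Rightarrow> 'b) \<Rightarrow> 'b set \<Rightarrow> bool"
  where "finite_dim s S \<longleftrightarrow> (\<exists>B. finite B \<and> S \<subseteq> module.span s B)"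


section \<open>Conformal vertex algebras and generalized modules\<close>

text \<open>\<open>mode V v n\<close> and \<open>act M v n\<close> are the coefficients \<open>v\<^sub>n\<close> of \<open>x^(-n-1)\<close> in \<open>Y(v,x)\<close>.\<close>

record 'v vertex_data =
  vscale :: "complex \<Rightarrow> 'v \<Rightarrow> 'v"
  mode :: "'v \<Rightarrow> int \<Rightarrow> 'v \<Rightarrow> 'v"
  vacuum :: 'v
  conformal :: 'v
  central :: complex
  vweight :: "int \<Rightarrow> 'v set"

record ('v, 'w) vmod =
  carrier :: "'w set"
  scale :: "complex \<Rightarrow> 'w \<Rightarrow> 'w"
  act :: "'v \<Rightarrow> int \<Rightarrow> 'w \<Rightarrow> 'w"

definition adjoint :: "('v, 'm) vertex_data_scheme \<Rightarrow> ('v, 'v) vmod"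
  where "adjoint V = \<lparr>carrier = UNIV, scale = vscale V, act = mode V\<rparr>"

definition Lop :: "('v, 'm) vertex_data_scheme \<Rightarrow> ('v, 'w, 'n) vmod_scheme \<Rightarrow> int \<Rightarrow> 'w \<Rightarrow> 'w"
  where "Lop V M n = act M (conformal V) (n + 1)"

text \<open>
  The Jacobi identity
  \<open>x0^(-1) \<delta>((x1 - x2)/x0) Y(u,x1) Y(v,x2) w - x0^(-1) \<delta>((x2 - x1)/(-x0)) Y(v,x2) Y(u,x1) w
     = x2^(-1) \<delta>((x1 - x0)/x2) Y(Y(u,x0)v, x2) w\<close>
  is stated coefficientwise. With the binomial expansion convention, the coefficient of
  \<open>x0^(-l-1) x1^(-m-1) x2^(-h-1)\<close> is the identity below, where \<open>p i\<close>, \<open>q i\<close>, \<open>r i\<close> are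
  \<open>u\<^sub>(m+l-i) v\<^sub>(h+i) w\<close>, \<open>v\<^sub>(h+l-i) u\<^sub>(m+i) w\<close> and \<open>(u\<^sub>(l+i) v)\<^sub>(m+h-i) w\<close>.
  On the right \<open>(-1)^i ((i-m-1) gchoose i) = m gchoose i\<close> has been used.
  All sums are finite by lower truncation.
\<close>

definition jacobi_coeff ::
  "(complex \<Rightarrow> 'w::ab_group_add \<Rightarrow> 'w) \<Rightarrow> int \<Rightarrow> int \<Rightarrow> (nat \<Rightarrow> 'w) \<Rightarrow> (nat \<Rightarrow> 'w) \<Rightarrow> (nat \<Rightarrow> 'w) \<Rightarrow> bool"
  where "jacobi_coeff s l m p q r \<longleftrightarrow>
    Sum_any (\<lambda>i. s ((-1) ^ i * ((of_int l :: complex) gchoose i)) (p i))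
    - Sum_any (\<lambda>i. s ((-1) powi l * (-1) ^ i * ((of_int l :: complex) gchoose i)) (q i))
    = Sum_any (\<lambda>i. s ((of_int m :: complex) gchoose i) (r i))"

text \<open>The axioms shared by the action of \<open>V\<close> on itself and on a (generalized) module.\<close>

locale vertex_action =
  fixes V :: "('v::ab_group_add, 'm) vertex_data_scheme"
    and M :: "('v, 'w::ab_group_add, 'n) vmod_scheme"
  assumes vector_space_algebra: "vector_space (vscale V)"
    and vector_space_ambient: "vector_space (scale M)"
    and subspace_carrier: "module.subspace (scale M) (carrier M)"
    and act_closed: "w \<in> carrier M \<Longrightarrow> act M v n w \<in> carrier M"
    and act_linear: "linear_on (scale M) (scale M) (carrier M) (act M v n)"
    and act_linear_left: "w \<in> carrier M \<Longrightarrow> Vector_Spaces.linear (vscale V) (scale M) (\<lambda>v. act M v n w)"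
    and lower_truncation: "w \<in> carrier M \<Longrightarrow> \<exists>N. \<forall>n\<ge>N. act M v n w = 0"
    and vacuum_property: "w \<in> carrier M \<Longrightarrow> act M (vacuum V) n w = (if n = -1 then w else 0)"
    and jacobi: "w \<in> carrier M \<Longrightarrow> jacobi_coeff (scale M) l m
          (\<lambda>i. act M u (m + l - int i) (act M v (h + int i) w))
          (\<lambda>i. act M v (h + l - int i) (act M u (m + int i) w))
          (\<lambda>i. act M (mode V u (l + int i) v) (m + h - int i) w)"
    and virasoro: "w \<in> carrier M \<Longrightarrow>
          Lop V M j (Lop V M k w) - Lop V M k (Lop V M j w)
          = scale M (of_int (j - k)) (Lop V M (j + k) w)
            + scale M (if j + k = 0 then (of_int (j ^ 3 - j) / 12) * central V else 0) w"
    and L_minus1_derivative: "w \<in> carrier M \<Longrightarrow>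
          act M (Lop V (adjoint V) (-1) v) n w = scale M (- of_int n) (act M v (n - 1) w)"

locale conformal_vertex_algebra = vertex_action V "adjoint V"
  for V :: "('v::ab_group_add, 'm) vertex_data_scheme" +
  assumes weight_grading: "direct_sum_on (vscale V) UNIV UNIV (vweight V)"
    and vacuum_weight: "vacuum V \<in> vweight V 0"
    and conformal_weight: "conformal V \<in> vweight V 2"
    and creation: "n \<ge> 0 \<Longrightarrow> mode V v n (vacuum V) = 0" "mode V v (-1) (vacuum V) = v"
    and L0_weight: "v \<in> vweight V n \<Longrightarrow> Lop V (adjoint V) 0 v = vscale V (of_int n) v"

definition gweight ::
  "('v, 'm) vertex_data_scheme \<Rightarrow> ('v, 'w::ab_group_add, 'n) vmod_scheme \<Rightarrow> complex \<Rightarrow> 'w set"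
  where "gweight V M n = {w \<in> carrier M. \<exists>N. ((\<lambda>x. Lop V M 0 x - scale M n x) ^^ N) w = 0}"

locale generalized_module =
  conformal_vertex_algebra V + module_action: vertex_action V M
  for V :: "('v::ab_group_add, 'm) vertex_data_scheme"
    and M :: "('v, 'w::ab_group_add, 'n) vmod_scheme" +
  assumes module_weight_grading: "direct_sum_on (scale M) (carrier M) UNIV (gweight V M)"


section \<open>Strong gradings\<close>

text \<open>
  The type \<open>'a\<close> is the larger abelian group, which grades the modules; its subgroup \<open>A\<close> grades
  the algebra. \<open>Vg \<alpha>\<close> is only meaningful for \<open>\<alpha> \<in> A\<close>.
\<close>

locale strongly_graded_algebra = conformal_vertex_algebra V
  for V :: "('v::ab_group_add, 'm) vertex_data_scheme"
    and A :: "'a::ab_group_add set"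
    and Vg :: "'a \<Rightarrow> 'v set" +
  assumes subgroup: "0 \<in> A" "\<alpha> \<in> A \<Longrightarrow> \<beta> \<in> A \<Longrightarrow> \<alpha> + \<beta> \<in> A" "\<alpha> \<in> A \<Longrightarrow> - \<alpha> \<in> A"
    and degree_grading: "direct_sum_on (vscale V) UNIV A Vg"
    and compatible: "\<alpha> \<in> A \<Longrightarrow> direct_sum_on (vscale V) (Vg \<alpha>) UNIV (\<lambda>n. vweight V n \<inter> Vg \<alpha>)"
    and finite_dim_homogeneous: "\<alpha> \<in> A \<Longrightarrow> finite_dim (vscale V) (vweight V n \<inter> Vg \<alpha>)"
    and bounded_below: "\<alpha> \<in> A \<Longrightarrow> \<exists>N. \<forall>n<N. vweight V n \<inter> Vg \<alpha> = {0}"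
    and vacuum_degree: "vacuum V \<in> Vg 0"
    and conformal_degree: "conformal V \<in> Vg 0"
    and mode_degree: "\<alpha> \<in> A \<Longrightarrow> \<beta> \<in> A \<Longrightarrow> v \<in> Vg \<alpha> \<Longrightarrow> w \<in> Vg \<beta> \<Longrightarrow> mode V v l w \<in> Vg (\<alpha> + \<beta>)"

locale strongly_graded_module =
  strongly_graded_algebra V A Vg + generalized_module V M
  for V :: "('v::ab_group_add, 'm) vertex_data_scheme"
    and A :: "'a::ab_group_add set"
    and Vg :: "'a \<Rightarrow> 'v set"
    and M :: "('v, 'w::ab_group_add, 'n) vmod_scheme"
    and Wg :: "'a \<Rightarrow> 'w set" +
  assumes module_degree_grading: "direct_sum_on (scale M) (carrier M) UNIV Wg"
    and module_compatible: "direct_sum_on (scale M) (Wg \<beta>) UNIV (\<lambda>n. gweight V M n \<inter> Wg \<beta>)"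
    and module_finite_dim_homogeneous: "finite_dim (scale M) (gweight V M n \<inter> Wg \<beta>)"
    and module_bounded_below: "\<exists>K::int. \<forall>k<K. gweight V M (n + of_int k) \<inter> Wg \<beta> = {0}"
    and act_degree: "\<alpha> \<in> A \<Longrightarrow> v \<in> Vg \<alpha> \<Longrightarrow> w \<in> Wg \<beta> \<Longrightarrow> act M v l w \<in> Wg (\<alpha> + \<beta>)"

definition real_weights ::
  "('v, 'm) vertex_data_scheme \<Rightarrow> ('v, 'w::ab_group_add, 'n) vmod_scheme \<Rightarrow> bool"
  where "real_weights V M \<longleftrightarrow> (\<forall>n. n \<notin> \<real> \<longrightarrow> gweight V M n = {0})"

text \<open>
  The underlying space of the contragredient module: an element of the direct sum of the duals of
  the doubly homogeneous subspaces is a linear functional on the module that vanishes on all but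
  finitely many of them. The pairing is evaluation. The subspace of degree \<open>\<beta>\<close> consists of the
  functionals supported in degree \<open>-\<beta>\<close>. Values outside the carrier are irrelevant.
\<close>

definition contragredient ::
  "('v, 'm) vertex_data_scheme \<Rightarrow> ('v, 'w::ab_group_add, 'n) vmod_scheme \<Rightarrow> ('a \<Rightarrow> 'w set) \<Rightarrow> ('w \<Rightarrow> complex) set"
  where "contragredient V M Wg = {f. linear_on (scale M) (*) (carrier M) f \<and>
    finite {(\<beta>, n). \<exists>w \<in> gweight V M n \<inter> Wg \<beta>. f w \<noteq> 0}}"

definition contragredient_degree ::
  "('v, 'm) vertex_data_scheme \<Rightarrow> ('v, 'w::ab_group_add, 'n) vmod_scheme \<Rightarrow>
    ('a::ab_group_add \<Rightarrow> 'w set) \<Rightarrow> 'a \<Rightarrow> ('w \<Rightarrow> complex) set"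
  where "contragredient_degree V M Wg \<beta> =
    {f \<in> contragredient V M Wg. \<forall>\<gamma>. \<gamma> \<noteq> - \<beta> \<longrightarrow> (\<forall>w \<in> Wg \<gamma>. f w = 0)}"


section \<open>The cofiniteness condition\<close>

definition V_plus :: "('v::ab_group_add, 'm) vertex_data_scheme \<Rightarrow> 'v set"
  where "V_plus V = module.span (vscale V) (\<Union>n\<in>{0<..}. vweight V n)"

definition C1 ::
  "('v::ab_group_add, 'm) vertex_data_scheme \<Rightarrow> ('v, 'w::ab_group_add, 'n) vmod_scheme \<Rightarrow> 'w set"
  where "C1 V M = module.span (scale M) {act M u (-1) w | u w. u \<in> V_plus V \<and> w \<in> carrier M}"

text \<open>
  Finite-dimensionality of each quotient of \<open>Wg \<beta>\<close> by its subspace \<open>C1 V M \<inter> Wg \<beta>\<close>: finitely many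
  classes, represented by \<open>B\<close>, span the quotient.
\<close>

definition C1_cofinite ::
  "('v::ab_group_add, 'm) vertex_data_scheme \<Rightarrow> ('v, 'w::ab_group_add, 'n) vmod_scheme \<Rightarrow> ('a \<Rightarrow> 'w set) \<Rightarrow> bool"
  where "C1_cofinite V M Wg \<longleftrightarrow> (\<forall>\<beta>. \<exists>B. finite B \<and> B \<subseteq> Wg \<beta> \<and>
    Wg \<beta> \<subseteq> module.span (scale M) (B \<union> (C1 V M \<inter> Wg \<beta>)))"


section \<open>Patterns\<close>

text \<open>A partition of \<open>\<beta>\<close> is a finite multiset with sum \<open>\<beta>\<close>; partitions are compared up to zero entries.\<close>

definition nonzero_part :: "'a::zero multiset \<Rightarrow> 'a multiset"
  where "nonzero_part p = filter_mset (\<lambda>x. x \<noteq> 0) p"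

definition same_partition :: "'a::zero multiset \<Rightarrow> 'a multiset \<Rightarrow> bool"
  where "same_partition p q \<longleftrightarrow> nonzero_part p = nonzero_part q"

definition groupings :: "'a::comm_monoid_add multiset \<Rightarrow> 'a multiset set"
  where "groupings p = {image_mset sum_mset Q | Q. sum_mset Q = p \<and> {#} \<notin># Q}"

text \<open>
  \<open>P \<beta> w\<close> is the partition chosen for \<open>w \<in> Wg \<beta>\<close>. The predicate expresses that this choice arises
  from the recursive description of patterns; being inductive, it also says that the recursion
  terminates. A pattern is a single partition, so all terms of the chosen linear combination
  must yield the same one. For \<open>w = 0\<close> the empty combination is admitted, and then the only
  constraint is that \<open>P \<beta> 0\<close> is a partition of \<open>\<beta>\<close>.
\<close>

inductive pattern_of ::
  "('v::ab_group_add, 'm) vertex_data_scheme \<Rightarrow> 'a::ab_group_add set \<Rightarrow> ('a \<Rightarrow> 'v set) \<Rightarrow>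
    ('v, 'w::ab_group_add, 'n) vmod_scheme \<Rightarrow> ('a \<Rightarrow> 'w set) \<Rightarrow> ('a \<Rightarrow> 'w \<Rightarrow> 'a multiset) \<Rightarrow>
    'a \<Rightarrow> 'w \<Rightarrow> bool"
  for V A Vg M Wg P
  where
    not_in_C1: "w \<in> Wg \<beta> \<Longrightarrow> w \<notin> C1 V M \<Longrightarrow> sum_mset (P \<beta> w) = \<beta> \<Longrightarrow>
      same_partition (P \<beta> w) {#\<beta>#} \<Longrightarrow> pattern_of V A Vg M Wg P \<beta> w"
  | in_C1: "w \<in> Wg \<beta> \<Longrightarrow> w \<in> C1 V M \<Longrightarrow> sum_mset (P \<beta> w) = \<beta> \<Longrightarrow>
      w = (\<Sum>i<N. scale M (c i) (act M (u i) (-1) (w' i))) \<Longrightarrow>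
      (\<And>i. i < N \<Longrightarrow> \<alpha> i \<in> A \<and> u i \<in> V_plus V \<inter> Vg (\<alpha> i) \<and> w' i \<in> Wg (\<beta> - \<alpha> i)) \<Longrightarrow>
      (\<And>i. i < (N::nat) \<Longrightarrow> pattern_of V A Vg M Wg P (\<beta> - \<alpha> i) (w' i)) \<Longrightarrow>
      (\<And>i. i < N \<Longrightarrow> same_partition (P \<beta> w) (add_mset (\<alpha> i) (P (\<beta> - \<alpha> i) (w' i)))) \<Longrightarrow>
      pattern_of V A Vg M Wg P \<beta> w"

definition pattern_assignment ::
  "('v::ab_group_add, 'm) vertex_data_scheme \<Rightarrow> 'a::ab_group_add set \<Rightarrow> ('a \<Rightarrow> 'v set) \<Rightarrow>
    ('v, 'w::ab_group_add, 'n) vmod_scheme \<Rightarrow> ('a \<Rightarrow> 'w set) \<Rightarrow> ('a \<Rightarrow> 'w \<Rightarrow> 'a multiset) \<Rightarrow> bool"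
  where "pattern_assignment V A Vg M Wg P \<longleftrightarrow> (\<forall>\<beta>. \<forall>w \<in> Wg \<beta>. pattern_of V A Vg M Wg P \<beta> w)"

definition patterns_preserved ::
  "'a::ab_group_add set \<Rightarrow> ('a \<Rightarrow> 'v set) \<Rightarrow>
    ('v, 'w::ab_group_add, 'n) vmod_scheme \<Rightarrow> ('a \<Rightarrow> 'w set) \<Rightarrow> ('a \<Rightarrow> 'w \<Rightarrow> 'a multiset) \<Rightarrow> bool"
  where "patterns_preserved A Vg M Wg P \<longleftrightarrow>
    (\<forall>\<alpha>\<in>A. \<forall>\<beta>. \<forall>u \<in> Vg \<alpha>. \<forall>w \<in> Wg \<beta>. \<forall>k.
       \<exists>p \<in> groupings (add_mset \<alpha> (P \<beta> w)). same_partition (P (\<alpha> + \<beta>) (act M u k w)) p)"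


section \<open>Logarithmic intertwining operators\<close>

text \<open>
  \<open>Y w1 n k w2\<close> is the coefficient of \<open>x^(-n-1) (log x)^k\<close>. For each power of \<open>x\<close> only finitely
  many powers of \<open>log x\<close> occur. The Jacobi identity is the coefficient of
  \<open>x0^(-l-1) x1^(-m-1) x2^(-h-1) (log x2)^k\<close>, with \<open>h\<close> complex.
\<close>

locale log_intertwining_operator =
  fixes V :: "('v::ab_group_add, 'm) vertex_data_scheme"
    and M1 M2 M3 :: "('v, 'w::ab_group_add, 'n) vmod_scheme"
    and Y :: "'w \<Rightarrow> complex \<Rightarrow> nat \<Rightarrow> 'w \<Rightarrow> 'w"
  assumes closed: "w1 \<in> carrier M1 \<Longrightarrow> w2 \<in> carrier M2 \<Longrightarrow> Y w1 n k w2 \<in> carrier M3"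
    and linear_right: "w1 \<in> carrier M1 \<Longrightarrow> linear_on (scale M2) (scale M3) (carrier M2) (Y w1 n k)"
    and linear_left: "w2 \<in> carrier M2 \<Longrightarrow>
          linear_on (scale M1) (scale M3) (carrier M1) (\<lambda>w1. Y w1 n k w2)"
    and log_polynomial: "w1 \<in> carrier M1 \<Longrightarrow> w2 \<in> carrier M2 \<Longrightarrow> finite {k. Y w1 n k w2 \<noteq> 0}"
    and lower_truncation: "w1 \<in> carrier M1 \<Longrightarrow> w2 \<in> carrier M2 \<Longrightarrow>
          \<exists>N::nat. \<forall>j\<ge>N. \<forall>k. Y w1 (n + of_nat j) k w2 = 0"
    and jacobi: "w1 \<in> carrier M1 \<Longrightarrow> w2 \<in> carrier M2 \<Longrightarrow> jacobi_coeff (scale M3) l m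
          (\<lambda>i. act M3 v (m + l - int i) (Y w1 (h + of_nat i) k w2))
          (\<lambda>i. Y w1 (h + of_int l - of_nat i) k (act M2 v (m + int i) w2))
          (\<lambda>i. Y (act M1 v (l + int i) w1) (of_int m + h - of_nat i) k w2)"
    and L_minus1_derivative: "w1 \<in> carrier M1 \<Longrightarrow> w2 \<in> carrier M2 \<Longrightarrow>
          Y (Lop V M1 (-1) w1) n k w2
          = scale M3 (- n) (Y w1 (n - 1) k w2) + scale M3 (of_nat (k + 1)) (Y w1 (n - 1) (k + 1) w2)"


section \<open>Formal series in several variables and the coefficient ring\<close>

text \<open>
  A formal series in \<open>z\<^sub>1,\<dots>,z\<^sub>n\<close> and their logarithms is given by its coefficients: \<open>\<phi> e k\<close> is the
  coefficient of \<open>\<Prod>i. z\<^sub>i^(e i) (log z\<^sub>i)^(k i)\<close>. Only the values of \<open>e\<close> and \<open>k\<close> on \<open>{1..n}\<close> matter.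
\<close>

type_synonym log_series = "(nat \<Rightarrow> complex) \<Rightarrow> (nat \<Rightarrow> nat) \<Rightarrow> complex"

definition dz :: "nat \<Rightarrow> log_series \<Rightarrow> log_series"
  where "dz l \<phi> e k =
    (e l + 1) * \<phi> (e(l := e l + 1)) k + of_nat (k l + 1) * \<phi> (e(l := e l + 1)) (k(l := k l + 1))"

definition correlator ::
  "nat \<Rightarrow> ('w \<Rightarrow> complex) \<Rightarrow> (nat \<Rightarrow> 'w \<Rightarrow> complex \<Rightarrow> nat \<Rightarrow> 'w \<Rightarrow> 'w) \<Rightarrow> (nat \<Rightarrow> 'w) \<Rightarrow> log_series"
  where "correlator n w0 Y w e k =
    w0 (foldr (\<lambda>i. Y i (w i) (- e i - 1) (k i)) [1..<n + 1] (w (n + 1)))"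

text \<open>
  An element of \<open>\<complex>[z\<^sub>i^\<plusminus>1, (z\<^sub>i - z\<^sub>j)^(-1)]\<close> is written as a finite linear combination of products
  \<open>(\<Prod>i. z\<^sub>i^(e i)) (\<Prod>(i,j). (z\<^sub>i - z\<^sub>j)^(-N (i,j)))\<close>, with the pairs satisfying \<open>i < j\<close>. Such an
  expression is not unique, but \<open>expand\<close> depends only on the rational function it represents,
  so quantifying existentially over expressions is quantifying over elements of the ring.
\<close>

type_synonym ring_expr = "((nat \<Rightarrow>\<^sub>0 int) \<times> (nat \<times> nat \<Rightarrow>\<^sub>0 nat)) \<Rightarrow>\<^sub>0 complex"

definition coeff_ring :: "nat \<Rightarrow> ring_expr set"
  where "coeff_ring n = {a. \<forall>(e, N) \<in> Poly_Mapping.keys a.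
    Poly_Mapping.keys e \<subseteq> {1..n} \<and> Poly_Mapping.keys N \<subseteq> {(i, j). 1 \<le> i \<and> i < j \<and> j \<le> n}}"

text \<open>
  Expansion in the region \<open>|z\<^sub>1| > \<dots> > |z\<^sub>n| > 0\<close>: for \<open>i < j\<close> and \<open>N \<ge> 1\<close>,
  \<open>(z\<^sub>i - z\<^sub>j)^(-N) = (\<Sum>\<kappa>\<ge>0. ((N + \<kappa> - 1) choose \<kappa>) z\<^sub>i^(-N-\<kappa>) z\<^sub>j^\<kappa>)\<close>.
  \<open>expand a d\<close> is the resulting coefficient of \<open>\<Prod>i. z\<^sub>i^(d i)\<close>; for \<open>a \<in> coeff_ring n\<close> only
  finitely many families \<open>\<kappa>\<close> contribute to it.
\<close>

definition expansion_exponent ::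
  "(nat \<times> nat \<Rightarrow>\<^sub>0 nat) \<Rightarrow> (nat \<times> nat \<Rightarrow>\<^sub>0 nat) \<Rightarrow> nat \<Rightarrow>\<^sub>0 int"
  where "expansion_exponent N \<kappa> = (\<Sum>(i, j)\<in>Poly_Mapping.keys N.
    Poly_Mapping.single i (- int (Poly_Mapping.lookup N (i, j)) - int (Poly_Mapping.lookup \<kappa> (i, j)))
    + Poly_Mapping.single j (int (Poly_Mapping.lookup \<kappa> (i, j))))"

definition expand :: "ring_expr \<Rightarrow> (nat \<Rightarrow>\<^sub>0 int) \<Rightarrow> complex"
  where "expand a d = (\<Sum>(e, N)\<in>Poly_Mapping.keys a. Poly_Mapping.lookup a (e, N) *
    (\<Sum>\<kappa> | Poly_Mapping.keys \<kappa> \<subseteq> Poly_Mapping.keys N \<and> d = e + expansion_exponent N \<kappa>.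
      \<Prod>p\<in>Poly_Mapping.keys N. of_nat ((Poly_Mapping.lookup N p + Poly_Mapping.lookup \<kappa> p - 1) choose Poly_Mapping.lookup \<kappa> p)))"

definition product_term :: "ring_expr \<Rightarrow> log_series \<Rightarrow> (nat \<Rightarrow> complex) \<Rightarrow> (nat \<Rightarrow> nat) \<Rightarrow> (nat \<Rightarrow>\<^sub>0 int) \<Rightarrow> complex"
  where "product_term a \<phi> e k d = expand a d * \<phi> (\<lambda>i. e i - of_int (Poly_Mapping.lookup d i)) k"

definition product_defined :: "ring_expr \<Rightarrow> log_series \<Rightarrow> bool"
  where "product_defined a \<phi> \<longleftrightarrow> (\<forall>e k. finite {d. product_term a \<phi> e k d \<noteq> 0})"

definition product :: "ring_expr \<Rightarrow> log_series \<Rightarrow> log_series"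
  where "product a \<phi> e k = Sum_any (product_term a \<phi> e k)"

text \<open>\<open>\<partial>\<^sub>l^m \<phi> + (\<Sum>k=1..m. a k l \<partial>\<^sub>l^(m-k) \<phi>) = 0\<close> for \<open>l = 1,\<dots>,n\<close>, as formal series.\<close>

definition satisfies_system :: "nat \<Rightarrow> nat \<Rightarrow> (nat \<Rightarrow> nat \<Rightarrow> ring_expr) \<Rightarrow> log_series \<Rightarrow> bool"
  where "satisfies_system n m a \<phi> \<longleftrightarrow> (\<forall>l\<in>{1..n}.
    (\<forall>k\<in>{1..m}. product_defined (a k l) ((dz l ^^ (m - k)) \<phi>)) \<and>
    (\<forall>e \<kappa>. (dz l ^^ m) \<phi> e \<kappa> + (\<Sum>k=1..m. product (a k l) ((dz l ^^ (m - k)) \<phi>) e \<kappa>) = 0))"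

end

theory Submission
  imports Defs "HOL-Library.Function_Algebras" "HOL-Library.FuncSet"
begin

text \<open>
  By the Jacobi identity, a correlator with \<open>u\<^sub>-\<^sub>1 w\<close> in one slot is a combination, over the ring
  \<open>R = \<complex>[z\<^sub>i\<^sup>\<plusminus>\<^sup>1, (z\<^sub>i - z\<^sub>j)\<^sup>-\<^sup>1]\<close>, of correlators in which \<open>u\<close> acts on another slot; for \<open>u \<in> V\<^sub>+\<close> this lowers the
  total weight. By \<open>C\<^sub>1\<close>-cofiniteness it can be repeated until the entries lie in finite-dimensional spaces,
  provided only finitely many degrees occur on the way. This is what the patterns give: the entries of the
  patterns of the initial elements are only redistributed among the slots. Hence all correlators with
  \<open>L(-1)\<^sup>k w\<^sub>l\<close> in slot \<open>l\<close>, that is, all derivatives of the given series, lie in one finitely generated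
  \<open>R\<close>-module, and since \<open>R\<close> is Noetherian some derivative is an \<open>R\<close>-combination of lower ones.

  The functional \<open>w\<^sub>0'\<close> is never reduced: its weight only decreases, so it stays in a finite-dimensional space. As
  patterns are neither linear nor compatible with weights, the reduction is applied to the spans of the weight
  components of all elements whose pattern is coarser than a given one. If \<open>C\<^sub>1\<close> contains a whole degree,
  these spans reduce termwise. Otherwise every element of that degree and of weight \<open>b\<close> is
  obtained from the bracket of \<open>L(N)\<close> and \<open>L(-N)\<close> for large \<open>N\<close>, up to finitely many \<open>b\<close>, and such elements are
  combinations of elements with trivial pattern.
\<close>

section \<open>Noetherian property of commuting operators\<close>

text \<open>Termination rests on an integer. When \<open>u\<close> of weight a >= 1 is taken off one
  slot and acts on another through a mode \<open>u_i\<close> with i >= 0, the total weight changes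
  by -a + (a - i - 1) < 0. The weight in each slot stays in one coset of the integers, so lower
  boundedness in finitely many degrees ends the process. The derivatives start at unbounded weights,
  but the generators found depend only on the cosets and on the partition to be distributed, so one
  finite set serves all derivatives.

  The obstacle is that a pattern describes a decomposition only of an element of \<open>C1\<close>.
  A weight component of x may lie in \<open>C1\<close> while x does not; then the pattern of x is
  trivial and yields no decomposition of the component. For L(k) z in \<open>C1\<close> with z
  outside, preservation does yield one, compatible with any partition of the degree. This is why the
  Virasoro bracket enters: on weight b, [L(N), L(-N)] is 2Nb + (N^3 - N)c/12 up to a locally
  nilpotent operator. The scalar vanishes for all N only if b = c = 0, so b = 0 is set
  aside.\<close>

inductive_set opspan ::
  "(complex \<Rightarrow> 'x::ab_group_add \<Rightarrow> 'x) \<Rightarrow> ('x \<Rightarrow> 'x) set \<Rightarrow> 'x set \<Rightarrow> 'x set"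
  for s T S
  where
    base: "x \<in> S \<Longrightarrow> x \<in> opspan s T S"
  | zero: "0 \<in> opspan s T S"
  | add: "x \<in> opspan s T S \<Longrightarrow> y \<in> opspan s T S \<Longrightarrow> x + y \<in> opspan s T S"
  | scale: "x \<in> opspan s T S \<Longrightarrow> s c x \<in> opspan s T S"
  | op: "f \<in> T \<Longrightarrow> x \<in> opspan s T S \<Longrightarrow> f x \<in> opspan s T S"

definition invariant_subspace ::
  "(complex \<Rightarrow> 'x::ab_group_add \<Rightarrow> 'x) \<Rightarrow> ('x \<Rightarrow> 'x) set \<Rightarrow> 'x set \<Rightarrow> bool"
  where "invariant_subspace s T U \<longleftrightarrow> module.subspace s U \<and> (\<forall>f\<in>T. \<forall>x\<in>U. f x \<in> U)"

text \<open>Linearity and commutation are asked on \<open>U\<close> only, because multiplication by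
  an infinite expansion is meaningful only on series with enough truncation.\<close>

definition commuting_on ::
  "(complex \<Rightarrow> 'x::ab_group_add \<Rightarrow> 'x) \<Rightarrow> ('x \<Rightarrow> 'x) set \<Rightarrow> 'x set \<Rightarrow> bool"
  where "commuting_on s T U \<longleftrightarrow> (\<forall>f\<in>T. linear_on s s U f \<and> (\<forall>g\<in>T. \<forall>x\<in>U. f (g x) = g (f x)))"

lemma opspan_least:
  assumes "vector_space s" "invariant_subspace s T U" "S \<subseteq> U"
  shows "opspan s T S \<subseteq> U"
proof
  interpret vector_space s by fact
  fix x assume "x \<in> opspan s T S"
  then show "x \<in> U"
    by induction (use assms in \<open>auto simp: invariant_subspace_def subspace_def\<close>)
qed

lemma opspan_invariant: "vector_space s \<Longrightarrow> invariant_subspace s T (opspan s T S)"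
proof -
  assume "vector_space s"
  then interpret vector_space s .
  show ?thesis
    unfolding invariant_subspace_def subspace_def by (auto intro: opspan.intros)
qed

lemma opspan_mono: "T \<subseteq> T' \<Longrightarrow> S \<subseteq> S' \<Longrightarrow> x \<in> opspan s T S \<Longrightarrow> x \<in> opspan s T' S'"
  by (rotate_tac 2, induction rule: opspan.induct) (auto intro: opspan.intros)

lemma opspan_subset_opspan:
  "vector_space s \<Longrightarrow> S \<subseteq> opspan s T S' \<Longrightarrow> opspan s T S \<subseteq> opspan s T S'"
  by (rule opspan_least) (auto intro: opspan_invariant)

lemma opspan_diff:
  assumes "vector_space s" "x \<in> opspan s T S" "y \<in> opspan s T S"
  shows "x - y \<in> opspan s T S"
proof -
  interpret vector_space s by fact
  show ?thesis
    using assms opspan_invariant[of s T S] subspace_diff by (auto simp: invariant_subspace_def)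
qed

lemma opspan_sum:
  "(\<And>i. i \<in> I \<Longrightarrow> g i \<in> opspan s T S) \<Longrightarrow> (\<Sum>i\<in>I. g i) \<in> opspan s T S"
  by (induction I rule: infinite_finite_induct) (auto intro: opspan.intros)

lemma opspan_funpow: "f \<in> T \<Longrightarrow> x \<in> opspan s T S \<Longrightarrow> (f ^^ k) x \<in> opspan s T S"
  by (induction k) (auto intro: opspan.intros)

lemma opspan_finite_subset:
  assumes "x \<in> opspan s T S"
  shows "\<exists>F. finite F \<and> F \<subseteq> S \<and> x \<in> opspan s T F"
  using assms
proof induction
  case (base x)
  then show ?case by (intro exI[of _ "{x}"]) (auto intro: opspan.base)
next
  case zero
  then show ?case by (intro exI[of _ "{}"]) (auto intro: opspan.zero)
next
  case (add x y)
  then obtain F G where "finite F" "F \<subseteq> S" "x \<in> opspan s T F" "finite G" "G \<subseteq> S" "y \<in> opspan s T G"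
    by blast
  then show ?case
    by (intro exI[of _ "F \<union> G"]) (auto intro!: opspan.add intro: opspan_mono[where T' = T and S' = "F \<union> G"])
qed (auto intro: opspan.intros)

text \<open>This is Hilbert's basis theorem: adjoining one more commuting operator \<open>t\<close> to \<open>T\<close>, the
  leading coefficients of degree \<open>k\<close> in \<open>t\<close> form an increasing chain of \<open>T\<close>-invariant subspaces.
  The powers of \<open>t\<close> need not be independent.\<close>

theorem commuting_operators_noetherian:
  assumes vs: "vector_space s" and "finite T"
    and "invariant_subspace s T U" "commuting_on s T U"
    and "finite S" "S \<subseteq> U" "invariant_subspace s T U'" "U' \<subseteq> opspan s T S"
  shows "\<exists>S'. finite S' \<and> U' = opspan s T S'"
  using assms(2-)
proof (induction T arbitrary: U' S rule: finite_induct)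
  case empty
  interpret vector_space s by fact
  have "opspan s {} S \<subseteq> span S"
    by (rule opspan_least) (auto simp: vs invariant_subspace_def span_base)
  with empty.prems have sub: "U' \<subseteq> span S" by auto
  obtain B where B: "B \<subseteq> U'" "independent B" "U' \<subseteq> span B"
    using basis_exists[of U'] by metis
  have "finite B"
    using independent_span_bound[OF empty.prems(3) B(2)] B(1) sub by auto
  moreover have "U' = opspan s {} B"
  proof
    show "opspan s {} B \<subseteq> U'" using opspan_least[OF vs empty.prems(5) B(1)] .
    have "span B \<subseteq> opspan s {} B"
      using opspan_invariant[OF vs, of "{}" B]
      by (intro span_minimal) (auto simp: invariant_subspace_def intro: opspan.base)
    with B(3) show "U' \<subseteq> opspan s {} B" by auto
  qed
  ultimately show ?case by auto
next
  case (insert t T)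
  interpret vector_space s by fact
  define U0 where "U0 = opspan s T S"
  have Usub: "subspace U" and Uinv: "\<And>f x. f \<in> insert t T \<Longrightarrow> x \<in> U \<Longrightarrow> f x \<in> U"
    using insert.prems(1) by (auto simp: invariant_subspace_def)
  have lin_add: "\<And>f x y. f \<in> insert t T \<Longrightarrow> x \<in> U \<Longrightarrow> y \<in> U \<Longrightarrow> f (x + y) = f x + f y"
    and lin_scale: "\<And>f c x. f \<in> insert t T \<Longrightarrow> x \<in> U \<Longrightarrow> f (s c x) = s c (f x)"
    and comm: "\<And>f g x. f \<in> insert t T \<Longrightarrow> g \<in> insert t T \<Longrightarrow> x \<in> U \<Longrightarrow> f (g x) = g (f x)"
    using insert.prems(2) unfolding commuting_on_def linear_on_def by blast+
  have U0_inv: "invariant_subspace s T U0" unfolding U0_def by (rule opspan_invariant[OF vs])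
  have U0_sub: "subspace U0" and U0_op: "\<And>f x. f \<in> T \<Longrightarrow> x \<in> U0 \<Longrightarrow> f x \<in> U0"
    using U0_inv by (auto simp: invariant_subspace_def)
  have inv_T: "invariant_subspace s T U" and comm_T: "commuting_on s T U"
    using insert.prems(1,2) by (auto simp: invariant_subspace_def commuting_on_def)
  have U0_U: "U0 \<subseteq> U"
    unfolding U0_def by (rule opspan_least[OF vs inv_T insert.prems(4)])
  have U'_sub: "subspace U'" and U'_op: "\<And>f x. f \<in> insert t T \<Longrightarrow> x \<in> U' \<Longrightarrow> f x \<in> U'"
    using insert.prems(5) by (auto simp: invariant_subspace_def)
  have tU: "(t ^^ k) x \<in> U" if "x \<in> U" for k x
    using that by (induction k) (auto intro: Uinv)
  have t_add: "(t ^^ k) (x + y) = (t ^^ k) x + (t ^^ k) y" if "x \<in> U" "y \<in> U" for k x y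
    using that by (induction k) (auto simp: lin_add tU)
  have t_scale: "(t ^^ k) (s c x) = s c ((t ^^ k) x)" if "x \<in> U" for k x c
    using that by (induction k) (auto simp: lin_scale tU)
  have f_0: "f 0 = 0" if "f \<in> insert t T" for f
    using lin_scale[OF that subspace_0[OF Usub], of 0] by simp
  have t_0: "(t ^^ k) 0 = 0" for k by (induction k) (auto simp: f_0)
  have t_comm: "f ((t ^^ k) x) = (t ^^ k) (f x)" if "x \<in> U" "f \<in> insert t T" for k x f
    using that
  proof (induction k)
    case (Suc k)
    then show ?case using comm[of f t "(t ^^ k) x"] tU by simp
  qed simp
  have f_sum: "f (\<Sum>j\<in>J. h j) = (\<Sum>j\<in>J. f (h j))" if "f \<in> insert t T" "\<And>j. j \<in> J \<Longrightarrow> h j \<in> U"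
    for f J and h :: "nat \<Rightarrow> 'a"
    using that(2)
  proof (induction J rule: infinite_finite_induct)
    case (insert a F)
    moreover have "sum h F \<in> U" using insert.prems by (intro subspace_sum[OF Usub]) auto
    ultimately show ?case by (simp add: lin_add[OF that(1)])
  qed (auto simp: f_0[OF that(1)])
  \<comment> \<open>Polynomials in \<open>t\<close> of degree below \<open>k\<close> with
    coefficients in \<open>U0\<close>. As such a presentation is not unique, every statement below
    asks for the existence of one.\<close>
  define F where "F k = {x. \<exists>g. (\<forall>j<k. g j \<in> U0) \<and> x = (\<Sum>j<k. (t ^^ j) (g j))}" for k :: nat
  have F_U: "F k \<subseteq> U" for k
    unfolding F_def using U0_U tU by (auto intro!: subspace_sum[OF Usub])
  have F_zero: "0 \<in> F k" for k
    unfolding F_def by (auto intro!: exI[of _ "\<lambda>_. 0"] simp: t_0 subspace_0[OF U0_sub])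
  have F_add: "x + y \<in> F k" if xy: "x \<in> F k" "y \<in> F k" for k x y
  proof -
    obtain g h where "\<forall>j<k. g j \<in> U0" "x = (\<Sum>j<k. (t ^^ j) (g j))"
      "\<forall>j<k. h j \<in> U0" "y = (\<Sum>j<k. (t ^^ j) (h j))"
      using xy unfolding F_def by auto
    moreover have "(\<Sum>j<k. (t ^^ j) (g j)) + (\<Sum>j<k. (t ^^ j) (h j)) = (\<Sum>j<k. (t ^^ j) (g j + h j))"
      unfolding sum.distrib[symmetric]
      using U0_U calculation(1,3) by (intro sum.cong) (auto simp: t_add subset_iff)
    ultimately show ?thesis
      unfolding F_def using subspace_add[OF U0_sub] by (auto intro!: exI[of _ "\<lambda>j. g j + h j"])
  qed
  have F_scale: "s c x \<in> F k" if x: "x \<in> F k" for k x c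
  proof -
    obtain g where g: "\<forall>j<k. g j \<in> U0" "x = (\<Sum>j<k. (t ^^ j) (g j))"
      using x unfolding F_def by auto
    moreover have "s c (\<Sum>j<k. (t ^^ j) (g j)) = (\<Sum>j<k. (t ^^ j) (s c (g j)))"
      unfolding scale_sum_right using U0_U g(1) by (intro sum.cong) (auto simp: t_scale subset_iff)
    ultimately show ?thesis
      unfolding F_def using subspace_scale[OF U0_sub] by (auto intro!: exI[of _ "\<lambda>j. s c (g j)"])
  qed
  have F_sub: "subspace (F k)" for k
    unfolding subspace_def using F_zero F_add F_scale by blast
  have F_op: "f x \<in> F k" if x: "x \<in> F k" and f: "f \<in> T" for k x f
  proof -
    obtain g where g: "\<forall>j<k. g j \<in> U0" "x = (\<Sum>j<k. (t ^^ j) (g j))"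
      using x unfolding F_def by auto
    have "f x = (\<Sum>j<k. (t ^^ j) (f (g j)))"
      unfolding g(2) using g(1) U0_U f
      by (subst f_sum) (auto intro!: sum.cong tU simp: t_comm subset_iff)
    then show ?thesis
      unfolding F_def using g(1) U0_op[OF f] by (auto intro!: exI[of _ "\<lambda>j. f (g j)"])
  qed
  have F_Suc: "x \<in> F (Suc k) \<longleftrightarrow> (\<exists>y\<in>F k. \<exists>z\<in>U0. x = (t ^^ k) z + y)" for x k
  proof
    assume "x \<in> F (Suc k)"
    then obtain g where "\<forall>j<Suc k. g j \<in> U0" "x = (\<Sum>j<Suc k. (t ^^ j) (g j))"
      unfolding F_def by auto
    moreover from this have "(\<Sum>j<k. (t ^^ j) (g j)) \<in> F k" unfolding F_def by (intro CollectI exI[of _ g]) simp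
    ultimately show "\<exists>y\<in>F k. \<exists>z\<in>U0. x = (t ^^ k) z + y"
      by (metis add.commute lessI sum.lessThan_Suc)
  next
    assume "\<exists>y\<in>F k. \<exists>z\<in>U0. x = (t ^^ k) z + y"
    then obtain g z where "\<forall>j<k. g j \<in> U0" "z \<in> U0" "x = (t ^^ k) z + (\<Sum>j<k. (t ^^ j) (g j))"
      unfolding F_def by auto
    then show "x \<in> F (Suc k)"
      unfolding F_def by (auto intro!: exI[of _ "g(k := z)"] simp: add.commute)
  qed
  have F_t: "t x \<in> F (Suc k)" if x: "x \<in> F k" for k x
  proof -
    obtain g where g: "\<forall>j<k. g j \<in> U0" "x = (\<Sum>j<k. (t ^^ j) (g j))"
      using x unfolding F_def by auto
    have "t x = (\<Sum>j<k. t ((t ^^ j) (g j)))"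
      unfolding g(2) using g(1) U0_U by (intro f_sum) (auto intro!: tU)
    also have "\<dots> = (\<Sum>j<Suc k. (t ^^ j) (case j of 0 \<Rightarrow> 0 | Suc i \<Rightarrow> g i))"
      unfolding sum.lessThan_Suc_shift by simp
    finally show ?thesis
      unfolding F_def using g(1) subspace_0[OF U0_sub]
      by (intro CollectI exI[of _ "\<lambda>j. case j of 0 \<Rightarrow> 0 | Suc i \<Rightarrow> g i"]) (auto split: nat.split)
  qed
  have F_tt: "(t ^^ m) x \<in> F (m + k)" if x: "x \<in> F k" for k x m
    using x by (induction m) (auto intro: F_t)
  have F_mono: "F k \<subseteq> F (Suc k)" for k
    using F_Suc subspace_0[OF U0_sub] t_0 by fastforce
  have F_mono': "F k \<subseteq> F k'" if "k \<le> k'" for k k'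
    using lift_Suc_mono_le[of F, OF F_mono that] .
  \<comment> \<open>Leading coefficients in degree \<open>k\<close> of elements of
    \<open>U'\<close>, with respect to any presentation.\<close>
  define L where "L k = {x \<in> U0. \<exists>y\<in>F k. (t ^^ k) x + y \<in> U'}" for k
  have L_inv: "invariant_subspace s T (L k)" for k
    unfolding invariant_subspace_def
  proof (intro conjI ballI)
    show "subspace (L k)"
      unfolding subspace_def
    proof (intro conjI ballI allI)
      show "0 \<in> L k"
        unfolding L_def using subspace_0[OF U0_sub] subspace_0[OF U'_sub] F_zero[of k] t_0 by force
    next
      fix x y assume "x \<in> L k" "y \<in> L k"
      then obtain a b where ab: "x \<in> U0" "y \<in> U0" "a \<in> F k" "b \<in> F k"
        "(t ^^ k) x + a \<in> U'" "(t ^^ k) y + b \<in> U'"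
        unfolding L_def by auto
      have "(t ^^ k) (x + y) + (a + b) = ((t ^^ k) x + a) + ((t ^^ k) y + b)"
        using ab U0_U by (simp add: t_add subset_iff)
      then show "x + y \<in> L k"
        unfolding L_def using ab subspace_add[OF U'_sub] subspace_add[OF U0_sub] F_add
        by (metis (mono_tags, lifting) mem_Collect_eq)
    next
      fix c x assume "x \<in> L k"
      then obtain a where ab: "x \<in> U0" "a \<in> F k" "(t ^^ k) x + a \<in> U'"
        unfolding L_def by auto
      have "(t ^^ k) (s c x) + s c a = s c ((t ^^ k) x + a)"
        using ab U0_U by (simp add: t_scale subset_iff scale_right_distrib)
      then show "s c x \<in> L k"
        unfolding L_def using ab subspace_scale[OF U'_sub] subspace_scale[OF U0_sub] F_scale
        by (metis (mono_tags, lifting) mem_Collect_eq)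
    qed
  next
    fix f x assume f: "f \<in> T" and "x \<in> L k"
    then obtain a where ab: "x \<in> U0" "a \<in> F k" "(t ^^ k) x + a \<in> U'"
      unfolding L_def by auto
    have "(t ^^ k) (f x) + f a = f ((t ^^ k) x + a)"
      using ab U0_U F_U f by (subst lin_add) (auto simp: t_comm tU subset_iff)
    then show "f x \<in> L k"
      unfolding L_def using ab U'_op[of f] U0_op F_op f
      by (metis (mono_tags, lifting) insertCI mem_Collect_eq)
  qed
  have L_mono: "L k \<subseteq> L (Suc k)" for k
  proof
    fix x assume "x \<in> L k"
    then obtain a where ab: "x \<in> U0" "a \<in> F k" "(t ^^ k) x + a \<in> U'"
      unfolding L_def by auto
    have "(t ^^ Suc k) x + t a = t ((t ^^ k) x + a)"
      using ab U0_U F_U by (subst lin_add) (auto simp: tU subset_iff)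
    then show "x \<in> L (Suc k)"
      unfolding L_def using ab U'_op[of t] F_t[of a k]
      by (metis (mono_tags, lifting) insertCI mem_Collect_eq)
  qed
  have L_mono': "L k \<subseteq> L k'" if "k \<le> k'" for k k'
    using lift_Suc_mono_le[of L, OF L_mono that] .
  have L_U0: "L k \<subseteq> U0" for k unfolding L_def by auto
  have IH: "\<exists>S'. finite S' \<and> X = opspan s T S'" if "invariant_subspace s T X" "X \<subseteq> U0" for X
    using insert.IH[OF inv_T comm_T insert.prems(3,4) that(1)] that(2) unfolding U0_def by auto
  have "invariant_subspace s T (\<Union>k. L k)"
    unfolding invariant_subspace_def subspace_def
  proof (intro conjI ballI allI)
    show "0 \<in> (\<Union>k. L k)" using L_inv[of 0] by (auto simp: invariant_subspace_def subspace_def)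
  next
    fix x y assume "x \<in> (\<Union>k. L k)" "y \<in> (\<Union>k. L k)"
    then obtain i j where "x \<in> L i" "y \<in> L j" by auto
    then have "x \<in> L (max i j)" "y \<in> L (max i j)" by (meson L_mono' max.cobounded1 max.cobounded2 subsetD)+
    then show "x + y \<in> (\<Union>k. L k)" using L_inv[of "max i j"] by (auto simp: invariant_subspace_def subspace_def)
  next
    fix x c assume "x \<in> (\<Union>k. L k)"
    then show "s c x \<in> (\<Union>k. L k)" using L_inv by (auto simp: invariant_subspace_def subspace_def)
  next
    fix x f assume "x \<in> (\<Union>k. L k)" "f \<in> T"
    then show "f x \<in> (\<Union>k. L k)" using L_inv by (auto simp: invariant_subspace_def)
  qed
  \<comment> \<open>The induction hypothesis applies to the union of the chain; its finitely many
    generators already lie in some \<open>L K\<close>, so the chain is constant from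
    \<open>K\<close> on.\<close>
  then obtain S0 where S0: "finite S0" "(\<Union>k. L k) = opspan s T S0"
    using IH[of "\<Union>k. L k"] L_U0 by blast
  have S0_sub: "S0 \<subseteq> (\<Union>k. L k)" unfolding S0(2) by (auto intro: opspan.base)
  have "\<exists>K. S0 \<subseteq> L K"
    using S0(1) S0_sub
  proof (induction S0 rule: finite_induct)
    case (insert x S0)
    then obtain i j where "S0 \<subseteq> L i" "x \<in> L j" by auto
    then have "insert x S0 \<subseteq> L (max i j)"
      using L_mono'[of i "max i j"] L_mono'[of j "max i j"] by auto
    then show ?case by blast
  qed auto
  then obtain K where K: "S0 \<subseteq> L K" by auto
  have LK: "L k \<subseteq> L K" for k
    using opspan_least[OF vs L_inv K] S0(2) by auto
  have "\<forall>k. \<exists>S'. finite S' \<and> L k = opspan s T S'"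
    using IH L_inv L_U0 by auto
  then obtain G where G: "\<And>k. finite (G k)" "\<And>k. L k = opspan s T (G k)"
    by metis
  have "\<forall>k. \<forall>x\<in>G k. \<exists>y. y \<in> F k \<and> (t ^^ k) x + y \<in> U'"
    using G(2) opspan.base unfolding L_def by blast
  then obtain lift where lift: "\<And>k x. x \<in> G k \<Longrightarrow> lift k x \<in> F k"
    "\<And>k x. x \<in> G k \<Longrightarrow> (t ^^ k) x + lift k x \<in> U'"
    by metis
  \<comment> \<open>One element of \<open>U'\<close> for each generator of each leading coefficient
    space up to degree \<open>K\<close>.\<close>
  define S' where "S' = (\<Union>k\<le>K. (\<lambda>x. (t ^^ k) x + lift k x) ` G k)"
  have S'_U': "S' \<subseteq> U'" unfolding S'_def using lift by auto
  let ?O = "opspan s (insert t T) S'"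
  have O_U': "?O \<subseteq> U'" by (rule opspan_least[OF vs insert.prems(5) S'_U'])
  have O_lead: "\<exists>y\<in>F k. (t ^^ k) x + y \<in> ?O" if "k \<le> K" "x \<in> L k" for k x
    using that(2)[unfolded G(2)]
  proof induction
    case (base x)
    then have "(t ^^ k) x + lift k x \<in> S'" unfolding S'_def using that(1) by auto
    then show ?case using lift(1)[OF base] by (auto intro: opspan.base)
  next
    case zero
    then show ?case using F_zero[of k] by (intro bexI[of _ 0]) (auto simp: t_0 intro: opspan.zero)
  next
    case (add x y)
    then obtain a b where ab: "a \<in> F k" "b \<in> F k" "(t ^^ k) x + a \<in> ?O" "(t ^^ k) y + b \<in> ?O" by auto
    have "x \<in> U" "y \<in> U" using add.hyps G(2) L_U0 U0_U by blast+
    then have "(t ^^ k) (x + y) + (a + b) = ((t ^^ k) x + a) + ((t ^^ k) y + b)"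
      by (simp add: t_add)
    with opspan.add[OF ab(3,4)] have "(t ^^ k) (x + y) + (a + b) \<in> ?O" by (simp only:)
    then show ?case using F_add[OF ab(1,2)] by blast
  next
    case (scale x c)
    then obtain a where ab: "a \<in> F k" "(t ^^ k) x + a \<in> ?O" by auto
    have "x \<in> U" using scale.hyps G(2) L_U0 U0_U by blast
    then have "(t ^^ k) (s c x) + s c a = s c ((t ^^ k) x + a)"
      by (simp add: t_scale scale_right_distrib)
    with opspan.scale[OF ab(2), of c] have "(t ^^ k) (s c x) + s c a \<in> ?O" by (simp only:)
    then show ?case using F_scale[OF ab(1), of c] by blast
  next
    case (op f x)
    then obtain a where ab: "a \<in> F k" "(t ^^ k) x + a \<in> ?O" by auto
    have "x \<in> U" using op.hyps G(2) L_U0 U0_U by blast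
    then have "(t ^^ k) (f x) + f a = f ((t ^^ k) x + a)"
      using ab F_U op.hyps by (subst lin_add) (auto simp: t_comm tU subset_iff)
    with opspan.op[OF insertI2[OF op.hyps(1)] ab(2)] have "(t ^^ k) (f x) + f a \<in> ?O" by (simp only:)
    then show ?case using F_op[OF ab(1) op.hyps(1)] by blast
  qed
  have U'_F: "u \<in> ?O" if "u \<in> U'" "u \<in> F k" for u k
    using that
  proof (induction k arbitrary: u)
    case 0
    then show ?case by (auto simp: F_def intro: opspan.zero)
  next
    case (Suc k)
    obtain y x where yx: "y \<in> F k" "x \<in> U0" "u = (t ^^ k) x + y" using Suc.prems F_Suc by auto
    then have "x \<in> L k" unfolding L_def using Suc.prems by auto
    \<comment> \<open>Division with remainder: beyond degree \<open>K\<close> the leading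
      coefficient already occurs in degree \<open>K\<close>, and a power of \<open>t\<close> lifts
      the matching element to degree \<open>k\<close>. The difference has lower degree.\<close>
    define k' where "k' = min k K"
    have "x \<in> L k'" using \<open>x \<in> L k\<close> LK unfolding k'_def by (auto simp: min_def)
    then obtain y' where y': "y' \<in> F k'" "(t ^^ k') x + y' \<in> ?O"
      using O_lead[of k' x] unfolding k'_def by auto
    let ?z = "(t ^^ (k - k')) ((t ^^ k') x + y')"
    have z: "?z \<in> ?O" using y' by (intro opspan_funpow) auto
    have "x \<in> U" using yx U0_U by auto
    have "?z = (t ^^ (k - k')) ((t ^^ k') x) + (t ^^ (k - k')) y'"
      using y'(1) F_U[of k'] \<open>x \<in> U\<close> by (intro t_add tU) auto
    also have "(t ^^ (k - k')) ((t ^^ k') x) = (t ^^ k) x"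
      unfolding k'_def by (metis comp_apply funpow_add le_add_diff_inverse2 min.cobounded1)
    finally have "u - ?z = y - (t ^^ (k - k')) y'" using yx by simp
    moreover have "(t ^^ (k - k')) y' \<in> F k"
      using F_tt[OF y'(1), of "k - k'"] by (simp add: k'_def)
    ultimately have "u - ?z \<in> F k" using subspace_diff[OF F_sub yx(1)] by metis
    moreover have "u - ?z \<in> U'" using subspace_diff[OF U'_sub] Suc.prems O_U' z by auto
    ultimately have "u - ?z \<in> ?O" using Suc.IH by auto
    then have "(u - ?z) + ?z \<in> ?O" using z by (rule opspan.add)
    then show ?case by simp
  qed
  have all_F: "\<exists>k. x \<in> F k" if "x \<in> opspan s (insert t T) S" for x
    using that
  proof induction
    case (base x)
    then have "x \<in> U0" unfolding U0_def by (rule opspan.base)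
    then show ?case using F_Suc[of x 0] F_zero[of 0] by (intro exI[of _ 1]) force
  next
    case zero
    then show ?case using F_zero by auto
  next
    case (add x y)
    then obtain i j where "x \<in> F i" "y \<in> F j" by auto
    then have "x \<in> F (max i j)" "y \<in> F (max i j)" by (meson F_mono' max.cobounded1 max.cobounded2 subsetD)+
    then show ?case using F_add[of x "max i j" y] by auto
  next
    case (scale x c)
    then show ?case using F_scale by auto
  next
    case (op f x)
    then obtain k where "x \<in> F k" by auto
    with op.hyps show ?case using F_op[of x k f] F_t[of x k] by auto
  qed
  have "U' = ?O"
  proof (intro antisym O_U' subsetI)
    fix x assume "x \<in> U'"
    moreover from this obtain k where "x \<in> F k" using all_F insert.prems(6) by auto
    ultimately show "x \<in> ?O" by (rule U'_F)
  qed
  moreover have "finite S'" unfolding S'_def using G(1) by auto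
  ultimately show ?case by (intro exI[of _ S'] conjI)
qed

text \<open>The submodule generated by the whole sequence is finitely generated, and its generators
  involve only finitely many terms. The conclusion covers all large \<open>k\<close>, so that
  several sequences can share one order.\<close>

corollary opspan_sequence_stabilizes:
  assumes vs: "vector_space s" and T: "finite T" "invariant_subspace s T U" "commuting_on s T U"
    and S: "finite S" "S \<subseteq> U" and \<phi>: "\<And>k::nat. \<phi> k \<in> opspan s T S"
  shows "\<exists>m. \<forall>k\<ge>m. \<phi> k \<in> opspan s T (\<phi> ` {..<k})"
proof -
  let ?U = "opspan s T (range \<phi>)"
  have "?U \<subseteq> opspan s T S" using \<phi> by (intro opspan_subset_opspan[OF vs]) auto
  then obtain F where F: "finite F" "?U = opspan s T F"
    using commuting_operators_noetherian[OF vs T S opspan_invariant[OF vs]] by blast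
  have "\<exists>m. x \<in> opspan s T (\<phi> ` {..<m})" if "x \<in> ?U" for x
  proof -
    obtain G where G: "finite G" "G \<subseteq> range \<phi>" "x \<in> opspan s T G"
      using opspan_finite_subset[OF \<open>x \<in> ?U\<close>] by auto
    then obtain I where I: "finite I" "G = \<phi> ` I" using finite_subset_image by metis
    obtain m where "\<forall>i\<in>I. i < m" using I(1) unfolding finite_nat_set_iff_bounded ..
    then have "G \<subseteq> \<phi> ` {..<m}" unfolding I(2) by auto
    then have "x \<in> opspan s T (\<phi> ` {..<m})" by (rule opspan_mono[OF subset_refl _ G(3)])
    then show ?thesis ..
  qed
  then have "\<forall>x\<in>F. \<exists>m. x \<in> opspan s T (\<phi> ` {..<m})"
    unfolding F(2) by (auto intro: opspan.base)
  then obtain m where m: "\<And>x. x \<in> F \<Longrightarrow> x \<in> opspan s T (\<phi> ` {..<m x})" by metis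
  define M where "M = Max (insert 0 (m ` F))"
  have "\<phi> k \<in> opspan s T (\<phi> ` {..<k})" if "k \<ge> M" for k
  proof -
    have mk: "m x \<le> k" if "x \<in> F" for x
      using that F(1) \<open>k \<ge> M\<close> unfolding M_def by (meson Max_ge finite.insertI finite_imageI image_eqI insertI2 order_trans)
    have "F \<subseteq> opspan s T (\<phi> ` {..<k})"
    proof
      fix x assume "x \<in> F"
      then show "x \<in> opspan s T (\<phi> ` {..<k})"
        using mk[of x] by (intro opspan_mono[OF subset_refl _ m[of x]]) auto
    qed
    then have "?U \<subseteq> opspan s T (\<phi> ` {..<k})" unfolding F(2) by (rule opspan_subset_opspan[OF vs])
    then show ?thesis using opspan.base[of "\<phi> k" "range \<phi>"] by blast
  qed
  then show ?thesis by blast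
qed

section \<open>Formal series and expansions of rational functions\<close>

definition sscale :: "complex \<Rightarrow> log_series \<Rightarrow> log_series"
  where "sscale c \<phi> = (\<lambda>e k. c * \<phi> e k)"

lemma sscale_apply: "sscale c \<phi> e k = c * \<phi> e k"
  by (simp add: sscale_def)

lemma vector_space_sscale: "vector_space sscale"
  by unfold_locales (auto simp: fun_eq_iff algebra_simps sscale_def)

interpretation series: vector_space sscale
  by (rule vector_space_sscale)

section \<open>Multiplication by monomials, and truncated series\<close>

definition mulz :: "(nat \<Rightarrow>\<^sub>0 int) \<Rightarrow> log_series \<Rightarrow> log_series"
  where "mulz d \<phi> e k = \<phi> (\<lambda>i. e i - of_int (Poly_Mapping.lookup d i)) k"

lemma mulz_mulz: "mulz d (mulz d' \<phi>) = mulz (d + d') \<phi>"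
  by (auto simp: mulz_def fun_eq_iff lookup_add algebra_simps)

lemma mulz_0 [simp]: "mulz 0 \<phi> = \<phi>"
  by (auto simp: mulz_def fun_eq_iff)

lemma mulz_add: "mulz d (\<phi> + \<psi>) = mulz d \<phi> + mulz d \<psi>"
  and mulz_diff: "mulz d (\<phi> - \<psi>) = mulz d \<phi> - mulz d \<psi>"
  and mulz_scale: "mulz d (sscale c \<phi>) = sscale c (mulz d \<phi>)"
  by (auto simp: mulz_def fun_eq_iff sscale_def)

lemma linear_mulz: "linear_on sscale sscale U (mulz d)"
  by (simp add: linear_on_def mulz_add mulz_scale)

text \<open>Lower truncation in \<open>z\<^sub>j\<close> for fixed exponents of \<open>z\<^sub>j\<^sub>+\<^sub>1, z\<^sub>j\<^sub>+\<^sub>2, \<dots>\<close>, uniformly in the exponents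
  of \<open>z\<^sub>1, \<dots>, z\<^sub>j\<^sub>-\<^sub>1\<close>. This is what a product of intertwining operators satisfies, and
  it suffices to multiply by expansions in the region \<open>|z\<^sub>1| > \<dots> > |z\<^sub>n| > 0\<close>.\<close>

definition truncated :: "nat \<Rightarrow> log_series set"
  where "truncated n = {\<phi>. \<forall>k e. \<forall>j\<in>{1..n}. \<exists>B::nat. \<forall>t\<ge>B. \<forall>e'.
    (\<forall>i>j. e' i = e i) \<longrightarrow> e' j = e j - of_nat t \<longrightarrow> \<phi> e' k = 0}"

lemma truncatedI:
  assumes "\<And>k e j. j \<in> {1..n} \<Longrightarrow> \<exists>B::nat. \<forall>t\<ge>B. \<forall>e'.
    (\<forall>i>j. e' i = e i) \<longrightarrow> e' j = e j - of_nat t \<longrightarrow> \<phi> e' k = 0"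
  shows "\<phi> \<in> truncated n"
  using assms by (auto simp: truncated_def)

lemma truncatedD:
  assumes "\<phi> \<in> truncated n" "j \<in> {1..n}"
  shows "\<exists>B::nat. \<forall>t\<ge>B. \<forall>e'. (\<forall>i>j. e' i = e i) \<longrightarrow> e' j = e j - of_nat t \<longrightarrow> \<phi> e' k = 0"
  using assms by (auto simp: truncated_def)

lemma subspace_truncated: "series.subspace (truncated n)"
  unfolding series.subspace_def
proof (intro conjI ballI allI)
  show "0 \<in> truncated n" by (rule truncatedI) auto
next
  fix \<phi> \<psi> assume *: "\<phi> \<in> truncated n" "\<psi> \<in> truncated n"
  show "\<phi> + \<psi> \<in> truncated n"
  proof (rule truncatedI)
    fix k e j assume j: "j \<in> {1..n}"
    obtain B where "\<forall>t\<ge>B. \<forall>e'. (\<forall>i>j. e' i = e i) \<longrightarrow> e' j = e j - of_nat t \<longrightarrow> \<phi> e' k = 0"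
      using truncatedD[OF *(1) j] by blast
    moreover obtain C where "\<forall>t\<ge>C. \<forall>e'. (\<forall>i>j. e' i = e i) \<longrightarrow> e' j = e j - of_nat t \<longrightarrow> \<psi> e' k = 0"
      using truncatedD[OF *(2) j] by blast
    ultimately show "\<exists>B. \<forall>t\<ge>B. \<forall>e'. (\<forall>i>j. e' i = e i) \<longrightarrow> e' j = e j - of_nat t \<longrightarrow> (\<phi> + \<psi>) e' k = 0"
      by (intro exI[of _ "max B C"]) auto
  qed
next
  fix c \<phi> assume *: "\<phi> \<in> truncated n"
  show "sscale c \<phi> \<in> truncated n"
  proof (rule truncatedI)
    fix k e j assume j: "j \<in> {1..n}"
    obtain B where "\<forall>t\<ge>B. \<forall>e'. (\<forall>i>j. e' i = e i) \<longrightarrow> e' j = e j - of_nat t \<longrightarrow> \<phi> e' k = 0"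
      using truncatedD[OF * j] by blast
    then show "\<exists>B. \<forall>t\<ge>B. \<forall>e'. (\<forall>i>j. e' i = e i) \<longrightarrow> e' j = e j - of_nat t \<longrightarrow> sscale c \<phi> e' k = 0"
      by (intro exI[of _ B]) (auto simp: sscale_def)
  qed
qed

lemma mulz_truncated:
  assumes "\<phi> \<in> truncated n"
  shows "mulz d \<phi> \<in> truncated n"
proof (rule truncatedI)
  fix k e j assume j: "j \<in> {1..n}"
  let ?s = "\<lambda>e i. e i - complex_of_int (Poly_Mapping.lookup d i)"
  obtain B where B: "\<forall>t\<ge>B. \<forall>e'. (\<forall>i>j. e' i = ?s e i) \<longrightarrow> e' j = ?s e j - of_nat t \<longrightarrow> \<phi> e' k = 0"
    using truncatedD[OF assms j, of "?s e" k] by blast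
  show "\<exists>B. \<forall>t\<ge>B. \<forall>e'. (\<forall>i>j. e' i = e i) \<longrightarrow> e' j = e j - of_nat t \<longrightarrow> mulz d \<phi> e' k = 0"
    unfolding mulz_def
  proof (intro exI[of _ B] allI impI)
    fix t e' assume "t \<ge> B" "\<forall>i>j. e' i = e i" "e' j = e j - of_nat t"
    then show "\<phi> (?s e') k = 0" using B[rule_format, of t "?s e'"] by (simp add: algebra_simps)
  qed
qed

text \<open>\<open>z\<^sub>i\<^sup>-\<^sup>m\<^sup>-\<^sup>t z\<^sub>j\<^sup>t\<close> for \<open>p = (i, j)\<close>, the exponents in the expansion of \<open>(z\<^sub>i - z\<^sub>j)\<^sup>-\<^sup>m\<close>.\<close>

definition pexp :: "nat \<times> nat \<Rightarrow> nat \<Rightarrow> nat \<Rightarrow> nat \<Rightarrow>\<^sub>0 int"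
  where "pexp p m t = Poly_Mapping.single (fst p) (- int m - int t) + Poly_Mapping.single (snd p) (int t)"

definition pairs :: "nat \<Rightarrow> (nat \<times> nat) set"
  where "pairs n = {(i, j). 1 \<le> i \<and> i < j \<and> j \<le> n}"

lemma finite_pairs: "finite (pairs n)"
  by (rule finite_subset[of _ "{1..n} \<times> {1..n}"]) (auto simp: pairs_def)

lemma lookup_pexp:
  "fst p \<noteq> snd p \<Longrightarrow> Poly_Mapping.lookup (pexp p m t) l =
    (if l = fst p then - int m - int t else if l = snd p then int t else 0)"
  by (auto simp: pexp_def lookup_add lookup_single when_def)

text \<open>The term of index \<open>t\<close> in the expansion reads off a coefficient whose
  exponent at \<open>snd p\<close> is lowered by \<open>t\<close>, while all later exponents are
  unchanged because \<open>fst p < snd p\<close>. Truncation at \<open>snd p\<close> therefore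
  applies.\<close>

lemma pexp_vanish:
  assumes "\<phi> \<in> truncated n" "p \<in> pairs n"
  shows "\<exists>B. \<forall>t\<ge>B. mulz (pexp p m t) \<phi> e k = 0"
proof -
  have p: "snd p \<in> {1..n}" "fst p < snd p" using assms(2) by (auto simp: pairs_def)
  from truncatedD[OF assms(1) p(1), of e k]
  obtain B :: nat where B: "\<And>t e'. t \<ge> B \<Longrightarrow> (\<forall>i>snd p. e' i = e i) \<Longrightarrow>
      e' (snd p) = e (snd p) - of_nat t \<Longrightarrow> \<phi> e' k = 0"
    by blast
  show ?thesis
    unfolding mulz_def using p(2)
    by (intro exI[of _ B] allI impI) (rule B, auto simp: lookup_pexp)
qed

lemma finite_pexp:
  assumes "\<phi> \<in> truncated n" "p \<in> pairs n"
  shows "finite {t. mulz (pexp p m t) \<phi> e k \<noteq> 0}"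
proof -
  obtain B where "\<forall>t\<ge>B. mulz (pexp p m t) \<phi> e k = 0" using pexp_vanish[OF assms] by blast
  then have "{t. mulz (pexp p m t) \<phi> e k \<noteq> 0} \<subseteq> {..<B}" by (auto simp: not_le[symmetric])
  then show ?thesis by (rule finite_subset) simp
qed

text \<open>The bound is uniform over all terms \<open>s\<close> of the expansion; this is what
  keeps the infinite sum truncated.\<close>

lemma pexp_truncated:
  assumes \<phi>: "\<phi> \<in> truncated n" and p: "p \<in> pairs n" and j0: "j0 \<in> {1..n}"
  shows "\<exists>B::nat. \<forall>t\<ge>B. \<forall>e'. (\<forall>i>j0. e' i = e i) \<longrightarrow> e' j0 = e j0 - of_nat t \<longrightarrow>
    (\<forall>s. mulz (pexp p m s) \<phi> e' k = 0)"
proof -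
  obtain i j where ij: "p = (i, j)" "i < j" "1 \<le> i" "j \<le> n" using p by (auto simp: pairs_def)
  consider "j0 > j" | "j0 = j" | "j0 < j" by linarith
  then show ?thesis
  proof cases
    case 1
    obtain B :: nat where B: "\<And>t e'. t \<ge> B \<Longrightarrow> (\<forall>i>j0. e' i = e i) \<Longrightarrow>
        e' j0 = e j0 - of_nat t \<Longrightarrow> \<phi> e' k = 0"
      using truncatedD[OF \<phi> j0, of e k] by blast
    show ?thesis
      unfolding mulz_def using 1 ij(2)
      by (intro exI[of _ B] allI impI) (rule B, auto simp: lookup_pexp ij(1))
  next
    case 2
    obtain B :: nat where B: "\<And>t e'. t \<ge> B \<Longrightarrow> (\<forall>i>j0. e' i = e i) \<Longrightarrow>
        e' j0 = e j0 - of_nat t \<Longrightarrow> \<phi> e' k = 0"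
      using truncatedD[OF \<phi> j0, of e k] by blast
    show ?thesis
      unfolding mulz_def
    proof (intro exI[of _ B] allI impI)
      fix t e' s assume "t \<ge> B" "\<forall>i>j0. e' i = e i" "e' j0 = e j0 - of_nat t"
      then show "\<phi> (\<lambda>i. e' i - of_int (Poly_Mapping.lookup (pexp p m s) i)) k = 0"
        using 2 ij(2) by (intro B[of "t + s"]) (auto simp: lookup_pexp ij(1))
    qed
  next
    case 3
    \<comment> \<open>Terms with \<open>s \<ge> B1\<close> are killed by truncation in the variable
      of index \<open>j\<close>. The finitely many others are shifts of the base point, each with
      its own bound in the variable of index \<open>j0\<close>.\<close>
    obtain B1 :: nat where B1: "\<And>t e'. t \<ge> B1 \<Longrightarrow> (\<forall>i>j. e' i = e i) \<Longrightarrow>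
        e' j = e j - of_nat t \<Longrightarrow> \<phi> e' k = 0"
      using truncatedD[OF \<phi>, of j e k] ij by auto
    define base where "base s = (\<lambda>i. e i - complex_of_int (Poly_Mapping.lookup (pexp p m s) i))" for s
    have "\<forall>s. \<exists>B::nat. \<forall>t\<ge>B. \<forall>e'. (\<forall>i>j0. e' i = base s i) \<longrightarrow> e' j0 = base s j0 - of_nat t \<longrightarrow> \<phi> e' k = 0"
      using truncatedD[OF \<phi> j0] by blast
    then obtain b :: "nat \<Rightarrow> nat" where b: "\<And>s t e'. t \<ge> b s \<Longrightarrow> (\<forall>i>j0. e' i = base s i) \<Longrightarrow>
        e' j0 = base s j0 - of_nat t \<Longrightarrow> \<phi> e' k = 0"
      by metis
    show ?thesis
      unfolding mulz_def
    proof (intro exI[of _ "Max (insert 0 (b ` {..<B1}))"] allI impI)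
      fix t e' s
      assume t: "t \<ge> Max (insert 0 (b ` {..<B1}))" and e': "\<forall>i>j0. e' i = e i" "e' j0 = e j0 - of_nat t"
      show "\<phi> (\<lambda>i. e' i - of_int (Poly_Mapping.lookup (pexp p m s) i)) k = 0"
      proof (cases "s < B1")
        case True
        then have "b s \<le> t" using t by simp
        then show ?thesis using e' by (intro b[of s t]) (auto simp: base_def)
      next
        case False
        then show ?thesis using e' 3 ij(2) by (intro B1[of s]) (auto simp: lookup_pexp ij(1))
      qed
    qed
  qed
qed

section \<open>Expanded negative powers of a difference as operators\<close>

definition Dop :: "nat \<times> nat \<Rightarrow> nat \<Rightarrow> log_series \<Rightarrow> log_series"
  where "Dop p m \<phi> e k = Sum_any (\<lambda>t. of_nat ((m + t - 1) choose t) * mulz (pexp p m t) \<phi> e k)"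

lemma Sum_any_eq_lessThan: "(\<And>t. t \<ge> B \<Longrightarrow> f t = 0) \<Longrightarrow> Sum_any f = sum f {..<B::nat}"
  by (rule Sum_any.expand_superset) (auto simp: not_le[symmetric])

lemma Dop_eq_sum:
  assumes "\<And>t. t \<ge> B \<Longrightarrow> mulz (pexp p m t) \<phi> e k = 0"
  shows "Dop p m \<phi> e k = (\<Sum>t<B. of_nat ((m + t - 1) choose t) * mulz (pexp p m t) \<phi> e k)"
  unfolding Dop_def by (rule Sum_any_eq_lessThan) (simp add: assms)

lemma Dop_truncated:
  assumes \<phi>: "\<phi> \<in> truncated n" and p: "p \<in> pairs n"
  shows "Dop p m \<phi> \<in> truncated n"
proof (rule truncatedI)
  fix k e j0 assume "j0 \<in> {1..n}"
  from pexp_truncated[OF assms this, of e m k] obtain B :: nat where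
    "\<forall>t\<ge>B. \<forall>e'. (\<forall>i>j0. e' i = e i) \<longrightarrow> e' j0 = e j0 - of_nat t \<longrightarrow> (\<forall>s. mulz (pexp p m s) \<phi> e' k = 0)"
    by blast
  then show "\<exists>B. \<forall>t\<ge>B. \<forall>e'. (\<forall>i>j0. e' i = e i) \<longrightarrow> e' j0 = e j0 - of_nat t \<longrightarrow> Dop p m \<phi> e' k = 0"
    unfolding Dop_def by (intro exI[of _ B]) auto
qed

lemma Dop_add:
  assumes "\<phi> \<in> truncated n" "\<psi> \<in> truncated n" "p \<in> pairs n"
  shows "Dop p m (\<phi> + \<psi>) = Dop p m \<phi> + Dop p m \<psi>"
proof (intro ext)
  fix e k
  have fin: "finite {t. of_nat ((m + t - 1) choose t) * mulz (pexp p m t) \<chi> e k \<noteq> 0}"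
    if "\<chi> \<in> truncated n" for \<chi>
    using finite_pexp[OF that assms(3), of m e k] by (rule rev_finite_subset) auto
  show "Dop p m (\<phi> + \<psi>) e k = (Dop p m \<phi> + Dop p m \<psi>) e k"
    unfolding Dop_def mulz_add plus_fun_apply distrib_left
    by (rule Sum_any.distrib; rule fin; fact)
qed

text \<open>A nonzero scalar does not change the support of the sum, so both sides agree even where
  the support is infinite and \<open>Sum_any\<close> takes its default value 0.\<close>

lemma Dop_scale: "Dop p m (sscale c \<phi>) = sscale c (Dop p m \<phi>)"
proof (intro ext)
  fix e k
  show "Dop p m (sscale c \<phi>) e k = sscale c (Dop p m \<phi>) e k"
  proof (cases "c = 0")
    case False
    then have "Sum_any (\<lambda>t. c * (of_nat ((m + t - 1) choose t) * mulz (pexp p m t) \<phi> e k))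
      = c * Sum_any (\<lambda>t. of_nat ((m + t - 1) choose t) * mulz (pexp p m t) \<phi> e k)"
      by (simp add: Sum_any.expand_set sum_distrib_left)
    then show ?thesis unfolding Dop_def mulz_scale by (simp add: mult.left_commute sscale_def)
  qed (simp add: Dop_def mulz_def sscale_def)
qed

lemma linear_Dop: "p \<in> pairs n \<Longrightarrow> linear_on sscale sscale (truncated n) (Dop p m)"
  by (simp add: linear_on_def Dop_add Dop_scale)

lemma mulz_Dop: "mulz d (Dop p m \<phi>) = Dop p m (mulz d \<phi>)"
proof (intro ext)
  fix e k
  have "mulz d (Dop p m \<phi>) e k
      = Sum_any (\<lambda>t. of_nat ((m + t - 1) choose t) * mulz d (mulz (pexp p m t) \<phi>) e k)"
    by (simp add: mulz_def Dop_def)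
  then show "mulz d (Dop p m \<phi>) e k = Dop p m (mulz d \<phi>) e k"
    by (simp add: Dop_def mulz_mulz add.commute)
qed

text \<open>For exponent 0 the truncated subtraction gives the right coefficients:
  \<open>0 choose 0 = 1\<close> at \<open>t = 0\<close>, and \<open>(t - 1) choose t = 0\<close>
  otherwise.\<close>

lemma Dop_0: "Dop p 0 \<phi> = \<phi>"
proof (intro ext)
  fix e k
  have "(0 + t - 1 choose t) = (if t = 0 then 1 else 0)" for t :: nat by (cases t) auto
  then have "of_nat ((0 + t - 1) choose t) * mulz (pexp p 0 t) \<phi> e k = (if t = 0 then \<phi> e k else 0)" for t
    by (auto simp: pexp_def)
  then show "Dop p 0 \<phi> e k = \<phi> e k"
    unfolding Dop_def by (simp only:) (subst Sum_any_eq_lessThan[of 1], auto)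
qed

text \<open>Multiplication by \<open>z\<^sub>i - z\<^sub>j\<close>; its injectivity identifies \<open>Dop p m\<close> with the \<open>m\<close>-th power of its inverse.\<close>

definition Mop :: "nat \<times> nat \<Rightarrow> log_series \<Rightarrow> log_series"
  where "Mop p \<phi> = mulz (Poly_Mapping.single (fst p) 1) \<phi> - mulz (Poly_Mapping.single (snd p) 1) \<phi>"

text \<open>Pascal's rule: the products with the two variables are the same series up to a shift of
  the index by one, and their difference has the binomial coefficients for the exponent
  \<open>m\<close>.\<close>

lemma Mop_Dop:
  assumes "\<phi> \<in> truncated n" "p \<in> pairs n"
  shows "Mop p (Dop p (Suc m) \<phi>) = Dop p m \<phi>"
proof (intro ext)
  fix e k
  define f where "f t = mulz (pexp p m t) \<phi> e k" for t
  obtain B where B: "\<And>t. t \<ge> B \<Longrightarrow> f t = 0"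
    using pexp_vanish[OF assms, of m e k] unfolding f_def by blast
  define b where "b m t = complex_of_nat ((m + t - 1) choose t)" for m t
  have "mulz (Poly_Mapping.single (fst p) 1) (Dop p (Suc m) \<phi>) e k =
      Sum_any (\<lambda>t. b (Suc m) t * mulz (Poly_Mapping.single (fst p) 1) (mulz (pexp p (Suc m) t) \<phi>) e k)"
    by (simp add: mulz_def Dop_def b_def)
  moreover have "Poly_Mapping.single (fst p) 1 + pexp p (Suc m) t = pexp p m t" for t
    by (simp add: pexp_def add.assoc[symmetric] single_add[symmetric])
  ultimately have 1: "mulz (Poly_Mapping.single (fst p) 1) (Dop p (Suc m) \<phi>) e k =
      Sum_any (\<lambda>t. b (Suc m) t * f t)"
    by (simp add: mulz_mulz f_def)
  have "mulz (Poly_Mapping.single (snd p) 1) (Dop p (Suc m) \<phi>) e k =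
      Sum_any (\<lambda>t. b (Suc m) t * mulz (Poly_Mapping.single (snd p) 1) (mulz (pexp p (Suc m) t) \<phi>) e k)"
    by (simp add: mulz_def Dop_def b_def)
  moreover have "Poly_Mapping.single (snd p) 1 + pexp p (Suc m) t = pexp p m (Suc t)" for t
  proof -
    have 1: "- int (Suc m) - int t = - int m - int (Suc t)" and 2: "int (Suc t) = 1 + int t" by simp_all
    show ?thesis unfolding pexp_def 1 unfolding 2 single_add by (simp only: ac_simps)
  qed
  ultimately have 2: "mulz (Poly_Mapping.single (snd p) 1) (Dop p (Suc m) \<phi>) e k =
      Sum_any (\<lambda>t. b (Suc m) t * f (Suc t))"
    by (simp add: mulz_mulz f_def)
  have "Mop p (Dop p (Suc m) \<phi>) e k = Sum_any (\<lambda>t. b (Suc m) t * f t) - Sum_any (\<lambda>t. b (Suc m) t * f (Suc t))"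
    unfolding Mop_def using 1 2 by simp
  \<comment> \<open>The bounds \<open>Suc B\<close> and \<open>B\<close> agree once the first sum is
    shifted by one.\<close>
  also have "\<dots> = (\<Sum>t<Suc B. b (Suc m) t * f t) - (\<Sum>t<B. b (Suc m) t * f (Suc t))"
    by (subst (1 2) Sum_any_eq_lessThan) (auto simp: B)
  also have "\<dots> = f 0 + (\<Sum>t<B. (b (Suc m) (Suc t) - b (Suc m) t) * f (Suc t))"
    unfolding sum.lessThan_Suc_shift left_diff_distrib sum_subtractf by (simp add: b_def)
  also have "\<dots> = (\<Sum>t<Suc B. b m t * f t)"
    unfolding sum.lessThan_Suc_shift by (simp add: b_def)
  also have "\<dots> = Dop p m \<phi> e k"
    unfolding b_def f_def by (rule Dop_eq_sum[symmetric]) (use B in \<open>auto simp: f_def\<close>)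
  finally show "Mop p (Dop p (Suc m) \<phi>) e k = Dop p m \<phi> e k" .
qed

text \<open>If the product of the difference with \<open>\<chi>\<close> vanishes, then
  \<open>\<chi>\<close> is unchanged by multiplication with the quotient of the second variable by
  the first, hence by all powers of this quotient; a high power makes any given coefficient vanish
  by truncation.\<close>

lemma Mop_inject:
  assumes "\<phi> \<in> truncated n" "\<psi> \<in> truncated n" "p \<in> pairs n" "Mop p \<phi> = Mop p \<psi>"
  shows "\<phi> = \<psi>"
proof -
  define \<chi> where "\<chi> = \<phi> - \<psi>"
  have \<chi>: "\<chi> \<in> truncated n" unfolding \<chi>_def by (rule series.subspace_diff[OF subspace_truncated assms(1,2)])
  have "mulz (Poly_Mapping.single (fst p) 1) \<chi> = mulz (Poly_Mapping.single (snd p) 1) \<chi>"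
    using assms(4) by (simp add: Mop_def \<chi>_def mulz_diff algebra_simps)
  then have "mulz (Poly_Mapping.single (fst p) (-1)) (mulz (Poly_Mapping.single (fst p) 1) \<chi>) =
      mulz (Poly_Mapping.single (fst p) (-1)) (mulz (Poly_Mapping.single (snd p) 1) \<chi>)"
    by simp
  then have step: "mulz (pexp p 0 1) \<chi> = \<chi>"
    by (simp add: mulz_mulz pexp_def single_add[symmetric])
  have "mulz (pexp p 0 t) \<chi> = \<chi>" for t
  proof (induction t)
    case (Suc t)
    have "pexp p 0 (Suc t) = pexp p 0 1 + pexp p 0 t"
      using single_add[of "fst p" "-1" "- int t"] single_add[of "snd p" 1 "int t"]
      by (simp add: pexp_def algebra_simps)
    then show ?case using Suc step by (simp add: mulz_mulz[symmetric])
  qed (simp add: pexp_def)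
  then have "\<chi> e k = 0" for e k
    using pexp_vanish[OF \<chi> assms(3), of 0 e k] by auto
  then show ?thesis unfolding \<chi>_def by (simp add: fun_eq_iff)
qed

lemma Mop_Dop_commute:
  assumes "\<phi> \<in> truncated n" "q \<in> pairs n"
  shows "Mop p (Dop q m \<phi>) = Dop q m (Mop p \<phi>)"
proof -
  have "Mop p \<phi> = mulz (Poly_Mapping.single (fst p) 1) \<phi> + sscale (-1) (mulz (Poly_Mapping.single (snd p) 1) \<phi>)"
    by (auto simp: Mop_def fun_eq_iff sscale_def)
  then have "Dop q m (Mop p \<phi>) = Dop q m (mulz (Poly_Mapping.single (fst p) 1) \<phi>)
      + sscale (-1) (Dop q m (mulz (Poly_Mapping.single (snd p) 1) \<phi>))"
    by (simp only: Dop_scale Dop_add[OF mulz_truncated[OF assms(1)]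
        series.subspace_scale[OF subspace_truncated mulz_truncated[OF assms(1)]] assms(2)])
  then show ?thesis by (auto simp: Mop_def mulz_Dop fun_eq_iff sscale_def)
qed

text \<open>Both sides become \<open>Dop q m \<phi>\<close> after multiplication by the difference
  belonging to \<open>p\<close>, and this multiplication can be cancelled. No double series has to
  be rearranged.\<close>

lemma Dop_commute:
  assumes "\<phi> \<in> truncated n" "p \<in> pairs n" "q \<in> pairs n"
  shows "Dop p 1 (Dop q m \<phi>) = Dop q m (Dop p 1 \<phi>)"
proof (rule Mop_inject[OF _ _ assms(2)])
  show "Dop p 1 (Dop q m \<phi>) \<in> truncated n" "Dop q m (Dop p 1 \<phi>) \<in> truncated n"
    using assms by (auto intro: Dop_truncated)
  have "Mop p (Dop p 1 (Dop q m \<phi>)) = Dop q m \<phi>"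
    using assms Mop_Dop[of "Dop q m \<phi>" n p 0] by (simp add: Dop_truncated Dop_0)
  moreover have "Mop p (Dop q m (Dop p 1 \<phi>)) = Dop q m (Mop p (Dop p 1 \<phi>))"
    using assms by (intro Mop_Dop_commute Dop_truncated)
  moreover have "Mop p (Dop p 1 \<phi>) = \<phi>"
    using assms Mop_Dop[of \<phi> n p 0] by (simp add: Dop_0)
  ultimately show "Mop p (Dop p 1 (Dop q m \<phi>)) = Mop p (Dop q m (Dop p 1 \<phi>))" by simp
qed

lemma Dop_Suc:
  assumes "\<phi> \<in> truncated n" "p \<in> pairs n"
  shows "Dop p (Suc m) \<phi> = Dop p 1 (Dop p m \<phi>)"
proof (rule Mop_inject[OF _ _ assms(2)])
  show "Dop p (Suc m) \<phi> \<in> truncated n" "Dop p 1 (Dop p m \<phi>) \<in> truncated n"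
    using assms by (auto intro: Dop_truncated)
  show "Mop p (Dop p (Suc m) \<phi>) = Mop p (Dop p 1 (Dop p m \<phi>))"
    using assms Mop_Dop[OF assms, of m] Mop_Dop[OF Dop_truncated[OF assms, of m] assms(2), of 0]
    by (simp add: Dop_0)
qed

section \<open>The coefficient ring as an algebra of commuting operators\<close>

definition ring_ops :: "nat \<Rightarrow> (log_series \<Rightarrow> log_series) set"
  where "ring_ops n = (\<lambda>(i, c). mulz (Poly_Mapping.single i c)) ` ({1..n} \<times> {1, -1}) \<union> (\<lambda>p. Dop p 1) ` pairs n"

lemma finite_ring_ops: "finite (ring_ops n)"
  by (auto simp: ring_ops_def finite_pairs)

lemma ring_ops_cases:
  assumes "f \<in> ring_ops n"
  obtains i c where "i \<in> {1..n}" "c \<in> {1, -1}" "f = mulz (Poly_Mapping.single i c)"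
  | p where "p \<in> pairs n" "f = Dop p 1"
proof -
  from assms consider x where "x \<in> {1..n} \<times> {1, -1}" "f = (case x of (i, c) \<Rightarrow> mulz (Poly_Mapping.single i c))"
    | p where "p \<in> pairs n" "f = Dop p 1"
    unfolding ring_ops_def by blast
  then show ?thesis
  proof cases
    case 1
    then show ?thesis using that(1)[of "fst x" "snd x"] by (auto simp: case_prod_unfold)
  qed (rule that(2))
qed

lemma invariant_truncated: "invariant_subspace sscale (ring_ops n) (truncated n)"
  by (auto simp: invariant_subspace_def subspace_truncated ring_ops_def mulz_truncated Dop_truncated)

lemma ring_ops_commute:
  assumes "f \<in> ring_ops n" "g \<in> ring_ops n" and x: "x \<in> truncated n"
  shows "f (g x) = g (f x)"
  using assms(1)
proof (cases rule: ring_ops_cases)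
  case f: (1 i c)
  from assms(2) show ?thesis
  proof (cases rule: ring_ops_cases)
    case (1 i' c')
    show ?thesis unfolding f(3) 1(3) mulz_mulz by (simp only: add.commute)
  next
    case (2 q)
    show ?thesis unfolding f(3) 2(2) by (rule mulz_Dop)
  qed
next
  case f: (2 p)
  from assms(2) show ?thesis
  proof (cases rule: ring_ops_cases)
    case (1 i c)
    show ?thesis unfolding f(2) 1(3) by (rule mulz_Dop[symmetric])
  next
    case (2 q)
    show ?thesis unfolding f(2) 2(2) by (rule Dop_commute[OF x f(1) 2(1)])
  qed
qed

lemma commuting_ring_ops: "commuting_on sscale (ring_ops n) (truncated n)"
proof -
  have "\<forall>f\<in>ring_ops n. linear_on sscale sscale (truncated n) f"
    by (auto simp: ring_ops_def linear_mulz linear_Dop)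
  moreover have "\<forall>f\<in>ring_ops n. \<forall>g\<in>ring_ops n. \<forall>x\<in>truncated n. f (g x) = g (f x)"
    using ring_ops_commute by metis
  ultimately show ?thesis unfolding commuting_on_def by metis
qed

lemma opspan_mulz:
  assumes "\<phi> \<in> opspan sscale (ring_ops n) S" "i \<in> {1..n}"
  shows "mulz (Poly_Mapping.single i c) \<phi> \<in> opspan sscale (ring_ops n) S"
proof -
  have pos: "mulz (Poly_Mapping.single i (int t)) \<phi> \<in> opspan sscale (ring_ops n) S" for t
  proof (induction t)
    case (Suc t)
    have "mulz (Poly_Mapping.single i 1) \<in> ring_ops n"
      unfolding ring_ops_def using assms(2) by (intro UnI1 image_eqI[of _ _ "(i, 1)"]) auto
    from opspan.op[OF this Suc] show ?case by (simp add: mulz_mulz single_add[symmetric])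
  qed (use assms in auto)
  have neg: "mulz (Poly_Mapping.single i (- int t)) \<phi> \<in> opspan sscale (ring_ops n) S" for t
  proof (induction t)
    case (Suc t)
    have "mulz (Poly_Mapping.single i (-1)) \<in> ring_ops n"
      unfolding ring_ops_def using assms(2) by (intro UnI1 image_eqI[of _ _ "(i, -1)"]) auto
    from opspan.op[OF this Suc] show ?case by (simp add: mulz_mulz single_add[symmetric])
  qed (use assms in auto)
  show ?thesis
    using pos[of "nat c"] neg[of "nat (- c)"] by (cases "c \<ge> 0") auto
qed

lemma opspan_Dop:
  assumes \<phi>: "\<phi> \<in> opspan sscale (ring_ops n) S" and "S \<subseteq> truncated n" "p \<in> pairs n"
  shows "Dop p m \<phi> \<in> opspan sscale (ring_ops n) S"
proof (induction m)
  case 0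
  then show ?case using assms by (simp add: Dop_0)
next
  case (Suc m)
  have "\<phi> \<in> truncated n"
    using opspan_least[OF vector_space_sscale invariant_truncated assms(2)] \<phi> by auto
  moreover have "Dop p 1 \<in> ring_ops n" using assms(3) by (auto simp: ring_ops_def)
  ultimately show ?case using opspan.op[OF _ Suc] assms(3) by (simp add: Dop_Suc)
qed

text \<open>Multiplication by the expansion of \<open>\<Prod>(i,j)\<in>S. (z\<^sub>i - z\<^sub>j)\<^sup>-\<^sup>N\<^sup>(\<^sup>i\<^sup>,\<^sup>j\<^sup>)\<close>, in one go.\<close>

definition shift :: "(nat \<times> nat) set \<Rightarrow> (nat \<times> nat \<Rightarrow>\<^sub>0 nat) \<Rightarrow> (nat \<times> nat \<Rightarrow>\<^sub>0 nat) \<Rightarrow> nat \<Rightarrow>\<^sub>0 int"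
  where "shift S N \<kappa> = (\<Sum>p\<in>S. pexp p (Poly_Mapping.lookup N p) (Poly_Mapping.lookup \<kappa> p))"

definition binom :: "(nat \<times> nat) set \<Rightarrow> (nat \<times> nat \<Rightarrow>\<^sub>0 nat) \<Rightarrow> (nat \<times> nat \<Rightarrow>\<^sub>0 nat) \<Rightarrow> complex"
  where "binom S N \<kappa> = (\<Prod>p\<in>S. of_nat ((Poly_Mapping.lookup N p + Poly_Mapping.lookup \<kappa> p - 1) choose Poly_Mapping.lookup \<kappa> p))"

definition Esupp :: "(nat \<times> nat) set \<Rightarrow> (nat \<times> nat \<Rightarrow>\<^sub>0 nat) \<Rightarrow> log_series \<Rightarrow> (nat \<Rightarrow> complex) \<Rightarrow> (nat \<Rightarrow> nat) \<Rightarrow> (nat \<times> nat \<Rightarrow>\<^sub>0 nat) set"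
  where "Esupp S N \<phi> e k = {\<kappa>. Poly_Mapping.keys \<kappa> \<subseteq> S \<and> mulz (shift S N \<kappa>) \<phi> e k \<noteq> 0}"

definition Eop :: "(nat \<times> nat) set \<Rightarrow> (nat \<times> nat \<Rightarrow>\<^sub>0 nat) \<Rightarrow> log_series \<Rightarrow> log_series"
  where "Eop S N \<phi> e k = (\<Sum>\<kappa>\<in>Esupp S N \<phi> e k. binom S N \<kappa> * mulz (shift S N \<kappa>) \<phi> e k)"

lemma keys_subset_insert_update:
  "p \<notin> S \<Longrightarrow> Poly_Mapping.keys \<kappa> \<subseteq> insert p S \<Longrightarrow>
    Poly_Mapping.keys (Poly_Mapping.update p 0 \<kappa>) \<subseteq> S \<and>
    \<kappa> = Poly_Mapping.update p (Poly_Mapping.lookup \<kappa> p) (Poly_Mapping.update p 0 \<kappa>)"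
  by (auto simp: in_keys_iff lookup_update split: if_splits intro!: poly_mapping_eqI)

lemma keys_update_subset:
  "Poly_Mapping.keys \<kappa> \<subseteq> S \<Longrightarrow> Poly_Mapping.keys (Poly_Mapping.update p t \<kappa>) \<subseteq> insert p S"
  by (auto simp: in_keys_iff lookup_update split: if_splits)

lemma shift_update:
  assumes "finite S" "p \<notin> S"
  shows "shift (insert p S) N (Poly_Mapping.update p t \<kappa>) = shift S N \<kappa> + pexp p (Poly_Mapping.lookup N p) t"
proof -
  have "(\<Sum>q\<in>S. pexp q (Poly_Mapping.lookup N q) (Poly_Mapping.lookup (Poly_Mapping.update p t \<kappa>) q)) = shift S N \<kappa>"
    unfolding shift_def using assms by (intro sum.cong) (auto simp: lookup_update)
  then show ?thesis using assms by (simp add: shift_def lookup_update add.commute)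
qed

lemma binom_update:
  assumes "finite S" "p \<notin> S"
  shows "binom (insert p S) N (Poly_Mapping.update p t \<kappa>) =
    binom S N \<kappa> * of_nat ((Poly_Mapping.lookup N p + t - 1) choose t)"
proof -
  have "(\<Prod>q\<in>S. complex_of_nat ((Poly_Mapping.lookup N q + Poly_Mapping.lookup (Poly_Mapping.update p t \<kappa>) q - 1) choose
      Poly_Mapping.lookup (Poly_Mapping.update p t \<kappa>) q)) = binom S N \<kappa>"
    unfolding binom_def using assms by (intro prod.cong) (auto simp: lookup_update)
  then show ?thesis using assms by (simp add: binom_def lookup_update mult.commute)
qed

text \<open>The series marks the coefficients to which some term of one expansion can contribute. It
  replaces infinitely many shifts of \<open>\<phi>\<close> by a single truncated series.\<close>

lemma indicator_truncated:
  assumes "\<phi> \<in> truncated n" "p \<in> pairs n"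
  shows "(\<lambda>e k. if \<exists>t. mulz (pexp p m t) \<phi> e k \<noteq> 0 then 1 else 0) \<in> truncated n"
proof (rule truncatedI)
  fix k e j0 assume "j0 \<in> {1..n}"
  from pexp_truncated[OF assms this, of e m k] obtain B :: nat where
    "\<forall>t\<ge>B. \<forall>e'. (\<forall>i>j0. e' i = e i) \<longrightarrow> e' j0 = e j0 - of_nat t \<longrightarrow> (\<forall>s. mulz (pexp p m s) \<phi> e' k = 0)"
    by blast
  then show "\<exists>B. \<forall>t\<ge>B. \<forall>e'. (\<forall>i>j0. e' i = e i) \<longrightarrow> e' j0 = e j0 - of_nat t \<longrightarrow>
      (if \<exists>t. mulz (pexp p m t) \<phi> e' k \<noteq> 0 then 1 else 0) = (0::complex)"
    by (intro exI[of _ B]) auto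
qed

text \<open>The induction hypothesis is applied to the indicator series for \<open>p\<close>, not to
  single shifts of \<open>\<phi>\<close>, and so bounds the indices of the other factors
  independently of the index \<open>t\<close> at \<open>p\<close>. For each choice of those, only
  finitely many \<open>t\<close> remain.\<close>

lemma finite_Esupp:
  assumes "finite S" "S \<subseteq> pairs n" "\<phi> \<in> truncated n"
  shows "finite (Esupp S N \<phi> e k)"
  using assms
proof (induction S arbitrary: \<phi> rule: finite_induct)
  case empty
  have "Esupp {} N \<phi> e k \<subseteq> {0}" by (auto simp: Esupp_def)
  then show ?case using finite_subset by blast
next
  case (insert p S)
  let ?m = "Poly_Mapping.lookup N p"
  define \<phi>' :: log_series where "\<phi>' = (\<lambda>e k. if \<exists>t. mulz (pexp p ?m t) \<phi> e k \<noteq> 0 then 1 else 0)"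
  have p: "p \<in> pairs n" using insert.prems by auto
  have "finite (Esupp S N \<phi>' e k)"
    using insert.prems p unfolding \<phi>'_def by (intro insert.IH indicator_truncated) auto
  moreover have "finite {t. mulz (pexp p ?m t) (mulz (shift S N \<kappa>) \<phi>) e k \<noteq> 0}" for \<kappa>
    using insert.prems p by (intro finite_pexp[of _ n] mulz_truncated) auto
  ultimately have "finite (Sigma (Esupp S N \<phi>' e k) (\<lambda>\<kappa>. {t. mulz (pexp p ?m t) (mulz (shift S N \<kappa>) \<phi>) e k \<noteq> 0}))"
    by (rule finite_SigmaI)
  then have "finite ((\<lambda>(\<kappa>, t). Poly_Mapping.update p t \<kappa>) ` \<dots>)" by (rule finite_imageI)
  moreover have "Esupp (insert p S) N \<phi> e k \<subseteq> (\<lambda>(\<kappa>, t). Poly_Mapping.update p t \<kappa>) `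
      (Sigma (Esupp S N \<phi>' e k) (\<lambda>\<kappa>. {t. mulz (pexp p ?m t) (mulz (shift S N \<kappa>) \<phi>) e k \<noteq> 0}))"
  proof
    fix \<kappa> assume \<kappa>: "\<kappa> \<in> Esupp (insert p S) N \<phi> e k"
    define \<kappa>' where "\<kappa>' = Poly_Mapping.update p 0 \<kappa>"
    define t where "t = Poly_Mapping.lookup \<kappa> p"
    have keys: "Poly_Mapping.keys \<kappa>' \<subseteq> S" "\<kappa> = Poly_Mapping.update p t \<kappa>'"
      using keys_subset_insert_update[OF insert.hyps(2)] \<kappa> unfolding Esupp_def \<kappa>'_def t_def by blast+
    have "mulz (shift S N \<kappa>' + pexp p ?m t) \<phi> e k \<noteq> 0"
      using \<kappa> keys(2) shift_update[OF insert.hyps(1,2)] by (simp add: Esupp_def)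
    then have nz: "mulz (pexp p ?m t) (mulz (shift S N \<kappa>') \<phi>) e k \<noteq> 0" "mulz (shift S N \<kappa>') (mulz (pexp p ?m t) \<phi>) e k \<noteq> 0"
      by (auto simp: mulz_mulz add.commute)
    from nz(2) have "mulz (shift S N \<kappa>') \<phi>' e k \<noteq> 0"
      unfolding \<phi>'_def by (auto simp: mulz_def)
    then have "\<kappa>' \<in> Esupp S N \<phi>' e k" using keys by (auto simp: Esupp_def)
    then show "\<kappa> \<in> (\<lambda>(\<kappa>, t). Poly_Mapping.update p t \<kappa>) `
      (Sigma (Esupp S N \<phi>' e k) (\<lambda>\<kappa>. {t. mulz (pexp p ?m t) (mulz (shift S N \<kappa>) \<phi>) e k \<noteq> 0}))"
      using nz(1) keys(2) by (intro image_eqI[of _ _ "(\<kappa>', t)"]) auto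
  qed
  ultimately show ?case using finite_subset by blast
qed

lemma Eop_empty: "Eop {} N \<phi> = \<phi>"
proof (intro ext)
  fix e k
  have "Esupp {} N \<phi> e k = (if \<phi> e k = 0 then {} else {0})" by (auto simp: Esupp_def shift_def)
  then show "Eop {} N \<phi> e k = \<phi> e k" by (simp add: Eop_def binom_def shift_def)
qed

text \<open>The simultaneous sum and the iterated one are both compared with the sum over a finite
  rectangle \<open>X \<times> {..<B}\<close> that contains all nonzero terms; a pair in it
  corresponds to a family through updating the value at \<open>p\<close>.\<close>

lemma Eop_insert:
  assumes "finite S" "p \<notin> S" "insert p S \<subseteq> pairs n" "\<phi> \<in> truncated n"
  shows "Eop (insert p S) N \<phi> = Eop S N (Dop p (Poly_Mapping.lookup N p) \<phi>)"
proof (intro ext)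
  fix e k
  let ?m = "Poly_Mapping.lookup N p"
  define \<phi>' :: log_series where "\<phi>' = (\<lambda>e k. if \<exists>t. mulz (pexp p ?m t) \<phi> e k \<noteq> 0 then 1 else 0)"
  define X where "X = Esupp S N \<phi>' e k"
  define trm where "trm \<kappa> t = mulz (shift S N \<kappa> + pexp p ?m t) \<phi> e k" for \<kappa> t
  have p: "p \<in> pairs n" and S: "S \<subseteq> pairs n" using assms by auto
  have finX: "finite X"
    unfolding X_def \<phi>'_def using assms by (intro finite_Esupp[of S n] indicator_truncated) auto
  have X: "\<kappa> \<in> X" if "Poly_Mapping.keys \<kappa> \<subseteq> S" "trm \<kappa> t \<noteq> 0" for \<kappa> t
  proof -
    have "mulz (shift S N \<kappa>) (mulz (pexp p ?m t) \<phi>) e k \<noteq> 0"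
      using that(2) by (simp add: trm_def mulz_mulz)
    then show ?thesis using that(1) unfolding X_def Esupp_def \<phi>'_def by (auto simp: mulz_def)
  qed
  have X_keys: "Poly_Mapping.keys \<kappa> \<subseteq> S" if "\<kappa> \<in> X" for \<kappa> using that by (auto simp: X_def Esupp_def)
  have "\<exists>B. \<forall>t\<ge>B. trm \<kappa> t = 0" for \<kappa>
    using pexp_vanish[OF mulz_truncated[OF assms(4)] p, of ?m "shift S N \<kappa>" e k]
    by (simp add: trm_def mulz_mulz add.commute)
  then obtain b where b: "\<And>\<kappa> t. t \<ge> b \<kappa> \<Longrightarrow> trm \<kappa> t = 0" by metis
  define B where "B = Max (insert 0 (b ` X))"
  have B: "trm \<kappa> t = 0" if "\<kappa> \<in> X" "t \<ge> B" for \<kappa> t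
    using b[of \<kappa> t] that finX unfolding B_def by auto
  define g where "g = (\<lambda>(\<kappa>, t). Poly_Mapping.update p t \<kappa> :: nat \<times> nat \<Rightarrow>\<^sub>0 nat)"
  have inj: "inj_on g (X \<times> {..<B})"
  proof (rule inj_onI)
    fix x y assume xy: "x \<in> X \<times> {..<B}" "y \<in> X \<times> {..<B}" "g x = g y"
    obtain \<kappa> t \<mu> s where xy': "x = (\<kappa>, t)" "y = (\<mu>, s)" by (cases x, cases y)
    have *: "Poly_Mapping.lookup (Poly_Mapping.update p t \<kappa>) q = Poly_Mapping.lookup (Poly_Mapping.update p s \<mu>) q" for q
      using xy(3) by (simp add: g_def xy')
    have "t = s" using *[of p] by (simp add: lookup_update)
    moreover have "Poly_Mapping.lookup \<kappa> q = Poly_Mapping.lookup \<mu> q" for q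
    proof (cases "q = p")
      case True
      have "p \<notin> Poly_Mapping.keys \<kappa>" "p \<notin> Poly_Mapping.keys \<mu>"
        using xy(1,2) xy' X_keys assms(2) by auto
      then show ?thesis using True by (simp add: in_keys_iff)
    next
      case False
      then show ?thesis using *[of q] by (simp add: lookup_update)
    qed
    ultimately show "x = y" using xy' by (simp add: poly_mapping_eqI)
  qed
  have "Eop (insert p S) N \<phi> e k =
      (\<Sum>\<kappa>\<in>g ` (X \<times> {..<B}). binom (insert p S) N \<kappa> * mulz (shift (insert p S) N \<kappa>) \<phi> e k)"
    unfolding Eop_def
  proof (rule sum.mono_neutral_left)
    show "finite (g ` (X \<times> {..<B}))" using finX by auto
    show "Esupp (insert p S) N \<phi> e k \<subseteq> g ` (X \<times> {..<B})"
    proof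
      fix \<kappa> assume \<kappa>: "\<kappa> \<in> Esupp (insert p S) N \<phi> e k"
      define \<kappa>' where "\<kappa>' = Poly_Mapping.update p 0 \<kappa>"
      define t where "t = Poly_Mapping.lookup \<kappa> p"
      have keys: "Poly_Mapping.keys \<kappa>' \<subseteq> S" "\<kappa> = Poly_Mapping.update p t \<kappa>'"
        using keys_subset_insert_update[OF assms(2)] \<kappa> unfolding Esupp_def \<kappa>'_def t_def by blast+
      have nz: "trm \<kappa>' t \<noteq> 0"
        using \<kappa> keys(2) shift_update[OF assms(1,2)] by (simp add: Esupp_def trm_def)
      then have "\<kappa>' \<in> X" by (rule X[OF keys(1)])
      moreover have "t < B" using B[OF \<open>\<kappa>' \<in> X\<close>, of t] nz by (auto simp: not_le[symmetric])
      ultimately show "\<kappa> \<in> g ` (X \<times> {..<B})" using keys(2) by (auto simp: g_def)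
    qed
    show "\<forall>\<kappa>\<in>g ` (X \<times> {..<B}) - Esupp (insert p S) N \<phi> e k.
        binom (insert p S) N \<kappa> * mulz (shift (insert p S) N \<kappa>) \<phi> e k = 0"
      using X_keys keys_update_subset by (fastforce simp: Esupp_def g_def)
  qed
  also have "\<dots> = (\<Sum>(\<kappa>, t)\<in>X \<times> {..<B}. binom S N \<kappa> * (of_nat ((?m + t - 1) choose t) * trm \<kappa> t))"
    by (subst sum.reindex[OF inj])
      (auto intro!: sum.cong simp: g_def shift_update[OF assms(1,2)] binom_update[OF assms(1,2)] trm_def)
  also have "\<dots> = (\<Sum>\<kappa>\<in>X. binom S N \<kappa> * (\<Sum>t<B. of_nat ((?m + t - 1) choose t) * trm \<kappa> t))"
    by (simp add: sum.cartesian_product sum_distrib_left)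
  also have "\<dots> = (\<Sum>\<kappa>\<in>X. binom S N \<kappa> * mulz (shift S N \<kappa>) (Dop p ?m \<phi>) e k)"
  proof (rule sum.cong)
    fix \<kappa> assume "\<kappa> \<in> X"
    then have "Dop p ?m (mulz (shift S N \<kappa>) \<phi>) e k = (\<Sum>t<B. of_nat ((?m + t - 1) choose t) * trm \<kappa> t)"
      using B by (subst Dop_eq_sum[of B]) (auto simp: trm_def mulz_mulz add.commute)
    then show "binom S N \<kappa> * (\<Sum>t<B. of_nat ((?m + t - 1) choose t) * trm \<kappa> t) =
        binom S N \<kappa> * mulz (shift S N \<kappa>) (Dop p ?m \<phi>) e k"
      by (simp add: mulz_Dop)
  qed simp
  also have "\<dots> = Eop S N (Dop p ?m \<phi>) e k"
    unfolding Eop_def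
  proof (rule sum.mono_neutral_right)
    show "Esupp S N (Dop p ?m \<phi>) e k \<subseteq> X"
    proof
      fix \<kappa> assume \<kappa>: "\<kappa> \<in> Esupp S N (Dop p ?m \<phi>) e k"
      show "\<kappa> \<in> X"
      proof (rule ccontr)
        assume "\<kappa> \<notin> X"
        then have "trm \<kappa> t = 0" for t using X[of \<kappa> t] \<kappa> by (auto simp: Esupp_def)
        then have "Dop p ?m (mulz (shift S N \<kappa>) \<phi>) e k = 0"
          by (simp add: Dop_def mulz_mulz trm_def add.commute)
        then show False using \<kappa> by (simp add: Esupp_def mulz_Dop)
      qed
    qed
    show "\<forall>\<kappa>\<in>X - Esupp S N (Dop p ?m \<phi>) e k. binom S N \<kappa> * mulz (shift S N \<kappa>) (Dop p ?m \<phi>) e k = 0"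
      using X_keys by (auto simp: Esupp_def)
  qed (rule finX)
  finally show "Eop (insert p S) N \<phi> e k = Eop S N (Dop p ?m \<phi>) e k" .
qed

lemma Eop_cong:
  "(\<And>p. p \<in> S \<Longrightarrow> Poly_Mapping.lookup N p = Poly_Mapping.lookup N' p) \<Longrightarrow> Eop S N = Eop S N'"
  by (simp add: Eop_def Esupp_def shift_def binom_def fun_eq_iff)

lemma Eop_truncated:
  assumes "finite S" "S \<subseteq> pairs n" "\<phi> \<in> truncated n"
  shows "Eop S N \<phi> \<in> truncated n"
  using assms
proof (induction S arbitrary: \<phi> rule: finite_induct)
  case (insert p S)
  then have "Dop p (Poly_Mapping.lookup N p) \<phi> \<in> truncated n" by (auto intro: Dop_truncated)
  with insert show ?case by (simp add: Eop_insert[of S p n])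
qed (simp add: Eop_empty)

lemma Dop_Eop:
  assumes "finite S" "S \<subseteq> pairs n" "\<phi> \<in> truncated n" "q \<in> pairs n"
  shows "Dop q 1 (Eop S N \<phi>) = Eop S N (Dop q 1 \<phi>)"
  using assms(1-3)
proof (induction S arbitrary: \<phi> rule: finite_induct)
  case (insert p S)
  let ?m = "Poly_Mapping.lookup N p"
  have p: "p \<in> pairs n" "S \<subseteq> pairs n" using insert.prems by auto
  have "Dop q 1 (Eop (insert p S) N \<phi>) = Dop q 1 (Eop S N (Dop p ?m \<phi>))"
    by (simp only: Eop_insert[OF insert.hyps(1,2) insert.prems])
  also have "\<dots> = Eop S N (Dop q 1 (Dop p ?m \<phi>))"
    by (rule insert.IH[OF p(2) Dop_truncated[OF insert.prems(2) p(1)]])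
  also have "\<dots> = Eop S N (Dop p ?m (Dop q 1 \<phi>))"
    by (simp only: Dop_commute[OF insert.prems(2) assms(4) p(1)])
  also have "\<dots> = Eop (insert p S) N (Dop q 1 \<phi>)"
    using Eop_insert[OF insert.hyps(1,2) insert.prems(1) Dop_truncated[OF insert.prems(2) assms(4)]] by simp
  finally show ?case .
qed (simp add: Eop_empty)

text \<open>Whether or not \<open>q\<close> is already a key, the operator can be written over the
  key set without \<open>q\<close> followed by the factor for \<open>q\<close>, whose exponent may
  be 0. The new factor then just raises this exponent by one.\<close>

lemma Dop_Eop_keys:
  assumes N: "Poly_Mapping.keys N \<subseteq> pairs n" and \<phi>: "\<phi> \<in> truncated n" and q: "q \<in> pairs n"
  shows "Dop q 1 (Eop (Poly_Mapping.keys N) N \<phi>) =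
    Eop (Poly_Mapping.keys (N + Poly_Mapping.single q 1)) (N + Poly_Mapping.single q 1) \<phi>"
proof -
  let ?N' = "N + Poly_Mapping.single q 1"
  define S where "S = Poly_Mapping.keys N - {q}"
  have S: "finite S" "q \<notin> S" "insert q S \<subseteq> pairs n" "S \<subseteq> pairs n" using N q by (auto simp: S_def)
  have keys: "Poly_Mapping.keys ?N' = insert q S"
    by (auto simp: S_def in_keys_iff lookup_add lookup_single when_def split: if_splits)
  have "Eop (Poly_Mapping.keys N) N \<phi> = Eop S N (Dop q (Poly_Mapping.lookup N q) \<phi>)"
  proof (cases "q \<in> Poly_Mapping.keys N")
    case True
    then have "Poly_Mapping.keys N = insert q S" by (auto simp: S_def)
    then show ?thesis using Eop_insert[OF S(1-3) \<phi>] by simp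
  next
    case False
    then have "Poly_Mapping.keys N = S" "Poly_Mapping.lookup N q = 0" by (auto simp: S_def in_keys_iff)
    then show ?thesis using Dop_0 by simp
  qed
  then have "Dop q 1 (Eop (Poly_Mapping.keys N) N \<phi>) = Eop S N (Dop q 1 (Dop q (Poly_Mapping.lookup N q) \<phi>))"
    using Dop_Eop[OF S(1,4) Dop_truncated[OF \<phi> q] q] by simp
  also have "\<dots> = Eop S N (Dop q (Poly_Mapping.lookup ?N' q) \<phi>)"
    using Dop_Suc[OF \<phi> q] by (simp add: lookup_add)
  also have "\<dots> = Eop S ?N' (Dop q (Poly_Mapping.lookup ?N' q) \<phi>)"
    by (subst Eop_cong[of S N ?N']) (use S(2) in \<open>auto simp: lookup_add lookup_single when_def\<close>)
  also have "\<dots> = Eop (insert q S) ?N' \<phi>" using Eop_insert[OF S(1-3) \<phi>] by simp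
  finally show ?thesis unfolding keys .
qed

section \<open>From operators back to products with ring elements\<close>

definition mono_op :: "(nat \<Rightarrow>\<^sub>0 int) \<times> (nat \<times> nat \<Rightarrow>\<^sub>0 nat) \<Rightarrow> log_series \<Rightarrow> log_series"
  where "mono_op x \<phi> = mulz (fst x) (Eop (Poly_Mapping.keys (snd x)) (snd x) \<phi>)"

definition ring_monomials :: "nat \<Rightarrow> ((nat \<Rightarrow>\<^sub>0 int) \<times> (nat \<times> nat \<Rightarrow>\<^sub>0 nat)) set"
  where "ring_monomials n = {(e, N). Poly_Mapping.keys e \<subseteq> {1..n} \<and> Poly_Mapping.keys N \<subseteq> pairs n}"

lemma coeff_ring_iff: "a \<in> coeff_ring n \<longleftrightarrow> Poly_Mapping.keys a \<subseteq> ring_monomials n"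
  by (auto simp: coeff_ring_def ring_monomials_def pairs_def)

lemma mono_op_truncated:
  "x \<in> ring_monomials n \<Longrightarrow> \<phi> \<in> truncated n \<Longrightarrow> mono_op x \<phi> \<in> truncated n"
  by (auto simp: mono_op_def ring_monomials_def intro!: mulz_truncated Eop_truncated)

definition expand_mono :: "(nat \<Rightarrow>\<^sub>0 int) \<times> (nat \<times> nat \<Rightarrow>\<^sub>0 nat) \<Rightarrow> (nat \<Rightarrow>\<^sub>0 int) \<Rightarrow> complex"
  where "expand_mono x d = (\<Sum>\<kappa> | Poly_Mapping.keys \<kappa> \<subseteq> Poly_Mapping.keys (snd x) \<and>
    d = fst x + shift (Poly_Mapping.keys (snd x)) (snd x) \<kappa>. binom (Poly_Mapping.keys (snd x)) (snd x) \<kappa>)"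

lemma expansion_exponent_eq_shift: "expansion_exponent N \<kappa> = shift (Poly_Mapping.keys N) N \<kappa>"
  unfolding expansion_exponent_def shift_def pexp_def by (intro sum.cong) auto

lemma expand_eq: "expand a d = (\<Sum>x\<in>Poly_Mapping.keys a. Poly_Mapping.lookup a x * expand_mono x d)"
  unfolding expand_def expand_mono_def binom_def expansion_exponent_eq_shift
  by (intro sum.cong) auto

text \<open>The convolution groups the families by their total exponent \<open>d\<close>. If the
  coefficient of \<open>\<phi>\<close> shifted by \<open>d\<close> is nonzero, all families with
  that exponent lie in the finite set \<open>F\<close>; otherwise the term is 0 whatever value
  \<open>expand_mono\<close> has.\<close>

lemma product_mono:
  assumes x: "x \<in> ring_monomials n" and \<phi>: "\<phi> \<in> truncated n"
  shows "finite {d. expand_mono x d * mulz d \<phi> e k \<noteq> 0}"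
    and "Sum_any (\<lambda>d. expand_mono x d * mulz d \<phi> e k) = mono_op x \<phi> e k"
proof -
  obtain e0 N where xN: "x = (e0, N)" "Poly_Mapping.keys N \<subseteq> pairs n"
    using x by (auto simp: ring_monomials_def)
  let ?S = "Poly_Mapping.keys N"
  define H where "H \<kappa> = e0 + shift ?S N \<kappa>" for \<kappa>
  define F where "F = {\<kappa>. Poly_Mapping.keys \<kappa> \<subseteq> ?S \<and> mulz (H \<kappa>) \<phi> e k \<noteq> 0}"
  have mulz_H: "mulz (H \<kappa>) \<phi> e k = mulz (shift ?S N \<kappa>) \<phi> (\<lambda>i. e i - of_int (Poly_Mapping.lookup e0 i)) k" for \<kappa>
    unfolding H_def mulz_mulz[symmetric] by (subst mulz_def) simp
  then have F_eq: "F = Esupp ?S N \<phi> (\<lambda>i. e i - of_int (Poly_Mapping.lookup e0 i)) k"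
    by (simp add: F_def Esupp_def)
  have finF: "finite F" unfolding F_eq using xN \<phi> by (intro finite_Esupp) auto
  have fiber: "{\<kappa>. Poly_Mapping.keys \<kappa> \<subseteq> ?S \<and> d = H \<kappa>} = {\<kappa> \<in> F. H \<kappa> = d}" if "mulz d \<phi> e k \<noteq> 0" for d
    using that by (auto simp: F_def)
  have em: "expand_mono x d = (\<Sum>\<kappa> | Poly_Mapping.keys \<kappa> \<subseteq> ?S \<and> d = H \<kappa>. binom ?S N \<kappa>)" for d
    by (simp add: expand_mono_def xN(1) H_def)
  have sub: "{d. expand_mono x d * mulz d \<phi> e k \<noteq> 0} \<subseteq> H ` F"
  proof
    fix d assume "d \<in> {d. expand_mono x d * mulz d \<phi> e k \<noteq> 0}"
    then have d: "mulz d \<phi> e k \<noteq> 0" "(\<Sum>\<kappa> | \<kappa> \<in> F \<and> H \<kappa> = d. binom ?S N \<kappa>) \<noteq> 0"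
      using fiber[of d] by (auto simp: em)
    from d(2) have "{\<kappa> \<in> F. H \<kappa> = d} \<noteq> {}" by (metis sum.empty)
    then show "d \<in> H ` F" by auto
  qed
  show "finite {d. expand_mono x d * mulz d \<phi> e k \<noteq> 0}"
    using sub finF finite_subset by blast
  have "Sum_any (\<lambda>d. expand_mono x d * mulz d \<phi> e k) = (\<Sum>d\<in>H ` F. expand_mono x d * mulz d \<phi> e k)"
    using finF by (intro Sum_any.expand_superset sub) auto
  also have "\<dots> = (\<Sum>d\<in>H ` F. \<Sum>\<kappa> | \<kappa> \<in> F \<and> H \<kappa> = d. binom ?S N \<kappa> * mulz (H \<kappa>) \<phi> e k)"
  proof (rule sum.cong)
    fix d assume "d \<in> H ` F"
    then have "mulz d \<phi> e k \<noteq> 0" by (auto simp: F_def)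
    then show "expand_mono x d * mulz d \<phi> e k = (\<Sum>\<kappa> | \<kappa> \<in> F \<and> H \<kappa> = d. binom ?S N \<kappa> * mulz (H \<kappa>) \<phi> e k)"
      unfolding em fiber[OF \<open>mulz d \<phi> e k \<noteq> 0\<close>] sum_distrib_right by (intro sum.cong) auto
  qed simp
  also have "\<dots> = (\<Sum>\<kappa>\<in>F. binom ?S N \<kappa> * mulz (H \<kappa>) \<phi> e k)"
    by (rule sum.image_gen[symmetric, OF finF])
  also have "\<dots> = mono_op x \<phi> e k"
    unfolding mono_op_def by (subst mulz_def) (simp add: xN(1) Eop_def F_eq mulz_H)
  finally show "Sum_any (\<lambda>d. expand_mono x d * mulz d \<phi> e k) = mono_op x \<phi> e k" .
qed

lemma product_eq:
  assumes a: "a \<in> coeff_ring n" and \<phi>: "\<phi> \<in> truncated n"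
  shows "product_defined a \<phi>"
    and "product a \<phi> = (\<Sum>x\<in>Poly_Mapping.keys a. sscale (Poly_Mapping.lookup a x) (mono_op x \<phi>))"
proof -
  have keys: "x \<in> ring_monomials n" if "x \<in> Poly_Mapping.keys a" for x
    using a that by (auto simp: coeff_ring_iff)
  define D where "D e k = (\<Union>x\<in>Poly_Mapping.keys a. {d. expand_mono x d * mulz d \<phi> e k \<noteq> 0})" for e k
  have finD: "finite (D e k)" for e k
    unfolding D_def using product_mono(1)[OF keys \<phi>] by auto
  have pt: "product_term a \<phi> e k d =
      (\<Sum>x\<in>Poly_Mapping.keys a. Poly_Mapping.lookup a x * (expand_mono x d * mulz d \<phi> e k))" for e k d
    by (simp add: product_term_def expand_eq mulz_def sum_distrib_right mult.assoc)
  have sub: "{d. product_term a \<phi> e k d \<noteq> 0} \<subseteq> D e k" for e k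
  proof
    fix d assume "d \<in> {d. product_term a \<phi> e k d \<noteq> 0}"
    then have "(\<Sum>x\<in>Poly_Mapping.keys a. Poly_Mapping.lookup a x * (expand_mono x d * mulz d \<phi> e k)) \<noteq> 0"
      by (simp only: mem_Collect_eq pt not_False_eq_True)
    then obtain x where "x \<in> Poly_Mapping.keys a" "Poly_Mapping.lookup a x * (expand_mono x d * mulz d \<phi> e k) \<noteq> 0"
      by (rule sum.not_neutral_contains_not_neutral)
    then show "d \<in> D e k" by (auto simp: D_def)
  qed
  then show "product_defined a \<phi>"
    unfolding product_defined_def using finD finite_subset by blast
  have sum_apply: "(\<Sum>x\<in>X. f x) e k = (\<Sum>x\<in>X. f x e k)" for f :: "'z \<Rightarrow> log_series" and X e k
    by (induction X rule: infinite_finite_induct) auto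
  show "product a \<phi> = (\<Sum>x\<in>Poly_Mapping.keys a. sscale (Poly_Mapping.lookup a x) (mono_op x \<phi>))"
  proof (intro ext)
    fix e k
    have "product a \<phi> e k = (\<Sum>d\<in>D e k. product_term a \<phi> e k d)"
      unfolding product_def by (rule Sum_any.expand_superset[OF finD sub])
    also have "\<dots> = (\<Sum>x\<in>Poly_Mapping.keys a. Poly_Mapping.lookup a x * (\<Sum>d\<in>D e k. expand_mono x d * mulz d \<phi> e k))"
      unfolding pt by (subst sum.swap) (simp add: sum_distrib_left)
    also have "\<dots> = (\<Sum>x\<in>Poly_Mapping.keys a. Poly_Mapping.lookup a x * mono_op x \<phi> e k)"
    proof (rule sum.cong)
      fix x assume x: "x \<in> Poly_Mapping.keys a"
      have "(\<Sum>d\<in>D e k. expand_mono x d * mulz d \<phi> e k) = Sum_any (\<lambda>d. expand_mono x d * mulz d \<phi> e k)"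
        by (rule Sum_any.expand_superset[OF finD, symmetric]) (use x in \<open>auto simp: D_def\<close>)
      then show "Poly_Mapping.lookup a x * (\<Sum>d\<in>D e k. expand_mono x d * mulz d \<phi> e k)
          = Poly_Mapping.lookup a x * mono_op x \<phi> e k"
        using product_mono(2)[OF keys[OF x] \<phi>] by simp
    qed simp
    finally show "product a \<phi> e k = (\<Sum>x\<in>Poly_Mapping.keys a. sscale (Poly_Mapping.lookup a x) (mono_op x \<phi>)) e k"
      by (simp add: sum_apply sscale_apply)
  qed
qed

lemma coeff_ring_add: "a \<in> coeff_ring n \<Longrightarrow> b \<in> coeff_ring n \<Longrightarrow> a + b \<in> coeff_ring n"
  unfolding coeff_ring_iff using keys_add[of a b] by blast

lemma coeff_ring_single: "x \<in> ring_monomials n \<Longrightarrow> Poly_Mapping.single x c \<in> coeff_ring n"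
  by (simp add: coeff_ring_iff)

lemma product_add:
  assumes a: "a \<in> coeff_ring n" "b \<in> coeff_ring n" and \<phi>: "\<phi> \<in> truncated n"
  shows "product (a + b) \<phi> = product a \<phi> + product b \<phi>"
proof -
  let ?K = "Poly_Mapping.keys a \<union> Poly_Mapping.keys b"
  have eq: "product c \<phi> = (\<Sum>x\<in>?K. sscale (Poly_Mapping.lookup c x) (mono_op x \<phi>))"
    if "c \<in> coeff_ring n" "Poly_Mapping.keys c \<subseteq> ?K" for c
    unfolding product_eq(2)[OF that(1) \<phi>] using that(2)
    by (intro sum.mono_neutral_left) (auto simp: in_keys_iff)
  show ?thesis
    using keys_add[of a b] a
    by (simp add: eq coeff_ring_add lookup_add series.scale_left_distrib sum.distrib)
qed

lemma product_single:
  assumes "x \<in> ring_monomials n" "\<phi> \<in> truncated n"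
  shows "product (Poly_Mapping.single x c) \<phi> = sscale c (mono_op x \<phi>)"
  using product_eq(2)[OF coeff_ring_single[OF assms(1), of c] assms(2)] by (cases "c = 0") auto

text \<open>Each generator of the ring sends a monomial applied to an element of \<open>S\<close> to
  another such monomial. Hence iterated operators reduce to linear combinations of monomials, the
  form in which \<open>expand\<close> describes ring elements.\<close>

lemma span_mono_opspan:
  assumes S: "S \<subseteq> truncated n"
  shows "opspan sscale (ring_ops n) S \<subseteq> series.span {mono_op x \<phi> | x \<phi>. x \<in> ring_monomials n \<and> \<phi> \<in> S}"
    (is "_ \<subseteq> series.span ?G")
proof (rule opspan_least[OF vector_space_sscale])
  have G: "?G \<subseteq> truncated n" using S mono_op_truncated by blast
  have span_G: "series.span ?G \<subseteq> truncated n"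
    by (rule series.span_minimal[OF G subspace_truncated])
  show "S \<subseteq> series.span ?G"
  proof
    fix \<phi> assume "\<phi> \<in> S"
    moreover have "mono_op (0, 0) \<phi> = \<phi>" by (simp add: mono_op_def Eop_empty)
    ultimately have "\<phi> \<in> ?G" by (intro CollectI exI[of _ "(0, 0)"] exI[of _ \<phi>]) (auto simp: ring_monomials_def)
    then show "\<phi> \<in> series.span ?G" by (rule series.span_base)
  qed
  have op_G: "f g \<in> ?G" if f: "f \<in> ring_ops n" and "g \<in> ?G" for f g
  proof -
    obtain e0 N \<phi> where g: "g = mono_op (e0, N) \<phi>" "(e0, N) \<in> ring_monomials n" "\<phi> \<in> S"
      using \<open>g \<in> ?G\<close> by auto
    have \<phi>: "\<phi> \<in> truncated n" using g S by auto
    have mem: "Poly_Mapping.keys e0 \<subseteq> {1..n}" "Poly_Mapping.keys N \<subseteq> pairs n" using g(2) by (auto simp: ring_monomials_def)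
    from f show ?thesis
    proof (cases rule: ring_ops_cases)
      case (1 i c)
      have "f g = mono_op (Poly_Mapping.single i c + e0, N) \<phi>"
        by (simp add: 1(3) g(1) mono_op_def mulz_mulz)
      moreover have "(Poly_Mapping.single i c + e0, N) \<in> ring_monomials n"
        using mem 1(1) keys_add[of "Poly_Mapping.single i c" e0] by (auto simp: ring_monomials_def split: if_splits)
      ultimately show ?thesis using g(3) by blast
    next
      case (2 p)
      have "f g = mono_op (e0, N + Poly_Mapping.single p 1) \<phi>"
        using Dop_Eop_keys[OF mem(2) \<phi> 2(1)] by (simp add: 2(2) g(1) mono_op_def mulz_Dop[symmetric])
      moreover have "(e0, N + Poly_Mapping.single p 1) \<in> ring_monomials n"
        using mem 2(1) keys_add[of N "Poly_Mapping.single p 1"] by (auto simp: ring_monomials_def)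
      ultimately show ?thesis using g(3) by blast
    qed
  qed
  have op_span: "f ` series.span ?G \<subseteq> series.span ?G" if f: "f \<in> ring_ops n" for f
  proof (rule image_subsetI)
    fix \<psi> assume "\<psi> \<in> series.span ?G"
    have lin: "linear_on sscale sscale (truncated n) f"
      using commuting_ring_ops f by (auto simp: commuting_on_def)
    have f_add: "f (x + y) = f x + f y" if "x \<in> truncated n" "y \<in> truncated n" for x y
      using lin that by (auto simp: linear_on_def)
    have f_scale: "f (sscale c x) = sscale c (f x)" if "x \<in> truncated n" for x c
      using lin that by (auto simp: linear_on_def)
    have "f \<psi> \<in> series.span ?G \<and> \<psi> \<in> series.span ?G"
      using \<open>\<psi> \<in> series.span ?G\<close>
    proof (induction rule: series.span_induct_alt)
      case base
      have "f 0 = f (sscale 0 0)" by simp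
      also have "\<dots> = 0"
        using f_scale[of 0 0] series.subspace_0[OF subspace_truncated] by (metis series.scale_zero_left)
      finally show ?case using series.span_zero by metis
    next
      case (step c x y)
      have x: "x \<in> truncated n" and y: "y \<in> truncated n" using step(1,2) G span_G by blast+
      have "f (sscale c x + y) = sscale c (f x) + f y"
        by (simp only: f_add[OF series.subspace_scale[OF subspace_truncated x] y] f_scale[OF x])
      moreover have "f x \<in> series.span ?G" by (rule series.span_base[OF op_G[OF f step(1)]])
      moreover have "x \<in> series.span ?G" by (rule series.span_base[OF step(1)])
      ultimately show ?case
        using step(2) by (simp only: series.span_add series.span_scale)
    qed
    then show "f \<psi> \<in> series.span ?G" ..
  qed
  show "invariant_subspace sscale (ring_ops n) (series.span ?G)"
    using op_span by (simp add: invariant_subspace_def series.subspace_span image_subset_iff)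
qed

lemma opspan_imp_products:
  fixes \<phi> :: "nat \<Rightarrow> log_series"
  assumes \<phi>: "\<And>j. \<phi> j \<in> truncated n" and \<psi>: "\<psi> \<in> opspan sscale (ring_ops n) (\<phi> ` {..<m})"
  shows "\<exists>a. (\<forall>j. a j \<in> coeff_ring n) \<and> \<psi> = (\<Sum>j<m. product (a j) (\<phi> j))"
proof -
  have "\<phi> ` {..<m} \<subseteq> truncated n" using \<phi> by auto
  from span_mono_opspan[OF this] \<psi>
  have "\<psi> \<in> series.span {mono_op x \<chi> | x \<chi>. x \<in> ring_monomials n \<and> \<chi> \<in> \<phi> ` {..<m}}" by auto
  then show ?thesis
  proof (induction rule: series.span_induct_alt)
    case base
    have "product 0 (\<phi> j) = 0" for j
      using product_eq(2)[of 0 n, OF _ \<phi>] by (simp add: coeff_ring_iff)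
    then show ?case by (intro exI[of _ "\<lambda>_. 0"]) (auto simp: coeff_ring_iff)
  next
    case (step c x y)
    then obtain a x' i where a: "\<And>j. a j \<in> coeff_ring n" "y = (\<Sum>j<m. product (a j) (\<phi> j))"
      "x = mono_op x' (\<phi> i)" "x' \<in> ring_monomials n" "i < m"
      by auto
    define b where "b = a(i := Poly_Mapping.single x' c + a i)"
    have b: "b j \<in> coeff_ring n" for j
      using a(1,4) by (auto simp: b_def intro: coeff_ring_add coeff_ring_single)
    have "product (b i) (\<phi> i) = sscale c x + product (a i) (\<phi> i)"
      using a(1,4) \<phi> by (simp add: b_def product_add[of _ n] coeff_ring_single product_single[of _ n] a(3))
    moreover have "(\<Sum>j\<in>{..<m} - {i}. product (b j) (\<phi> j)) = (\<Sum>j\<in>{..<m} - {i}. product (a j) (\<phi> j))"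
      by (intro sum.cong) (auto simp: b_def)
    ultimately have "(\<Sum>j<m. product (b j) (\<phi> j)) = sscale c x + y"
      using a(5) by (simp add: a(2) sum.remove[of "{..<m}" i] add.assoc)
    then show ?case using b by (intro exI[of _ b]) auto
  qed
qed

text \<open>Each variable has its own order from which the derivatives are combinations of lower
  ones. As this persists for all larger orders, the maximum serves every variable.\<close>

lemma exists_system:
  assumes \<phi>: "\<And>l k. l \<in> {1..n} \<Longrightarrow> (dz l ^^ k) \<phi> \<in> truncated n"
    and fg: "\<And>l. l \<in> {1..n} \<Longrightarrow> \<exists>S. finite S \<and> S \<subseteq> truncated n \<and> (\<forall>k. (dz l ^^ k) \<phi> \<in> opspan sscale (ring_ops n) S)"
  shows "\<exists>m. \<exists>a :: nat \<Rightarrow> nat \<Rightarrow> ring_expr.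
    (\<forall>k\<in>{1..m}. \<forall>l\<in>{1..n}. a k l \<in> coeff_ring n) \<and> satisfies_system n m a \<phi>"
proof -
  have "\<exists>m. \<forall>k\<ge>m. (dz l ^^ k) \<phi> \<in> opspan sscale (ring_ops n) ((\<lambda>k. (dz l ^^ k) \<phi>) ` {..<k})"
    if l: "l \<in> {1..n}" for l
  proof -
    obtain S where "finite S" "S \<subseteq> truncated n" "\<And>k. (dz l ^^ k) \<phi> \<in> opspan sscale (ring_ops n) S"
      using fg[OF l] by blast
    then show ?thesis
      by (intro opspan_sequence_stabilizes[OF vector_space_sscale finite_ring_ops invariant_truncated commuting_ring_ops])
  qed
  then obtain M where M: "\<And>l k. l \<in> {1..n} \<Longrightarrow> k \<ge> M l \<Longrightarrow>
      (dz l ^^ k) \<phi> \<in> opspan sscale (ring_ops n) ((\<lambda>k. (dz l ^^ k) \<phi>) ` {..<k})"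
    by metis
  define m where "m = Max (insert 0 (M ` {1..n}))"
  define good where "good l a \<longleftrightarrow> (\<forall>j. a j \<in> coeff_ring n) \<and> (dz l ^^ m) \<phi> = (\<Sum>j<m. product (a j) ((dz l ^^ j) \<phi>))"
    for l a
  have "\<forall>l\<in>{1..n}. \<exists>a. good l a"
  proof
    fix l assume l: "l \<in> {1..n}"
    then have "m \<ge> M l" by (simp add: m_def)
    from opspan_imp_products[OF \<phi>[OF l] M[OF l this]] show "\<exists>a. good l a"
      unfolding good_def .
  qed
  from bchoice[OF this] obtain b where "\<forall>l\<in>{1..n}. good l (b l)" ..
  then have b: "b l j \<in> coeff_ring n" "(dz l ^^ m) \<phi> = (\<Sum>j<m. product (b l j) ((dz l ^^ j) \<phi>))"
    if "l \<in> {1..n}" for l j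
    using that unfolding good_def by simp_all
  \<comment> \<open>The relation expresses the highest derivative through lower ones; moving these
    to the other side changes the sign, and the coefficient of index \<open>k\<close> belongs to the
    derivative of order \<open>m - k\<close>.\<close>
  define a where "a k l = - b l (m - k)" for k l
  have a: "a k l \<in> coeff_ring n" if "l \<in> {1..n}" for k l
    using b(1)[OF that] by (simp add: a_def coeff_ring_iff)
  have neg: "product (- c) \<psi> = - product c \<psi>" if "c \<in> coeff_ring n" "\<psi> \<in> truncated n" for c \<psi>
  proof -
    have "- c \<in> coeff_ring n" using that(1) by (simp add: coeff_ring_iff)
    then show ?thesis
      using that by (simp add: product_eq(2)[of _ n] sum_negf)
  qed
  have sum_apply: "(\<Sum>x\<in>X. f x) e k = (\<Sum>x\<in>X. f x e k)" for f :: "nat \<Rightarrow> log_series" and X e k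
    by (induction X rule: infinite_finite_induct) auto
  have "(dz l ^^ m) \<phi> e \<kappa> + (\<Sum>k=1..m. product (a k l) ((dz l ^^ (m - k)) \<phi>) e \<kappa>) = 0"
    if l: "l \<in> {1..n}" for l e \<kappa>
  proof -
    have "(\<Sum>k=1..m. product (a k l) ((dz l ^^ (m - k)) \<phi>) e \<kappa>)
        = (\<Sum>j<m. - product (b l j) ((dz l ^^ j) \<phi>) e \<kappa>)"
      by (rule sum.reindex_bij_witness[of _ "\<lambda>j. m - j" "\<lambda>k. m - k"])
        (auto simp: a_def neg[OF b(1)[OF l] \<phi>[OF l]])
    then show ?thesis by (subst b(2)[OF l]) (simp add: sum_apply sum_negf)
  qed
  then have "satisfies_system n m a \<phi>"
    unfolding satisfies_system_def using a product_eq(1)[OF _ \<phi>] by auto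
  then show ?thesis using a by (intro exI[of _ m] exI[of _ a]) auto
qed

section \<open>Homogeneous components\<close>

definition component :: "('i \<Rightarrow> 'b::ab_group_add set) \<Rightarrow> 'b \<Rightarrow> 'i \<Rightarrow> 'b"
  where "component G w = (THE f. (\<forall>i. f i \<in> G i) \<and> finite {i. f i \<noteq> 0} \<and> w = (\<Sum>i | f i \<noteq> 0. f i))"

locale graded_space = vector_space scale
  for scale :: "complex \<Rightarrow> 'b::ab_group_add \<Rightarrow> 'b" +
  fixes W :: "'b set" and G :: "'i \<Rightarrow> 'b set"
  assumes direct_sum: "direct_sum_on scale W UNIV G"
begin

lemma subspace_total: "subspace W" and subspace_piece: "subspace (G i)" and piece_subset: "G i \<subseteq> W"
  using direct_sum by (auto simp: direct_sum_on_def)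

lemma component_unique_ex:
  "w \<in> W \<Longrightarrow> \<exists>!f. (\<forall>i. f i \<in> G i) \<and> finite {i. f i \<noteq> 0} \<and> w = (\<Sum>i | f i \<noteq> 0. f i)"
  using direct_sum by (auto simp: direct_sum_on_def)

lemma component_mem: "w \<in> W \<Longrightarrow> component G w i \<in> G i"
  and finite_component: "w \<in> W \<Longrightarrow> finite {i. component G w i \<noteq> 0}"
  and sum_component: "w \<in> W \<Longrightarrow> (\<Sum>i | component G w i \<noteq> 0. component G w i) = w"
  using theI'[OF component_unique_ex, of w] unfolding component_def[symmetric] by auto

lemma component_in_total: "w \<in> W \<Longrightarrow> component G w i \<in> W"
  using component_mem piece_subset by blast

lemma component_eqI:
  assumes "finite F" "\<And>i. f i \<in> G i" "\<And>i. i \<notin> F \<Longrightarrow> f i = 0" "w = (\<Sum>i\<in>F. f i)"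
  shows "component G w = f"
proof -
  have w: "w \<in> W" unfolding assms(4) using assms(2) piece_subset by (intro subspace_sum[OF subspace_total]) blast
  have sub: "{i. f i \<noteq> 0} \<subseteq> F" using assms(3) by auto
  have "w = (\<Sum>i | f i \<noteq> 0. f i)"
    unfolding assms(4) using sub assms(1) by (intro sum.mono_neutral_right) auto
  then show ?thesis
    unfolding component_def using assms(2) finite_subset[OF sub assms(1)]
    by (intro the1_equality[OF component_unique_ex[OF w]]) auto
qed

lemma component_homogeneous: "w \<in> G i \<Longrightarrow> component G w j = (if j = i then w else 0)"
  using component_eqI[of "{i}" "\<lambda>j. if j = i then w else 0" w] subspace_0[OF subspace_piece] by auto

lemma component_add:
  assumes "v \<in> W" "w \<in> W"
  shows "component G (v + w) i = component G v i + component G w i"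
proof -
  let ?F = "{i. component G v i \<noteq> 0} \<union> {i. component G w i \<noteq> 0}"
  have *: "(\<Sum>i\<in>?F. component G x i) = x" if "x \<in> {v, w}" for x
    using that assms finite_component sum_component
    by (subst sum.mono_neutral_right[of _ "{i. component G x i \<noteq> 0}"]) auto
  have "component G (v + w) = (\<lambda>i. component G v i + component G w i)"
    using assms by (intro component_eqI[of ?F])
      (auto simp: finite_component sum.distrib * intro: subspace_add[OF subspace_piece] component_mem)
  then show ?thesis by simp
qed

lemma component_scale:
  assumes "w \<in> W"
  shows "component G (scale c w) i = scale c (component G w i)"
proof -
  have "component G (scale c w) = (\<lambda>i. scale c (component G w i))"
    using assms by (intro component_eqI[of "{i. component G w i \<noteq> 0}"])
      (auto simp: finite_component scale_sum_right[symmetric] sum_component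
        intro: subspace_scale[OF subspace_piece] component_mem)
  then show ?thesis by simp
qed

lemma component_0: "component G 0 i = 0"
  using component_homogeneous[OF subspace_0[OF subspace_piece], of i i] by simp

lemma component_sum:
  "(\<And>x. x \<in> X \<Longrightarrow> g x \<in> W) \<Longrightarrow> component G (sum g X) i = (\<Sum>x\<in>X. component G (g x) i)"
proof (induction X rule: infinite_finite_induct)
  case (insert x X)
  moreover have "sum g X \<in> W" using insert by (intro subspace_sum[OF subspace_total]) auto
  ultimately show ?case by (simp add: component_add)
qed (simp_all add: component_0)

text \<open>A decomposition for the finer grading is also one for the coarser grading. This shows
  that weight components of an element homogeneous in degree keep that degree.\<close>

lemma component_refine:
  assumes "graded_space scale W' G'" "\<And>i. G' i \<subseteq> G i" "w \<in> W'"
  shows "component G w = component G' w"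
proof -
  interpret sub: graded_space scale W' G' by fact
  show ?thesis
    using sub.finite_component[OF assms(3)] sub.component_mem[OF assms(3)] sub.sum_component[OF assms(3)] assms(2)
    by (intro component_eqI[of "{i. component G' w i \<noteq> 0}"]) auto
qed

end

lemma linear_on_0:
  assumes "vector_space s1" "vector_space s2" "linear_on s1 s2 S f" "x \<in> S"
  shows "f 0 = 0"
proof -
  interpret a: vector_space s1 by fact
  interpret b: vector_space s2 by fact
  have "f (s1 0 x) = s2 0 (f x)" using assms(3,4) unfolding linear_on_def by blast
  then show ?thesis by simp
qed

lemma linear_on_sum:
  assumes "vector_space s1" "vector_space s2" "module.subspace s1 S" "linear_on s1 s2 S f"
    "\<And>x. x \<in> X \<Longrightarrow> g x \<in> S"
  shows "f (sum g X) = (\<Sum>x\<in>X. f (g x))"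
proof -
  interpret a: vector_space s1 by fact
  interpret b: vector_space s2 by fact
  have f0: "f 0 = 0" using linear_on_0[OF assms(1,2,4)] a.subspace_0[OF assms(3)] by blast
  show ?thesis
    using assms(5)
  proof (induction X rule: infinite_finite_induct)
    case (insert x X)
    moreover have "sum g X \<in> S" using insert by (intro a.subspace_sum[OF assms(3)]) auto
    ultimately show ?case using assms(4) by (simp add: linear_on_def)
  qed (simp_all add: f0)
qed

text \<open>A homogeneous map carries a decomposition to a decomposition; injectivity of the shift
  \<open>h\<close> keeps distinct components apart.\<close>

lemma component_linear_image:
  assumes "graded_space s W G" "graded_space s' W' G'" "linear_on s s' W T"
    "\<And>i x. x \<in> G i \<Longrightarrow> T x \<in> G' (h i)" "inj h" "w \<in> W"
  shows "component G' (T w) (h i) = T (component G w i)"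
proof -
  interpret a: graded_space s W G by fact
  interpret b: graded_space s' W' G' by fact
  have vs: "vector_space s" "vector_space s'" by unfold_locales
  let ?F = "{i. component G w i \<noteq> 0}"
  have T0: "T 0 = 0" using linear_on_0[OF vs assms(3,6)] .
  have mem: "T (component G w j) \<in> W'" for j
    using assms(4)[OF a.component_mem[OF assms(6)]] b.piece_subset by blast
  have "T w = (\<Sum>j\<in>?F. T (component G w j))"
    using linear_on_sum[OF vs a.subspace_total assms(3), of ?F "component G w"]
      a.component_in_total[OF assms(6)] a.sum_component[OF assms(6)] by simp
  then have "component G' (T w) (h i) = (\<Sum>j\<in>?F. component G' (T (component G w j)) (h i))"
    using mem by (simp add: b.component_sum)
  also have "\<dots> = (\<Sum>j\<in>?F. if j = i then T (component G w j) else 0)"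
    using b.component_homogeneous[OF assms(4)[OF a.component_mem[OF assms(6)]]] injD[OF assms(5)]
    by (intro sum.cong) auto
  also have "\<dots> = T (component G w i)"
    using a.finite_component[OF assms(6)] T0 by (auto simp: sum.delta')
  finally show ?thesis .
qed


section \<open>Modes and weights\<close>

lemma jacobi_coeff_commutator:
  assumes "vector_space s" "jacobi_coeff s 0 m p q r"
  shows "p 0 - q 0 = Sum_any (\<lambda>i. s (of_int m gchoose i) (r i))"
proof -
  interpret vector_space s by fact
  have *: "Sum_any (\<lambda>i. s (c i * ((of_int 0 :: complex) gchoose i)) (x i)) = s (c 0) (x 0)" for c :: "nat \<Rightarrow> complex" and x
    by (subst Sum_any_eq_lessThan[of 1]) (auto simp: gbinomial_0_left)
  show ?thesis using assms(2) unfolding jacobi_coeff_def by (simp only: *) simp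
qed

text \<open>With \<open>l = -1\<close> and \<open>m = 0\<close> all coefficients on the left become
  1 in absolute value, and on the right only the index 0 survives. The result is the formula for the
  modes of \<open>u_{-1} v\<close>.\<close>

lemma jacobi_coeff_iterate:
  assumes "vector_space s" "jacobi_coeff s (-1) 0 p q r"
  shows "Sum_any p + Sum_any q = r 0"
proof -
  interpret vector_space s by fact
  have 1: "((-1)::complex) ^ i * ((of_int (-1) :: complex) gchoose i) = 1" for i
    by (simp add: gbinomial_minus binomial_gbinomial[symmetric] power_mult_distrib[symmetric])
  have 2: "((-1)::complex) powi (-1) * (-1) ^ i * ((of_int (-1) :: complex) gchoose i) = - 1" for i
    using 1[of i] by (simp add: power_int_minus mult.assoc)
  have 3: "Sum_any (\<lambda>i. s ((of_int 0 :: complex) gchoose i) (r i)) = r 0"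
    by (subst Sum_any_eq_lessThan[of 1]) (auto simp: gbinomial_0_left)
  have 4: "Sum_any (\<lambda>i. s (-1) (q i)) = - Sum_any q"
    by (simp add: Sum_any.expand_set sum_negf)
  show ?thesis using assms(2) unfolding jacobi_coeff_def 1 2 3 4 by simp
qed

context vertex_action
begin

lemma commutator:
  assumes "w \<in> carrier M"
  shows "act M u m (act M v h w) - act M v h (act M u m w) =
    Sum_any (\<lambda>i. scale M (of_int m gchoose i) (act M (mode V u (int i) v) (m + h - int i) w))"
  using jacobi_coeff_commutator[OF vector_space_ambient jacobi[OF assms, of 0 m u v h]] by simp

lemma act_add: "x \<in> carrier M \<Longrightarrow> y \<in> carrier M \<Longrightarrow> act M v n (x + y) = act M v n x + act M v n y"
  and act_scale: "x \<in> carrier M \<Longrightarrow> act M v n (scale M c x) = scale M c (act M v n x)"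
  using act_linear[of v n] by (auto simp: linear_on_def)

lemma act_zero: "act M v n 0 = 0"
proof -
  interpret amb: vector_space "scale M" by (rule vector_space_ambient)
  show ?thesis
    by (rule linear_on_0[OF vector_space_ambient vector_space_ambient act_linear amb.subspace_0[OF subspace_carrier]])
qed

lemma act_diff: "x \<in> carrier M \<Longrightarrow> y \<in> carrier M \<Longrightarrow> act M v n (x - y) = act M v n x - act M v n y"
proof -
  assume xy: "x \<in> carrier M" "y \<in> carrier M"
  interpret amb: vector_space "scale M" by (rule vector_space_ambient)
  have "act M v n (x + scale M (-1) y) = act M v n x + scale M (-1) (act M v n y)"
    using xy amb.subspace_scale[OF subspace_carrier] by (simp only: act_add act_scale)
  then show ?thesis by simp
qed

lemma act_left_add: "w \<in> carrier M \<Longrightarrow> act M (u + v) n w = act M u n w + act M v n w"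
  and act_left_scale: "w \<in> carrier M \<Longrightarrow> act M (vscale V c v) n w = scale M c (act M v n w)"
  using act_linear_left[of w n] by (auto simp: Vector_Spaces.linear_def module_hom_def module_hom_axioms_def)

lemma act_left_zero: "w \<in> carrier M \<Longrightarrow> act M 0 n w = 0"
  using act_left_add[of w 0 0 n] by simp

lemma act_left_sum: "w \<in> carrier M \<Longrightarrow> act M (sum g X) n w = (\<Sum>x\<in>X. act M (g x) n w)"
  by (induction X rule: infinite_finite_induct) (auto simp: act_left_add act_left_zero)

text \<open>Only two terms survive in the commutator formula for mode 1 of the conformal vector: its
  mode 0 on \<open>u\<close> is L(-1), contributing -(k + 1), and its mode 1 is L(0), contributing
  \<open>a\<close>.\<close>

lemma L0_commutator:
  assumes w: "w \<in> carrier M" and u: "Lop V (adjoint V) 0 u = vscale V (of_int a) u"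
  shows "Lop V M 0 (act M u k w) - act M u k (Lop V M 0 w) = scale M (of_int (a - k - 1)) (act M u k w)"
proof -
  interpret amb: vector_space "scale M" by (rule vector_space_ambient)
  let ?f = "\<lambda>i. scale M (of_int 1 gchoose i) (act M (mode V (conformal V) (int i) u) (1 + k - int i) w)"
  have big: "?f t = 0" if "t \<ge> 2" for t
  proof -
    have "(1::complex) gchoose t = of_nat (1 choose t)" by (simp add: binomial_gbinomial)
    then show ?thesis using that by simp
  qed
  have "Lop V M 0 (act M u k w) - act M u k (Lop V M 0 w) = Sum_any ?f"
    using commutator[OF w, of "conformal V" 1 u k] by (simp add: Lop_def)
  also have "\<dots> = (\<Sum>i<2. ?f i)" by (rule Sum_any_eq_lessThan) (rule big)
  also have "\<dots> = act M (mode V (conformal V) 0 u) (1 + k) w + act M (mode V (conformal V) 1 u) k w"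
    by (simp add: numeral_2_eq_2)
  also have "mode V (conformal V) 1 u = vscale V (of_int a) u"
    using u by (simp add: Lop_def adjoint_def)
  also have "act M (mode V (conformal V) 0 u) (1 + k) w = scale M (- of_int (1 + k)) (act M u k w)"
    using L_minus1_derivative[OF w, of u "1 + k"] by (simp add: Lop_def adjoint_def)
  also have "scale M (- of_int (1 + k)) (act M u k w) + act M (vscale V (of_int a) u) k w =
      scale M (of_int (a - k - 1)) (act M u k w)"
    by (simp add: act_left_scale[OF w] amb.scale_left_distrib[symmetric] del: amb.scale_minus_left)
  finally show ?thesis .
qed

end

context generalized_module
begin

sublocale weights: graded_space "scale M" "carrier M" "gweight V M"
  using module_action.vector_space_ambient module_weight_grading
  by (auto simp: graded_space_def graded_space_axioms_def)

sublocale algebra_weights: graded_space "vscale V" UNIV "vweight V"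
  using vector_space_algebra weight_grading
  by (auto simp: graded_space_def graded_space_axioms_def)

abbreviation wt :: "complex \<Rightarrow> 'w \<Rightarrow> 'w"
  where "wt b x \<equiv> component (gweight V M) x b"

lemma gweight_carrier: "x \<in> gweight V M b \<Longrightarrow> x \<in> carrier M"
  using weights.piece_subset by blast

lemma L0_shift_closed: "x \<in> carrier M \<Longrightarrow> Lop V M 0 x - scale M b x \<in> carrier M"
  unfolding Lop_def
  by (intro weights.subspace_diff[OF module_action.subspace_carrier] module_action.act_closed
      weights.subspace_scale[OF module_action.subspace_carrier])

text \<open>The mode intertwines L(0) - b with L(0) minus the shifted weight, so the power of the
  former that annihilates \<open>w\<close> yields a power of the latter that annihilates the
  image.\<close>

lemma act_weight:
  assumes u: "u \<in> vweight V a" and w: "w \<in> gweight V M b"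
  shows "act M u k w \<in> gweight V M (b + of_int (a - k - 1))"
proof -
  let ?c = "of_int (a - k - 1) :: complex"
  let ?D = "\<lambda>b x. Lop V M 0 x - scale M b x"
  have step: "?D (b + ?c) (act M u k x) = act M u k (?D b x)" if x: "x \<in> carrier M" for x
  proof -
    have "act M u k (?D b x) = act M u k (Lop V M 0 x) - scale M b (act M u k x)"
      using x by (subst module_action.act_diff)
        (auto simp: Lop_def module_action.act_scale
          intro: module_action.act_closed weights.subspace_scale[OF module_action.subspace_carrier])
    also have "\<dots> = Lop V M 0 (act M u k x) - scale M ?c (act M u k x) - scale M b (act M u k x)"
      using module_action.L0_commutator[OF x L0_weight[OF u], of k] by (simp add: algebra_simps)
    also have "\<dots> = ?D (b + ?c) (act M u k x)"
      by (simp add: weights.scale_left_distrib algebra_simps)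
    finally show ?thesis ..
  qed
  have pow: "(?D (b + ?c) ^^ N) (act M u k x) = act M u k ((?D b ^^ N) x) \<and> (?D b ^^ N) x \<in> carrier M"
    if x: "x \<in> carrier M" for x N
    using x
  proof (induction N)
    case (Suc N)
    then show ?case using step[of "(?D b ^^ N) x"] L0_shift_closed[of "(?D b ^^ N) x" b] by simp
  qed simp
  obtain N where N: "w \<in> carrier M" "(?D b ^^ N) w = 0"
    using w by (auto simp: gweight_def)
  then have "(?D (b + ?c) ^^ N) (act M u k w) = 0"
    using pow[OF N(1), of N] by (simp add: module_action.act_zero)
  then show ?thesis
    using module_action.act_closed[OF N(1)] unfolding gweight_def by auto
qed

lemma wt_act:
  assumes u: "u \<in> vweight V a" and w: "w \<in> carrier M"
  shows "wt (b + of_int (a - k - 1)) (act M u k w) = act M u k (wt b w)"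
proof -
  have "graded_space (scale M) (carrier M) (gweight V M)" by unfold_locales
  from component_linear_image[OF this this module_action.act_linear, of u k "\<lambda>b. b + of_int (a - k - 1)" w b]
  show ?thesis using act_weight[OF u] w by (simp add: inj_def)
qed

text \<open>Allows the elements of \<open>V_plus V\<close> in a pattern decomposition to be replaced
  by homogeneous ones of weight at least 1, from which the drop in weight comes.\<close>

lemma V_plus_component:
  assumes "u \<in> V_plus V"
  shows "component (vweight V) u a \<in> V_plus V" and "a \<le> 0 \<Longrightarrow> component (vweight V) u a = 0"
proof -
  have vp: "v \<in> V_plus V" if "v \<in> vweight V a" "a > 0" for v a
    unfolding V_plus_def using that by (intro algebra_weights.span_base) auto
  have "component (vweight V) u a \<in> V_plus V \<and> (a \<le> 0 \<longrightarrow> component (vweight V) u a = 0)"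
    using assms unfolding V_plus_def
  proof (induction rule: algebra_weights.span_induct_alt)
    case base
    then show ?case by (simp add: algebra_weights.component_0 algebra_weights.span_zero)
  next
    case (step c x y)
    then obtain n where n: "n > 0" "x \<in> vweight V n" by auto
    have x: "component (vweight V) x a = (if a = n then x else 0)"
      by (rule algebra_weights.component_homogeneous[OF n(2)])
    have "x \<in> algebra_weights.span (\<Union>n\<in>{0<..}. vweight V n)"
      using step by (intro algebra_weights.span_base)
    then show ?case
      using step n by (auto simp: algebra_weights.component_add algebra_weights.component_scale x
          algebra_weights.span_zero intro!: algebra_weights.span_add algebra_weights.span_scale)
  qed
  then show "component (vweight V) u a \<in> V_plus V" "a \<le> 0 \<Longrightarrow> component (vweight V) u a = 0" by auto
qed

lemma act_sum_components:
  assumes w: "w \<in> carrier M"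
  shows "act M u (-1) w = (\<Sum>a | component (vweight V) u a \<noteq> 0. act M (component (vweight V) u a) (-1) w)"
  using module_action.act_left_sum[OF w, of "component (vweight V) u" "{a. component (vweight V) u a \<noteq> 0}" "-1"]
    algebra_weights.sum_component[of u] by simp

lemma wt_act_minus1:
  assumes w: "w \<in> carrier M"
  shows "wt b (act M u (-1) w) =
    (\<Sum>a | component (vweight V) u a \<noteq> 0. act M (component (vweight V) u a) (-1) (wt (b - of_int a) w))"
proof -
  have "wt b (act M u (-1) w) = (\<Sum>a | component (vweight V) u a \<noteq> 0. wt b (act M (component (vweight V) u a) (-1) w))"
    unfolding act_sum_components[OF w, of u] by (rule weights.component_sum) (rule module_action.act_closed[OF w])
  also have "\<dots> = (\<Sum>a | component (vweight V) u a \<noteq> 0. act M (component (vweight V) u a) (-1) (wt (b - of_int a) w))"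
  proof (rule sum.cong)
    fix a
    show "wt b (act M (component (vweight V) u a) (-1) w) = act M (component (vweight V) u a) (-1) (wt (b - of_int a) w)"
      using wt_act[OF algebra_weights.component_mem[of u a] w, where b = "b - of_int a" and k = "-1"] by simp
  qed simp
  finally show ?thesis .
qed

lemma C1_carrier: "C1 V M \<subseteq> carrier M"
  unfolding C1_def
  by (rule weights.span_minimal) (auto intro: module_action.act_closed module_action.subspace_carrier)

lemma subspace_C1: "weights.subspace (C1 V M)"
  unfolding C1_def by (rule weights.subspace_span)

lemma wt_C1:
  assumes "c \<in> C1 V M"
  shows "wt b c \<in> C1 V M"
proof -
  have "wt b c \<in> C1 V M \<and> c \<in> C1 V M"
    using assms unfolding C1_def
  proof (induction rule: weights.span_induct_alt)
    case base
    then show ?case by (simp add: weights.component_0 weights.span_zero)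
  next
    case (step c x y)
    let ?S = "{act M u (- 1) w |u w. u \<in> V_plus V \<and> w \<in> carrier M}"
    obtain u w where uw: "x = act M u (-1) w" "u \<in> V_plus V" "w \<in> carrier M" using step by auto
    have "wt b x \<in> weights.span ?S"
      unfolding uw(1) wt_act_minus1[OF uw(3)]
      using V_plus_component(1)[OF uw(2)] weights.component_in_total[OF uw(3)]
      by (intro weights.span_sum weights.span_base) auto
    moreover have "x \<in> weights.span ?S" using step by (intro weights.span_base)
    moreover have "x \<in> carrier M" "y \<in> carrier M"
      using uw module_action.act_closed step C1_carrier unfolding C1_def by auto
    ultimately show ?case
      using step by (simp add: weights.component_add weights.component_scale
          weights.subspace_scale[OF module_action.subspace_carrier] weights.span_add weights.span_scale)
  qed
  then show ?thesis ..
qed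

end

section \<open>Coarsenings of partitions\<close>

text \<open>All partitions met during the reduction are submultisets of one fixed partition, so only
  finitely many degrees occur.\<close>

lemma finite_submultisets: "finite {q. q \<subseteq># p}"
proof (induction p)
  case (add a p)
  have "{q. q \<subseteq># add_mset a p} \<subseteq> {q. q \<subseteq># p} \<union> add_mset a ` {q. q \<subseteq># p}"
  proof
    fix q assume q: "q \<in> {q. q \<subseteq># add_mset a p}"
    show "q \<in> {q. q \<subseteq># p} \<union> add_mset a ` {q. q \<subseteq># p}"
    proof (cases "a \<in># q")
      case True
      then obtain r where "q = add_mset a r" by (blast dest: multi_member_split)
      then show ?thesis using q by auto
    next
      case False
      have "count q x \<le> count p x" for x
        using q mset_subset_eq_count[of q "add_mset a p" x] False by (cases "x = a") (auto simp: not_in_iff)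
      then show ?thesis by (simp add: subseteq_mset_def)
    qed
  qed
  then show ?case using add finite_subset by blast
qed auto

text \<open>\<open>coarse q p\<close>: up to zero entries, \<open>q\<close> arises from \<open>p\<close> by grouping.\<close>

inductive coarse :: "'a::ab_group_add multiset \<Rightarrow> 'a multiset \<Rightarrow> bool"
  where
    empty: "sum_mset p = 0 \<Longrightarrow> coarse {#} p"
  | add: "coarse q p \<Longrightarrow> sum_mset J = a \<Longrightarrow> coarse (add_mset a q) (J + p)"

lemma coarse_sum: "coarse q p \<Longrightarrow> sum_mset q = sum_mset p"
  by (induction rule: coarse.induct) auto

text \<open>The entries of the coarser partition are unordered, so the block of any entry can be
  split off, not just that of the entry added last. Applied to a pattern, it finds the block that
  travels with \<open>u\<close>.\<close>

lemma coarse_add_mset_elim: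
  assumes "coarse (add_mset a q) p"
  shows "\<exists>J p'. p = J + p' \<and> sum_mset J = a \<and> coarse q p'"
  using assms
proof (induction "add_mset a q" p arbitrary: q rule: coarse.induct)
  case (add q0 p J b)
  show ?case
  proof (cases "a = b")
    case True
    then show ?thesis using add by auto
  next
    case False
    then obtain q1 where q1: "q0 = add_mset a q1" "q = add_mset b q1"
      using add.hyps(4) by (auto simp: add_eq_conv_ex)
    obtain J' p' where J': "p = J' + p'" "sum_mset J' = a" "coarse q1 p'"
      using add.hyps(2)[OF q1(1)] by blast
    have "coarse q (J + p')" unfolding q1(2) by (rule coarse.add[OF J'(3) add.hyps(3)])
    moreover have "J + p = J' + (J + p')" using J' by simp
    ultimately show ?thesis using J'(2) by blast
  qed
qed auto

text \<open>A block with sum 0 would give a zero entry, and zero entries are disregarded.\<close>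

lemma coarse_sum_zero: "coarse q p \<Longrightarrow> sum_mset J = 0 \<Longrightarrow> coarse q (J + p)"
proof (induction rule: coarse.induct)
  case (empty p)
  then show ?case by (auto intro: coarse.empty)
next
  case (add q p J' a)
  from coarse.add[OF add.IH[OF add.prems] add.hyps(2)] show ?case by (simp add: ac_simps)
qed

lemma coarse_nonzero_part: "coarse q p \<Longrightarrow> coarse (nonzero_part q) p"
proof (induction rule: coarse.induct)
  case (add q p J a)
  then show ?case
    by (cases "a = 0") (auto simp: nonzero_part_def intro: coarse.add coarse_sum_zero)
qed (auto simp: nonzero_part_def intro: coarse.empty)

lemma coarse_of_nonzero_part: "coarse (nonzero_part q) p \<Longrightarrow> coarse q p"
proof (induction q arbitrary: p)
  case (add a q)
  show ?case
  proof (cases "a = 0")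
    case True
    then have "coarse q p" using add by (auto simp: nonzero_part_def)
    from coarse.add[OF this, of "{#}" 0] True show ?thesis by simp
  next
    case False
    then have "coarse (add_mset a (nonzero_part q)) p" using add by (auto simp: nonzero_part_def)
    then obtain J p' where "p = J + p'" "sum_mset J = a" "coarse (nonzero_part q) p'"
      using coarse_add_mset_elim by blast
    then show ?thesis using add.IH by (auto intro: coarse.add)
  qed
qed (auto simp: nonzero_part_def)

lemma coarse_same_partition: "same_partition q r \<Longrightarrow> coarse q p \<longleftrightarrow> coarse r p"
  unfolding same_partition_def by (metis coarse_nonzero_part coarse_of_nonzero_part)

lemma coarse_split:
  "coarse (J + p) r \<Longrightarrow> \<exists>r1 r2. r = r1 + r2 \<and> sum_mset r1 = sum_mset J \<and> coarse p r2"
proof (induction J arbitrary: r)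
  case empty
  then show ?case by (intro exI[of _ "{#}"] exI[of _ r]) auto
next
  case (add a J)
  then obtain J' r' where J': "r = J' + r'" "sum_mset J' = a" "coarse (J + p) r'"
    using coarse_add_mset_elim[of a "J + p" r] by auto
  then obtain r1 r2 where "r' = r1 + r2" "sum_mset r1 = sum_mset J" "coarse p r2"
    using add.IH by blast
  then show ?case using J' by (intro exI[of _ "J' + r1"] exI[of _ r2]) (auto simp: ac_simps)
qed

lemma coarse_trans: "coarse q p \<Longrightarrow> coarse p r \<Longrightarrow> coarse q r"
proof (induction arbitrary: r rule: coarse.induct)
  case (empty p)
  then show ?case using coarse_sum[OF empty(2)] by (auto intro: coarse.empty)
next
  case (add q p J a)
  then obtain r1 r2 where r: "r = r1 + r2" "sum_mset r1 = sum_mset J" "coarse p r2"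
    using coarse_split by blast
  then show ?case using add by (auto intro: coarse.add)
qed

lemma coarse_refl: "coarse q q"
proof (induction q)
  case (add a q)
  from coarse.add[OF this, of "{#a#}" a] show ?case by simp
qed (auto intro: coarse.empty)

lemma coarse_single: "coarse {#sum_mset p#} p"
  using coarse.add[OF coarse.empty, of "{#}" p "sum_mset p"] by simp

lemma coarse_groupings: "q \<in> groupings p \<Longrightarrow> coarse q p"
proof -
  have "coarse (image_mset sum_mset Q) (sum_mset Q)" for Q :: "'a multiset multiset"
    by (induction Q) (auto intro: coarse.intros)
  then show "q \<in> groupings p \<Longrightarrow> coarse q p" by (auto simp: groupings_def)
qed


section \<open>Subspaces spanned by elements with a given pattern\<close>

locale pattern_module = strongly_graded_module V A Vg M Wg
  for V :: "('v::ab_group_add, 'm) vertex_data_scheme"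
    and A :: "'a::ab_group_add set"
    and Vg :: "'a \<Rightarrow> 'v set"
    and M :: "('v, 'w::ab_group_add, 'n) vmod_scheme"
    and Wg :: "'a \<Rightarrow> 'w set" +
  fixes P :: "'a \<Rightarrow> 'w \<Rightarrow> 'a multiset"
  assumes cofinite: "C1_cofinite V M Wg"
    and assignment: "pattern_assignment V A Vg M Wg P"
    and preserved: "patterns_preserved A Vg M Wg P"

context strongly_graded_module
begin

sublocale degrees: graded_space "scale M" "carrier M" Wg
  using module_action.vector_space_ambient module_degree_grading
  by (auto simp: graded_space_def graded_space_axioms_def)

lemma degree_weights: "graded_space (scale M) (Wg \<beta>) (\<lambda>b. gweight V M b \<inter> Wg \<beta>)"
  using module_action.vector_space_ambient module_compatible
  by (auto simp: graded_space_def graded_space_axioms_def)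

lemma degree_carrier: "x \<in> Wg \<beta> \<Longrightarrow> x \<in> carrier M"
  using degrees.piece_subset by blast

lemma wt_degree:
  assumes "x \<in> Wg \<beta>"
  shows "wt b x \<in> gweight V M b \<inter> Wg \<beta>"
proof -
  interpret dw: graded_space "scale M" "Wg \<beta>" "\<lambda>b. gweight V M b \<inter> Wg \<beta>" by (rule degree_weights)
  have "component (gweight V M) x = component (\<lambda>b. gweight V M b \<inter> Wg \<beta>) x"
    by (rule weights.component_refine[OF degree_weights _ assms]) auto
  then show ?thesis using dw.component_mem[OF assms] by simp
qed

lemma algebra_component_degree:
  assumes "\<alpha> \<in> A" "u \<in> Vg \<alpha>"
  shows "component (vweight V) u a \<in> vweight V a \<inter> Vg \<alpha>"
proof -
  have gs: "graded_space (vscale V) (Vg \<alpha>) (\<lambda>n. vweight V n \<inter> Vg \<alpha>)"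
    using vector_space_algebra compatible[OF assms(1)]
    by (auto simp: graded_space_def graded_space_axioms_def)
  then interpret dw: graded_space "vscale V" "Vg \<alpha>" "\<lambda>n. vweight V n \<inter> Vg \<alpha>" .
  have "component (vweight V) u = component (\<lambda>n. vweight V n \<inter> Vg \<alpha>) u"
    by (rule algebra_weights.component_refine[OF gs _ assms(2)]) auto
  then show ?thesis using dw.component_mem[OF assms(2)] by simp
qed

text \<open>The weight 0 is included because there the scalar part of the bracket of L(N) and L(-N)
  vanishes when the central charge is 0.\<close>

definition exceptional :: "'a \<Rightarrow> complex set"
  where "exceptional \<beta> = insert 0 {b. \<not> gweight V M b \<inter> Wg \<beta> \<subseteq> C1 V M}"

text \<open>The finitely many representatives have components in finitely many weights. At any other
  weight, taking the weight component of a spanning expression leaves only components of elements of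
  \<open>C1 V M\<close>, which stay in it.\<close>

lemma finite_exceptional:
  assumes "C1_cofinite V M Wg"
  shows "finite (exceptional \<beta>)"
proof -
  obtain B where B: "finite B" "B \<subseteq> Wg \<beta>" "Wg \<beta> \<subseteq> weights.span (B \<union> (C1 V M \<inter> Wg \<beta>))"
    using assms unfolding C1_cofinite_def by blast
  let ?E = "\<Union>x\<in>B. {b. wt b x \<noteq> 0}"
  have "gweight V M b \<inter> Wg \<beta> \<subseteq> C1 V M" if b: "b \<notin> ?E" for b
  proof
    fix y assume y: "y \<in> gweight V M b \<inter> Wg \<beta>"
    then have "y \<in> weights.span (B \<union> (C1 V M \<inter> Wg \<beta>))" using B by auto
    then have "wt b y \<in> C1 V M \<and> y \<in> carrier M"
    proof (induction rule: weights.span_induct_alt)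
      case base
      then show ?case
        by (simp add: weights.component_0 weights.subspace_0 subspace_C1 module_action.subspace_carrier)
    next
      case (step c x y)
      then have x: "x \<in> carrier M" "wt b x \<in> C1 V M"
        using B(2) degree_carrier wt_C1 b weights.subspace_0[OF subspace_C1] by auto
      then show ?case
        using step by (simp add: weights.component_add weights.component_scale
            weights.subspace_add weights.subspace_scale subspace_C1 module_action.subspace_carrier)
    qed
    then show "y \<in> C1 V M" using weights.component_homogeneous[of y b b] y by auto
  qed
  then have "exceptional \<beta> \<subseteq> insert 0 ?E" by (auto simp: exceptional_def)
  moreover have "finite ?E" using B weights.finite_component degree_carrier by auto
  ultimately show ?thesis using finite_subset by blast
qed

end

context pattern_module
begin

lemma pattern_sum: "x \<in> Wg \<beta> \<Longrightarrow> sum_mset (P \<beta> x) = \<beta>"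
  using assignment unfolding pattern_assignment_def by (auto elim: pattern_of.cases)

lemma coarse_act:
  assumes "\<alpha> \<in> A" "u \<in> Vg \<alpha>" "x \<in> Wg \<beta>" "coarse (P \<beta> x) Q" "sum_mset J = \<alpha>"
  shows "coarse (P (\<alpha> + \<beta>) (act M u k x)) (J + Q)"
proof -
  obtain p where p: "p \<in> groupings (add_mset \<alpha> (P \<beta> x))" "same_partition (P (\<alpha> + \<beta>) (act M u k x)) p"
    using preserved assms unfolding patterns_preserved_def by blast
  from coarse_trans[OF coarse_groupings[OF p(1)] coarse.add[OF assms(4,5)]]
  show ?thesis using coarse_same_partition[OF p(2)] by auto
qed

definition pattern_space :: "'a multiset \<Rightarrow> complex \<Rightarrow> 'w set"
  where "pattern_space Q b = weights.span {wt b x | x. x \<in> Wg (sum_mset Q) \<and> coarse (P (sum_mset Q) x) Q}"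

lemma subspace_doubly_homogeneous: "weights.subspace (gweight V M b \<inter> Wg \<beta>)"
  by (rule weights.subspace_inter[OF weights.subspace_piece degrees.subspace_piece])

lemma pattern_space_subset: "pattern_space Q b \<subseteq> gweight V M b \<inter> Wg (sum_mset Q)"
  unfolding pattern_space_def using wt_degree
  by (intro weights.span_minimal subspace_doubly_homogeneous) auto

lemma pattern_space_carrier: "x \<in> pattern_space Q b \<Longrightarrow> x \<in> carrier M"
  using pattern_space_subset gweight_carrier by blast

lemma wt_in_pattern_space: "x \<in> Wg \<beta> \<Longrightarrow> wt b x \<in> pattern_space (P \<beta> x) b"
  unfolding pattern_space_def using pattern_sum by (intro weights.span_base) (auto intro: coarse_refl)

text \<open>The degree of \<open>u\<close> is added as a block \<open>J\<close> and not as a single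
  entry. The entries keep their identity while they move between slots, so their union over all
  slots is conserved.\<close>

lemma act_pattern_space:
  assumes "sum_mset J \<in> A" "u \<in> vweight V a \<inter> Vg (sum_mset J)" "x \<in> pattern_space Q b"
  shows "act M u k x \<in> pattern_space (J + Q) (b + of_int (a - k - 1))"
proof -
  have "act M u k x \<in> pattern_space (J + Q) (b + of_int (a - k - 1)) \<and> x \<in> carrier M"
    using assms(3) unfolding pattern_space_def
  proof (induction rule: weights.span_induct_alt)
    case base
    then show ?case by (simp add: module_action.act_zero weights.span_zero weights.subspace_0[OF module_action.subspace_carrier])
  next
    case (step c x y)
    then obtain z where z: "x = wt b z" "z \<in> Wg (sum_mset Q)" "coarse (P (sum_mset Q) z) Q" by auto
    have y: "y \<in> carrier M" using step(2) by blast
    have x: "x \<in> carrier M" unfolding z(1) using z(2) degree_carrier weights.component_in_total by auto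
    have "act M u k x = wt (b + of_int (a - k - 1)) (act M u k z)"
      using wt_act[of u a z k b] assms(2) z degree_carrier by simp
    moreover have "act M u k z \<in> Wg (sum_mset (J + Q))"
      using act_degree[OF assms(1) _ z(2), of u k] assms(2) by simp
    moreover have "coarse (P (sum_mset (J + Q)) (act M u k z)) (J + Q)"
      using coarse_act[OF assms(1) _ z(2,3), of u J k] assms(2) by simp
    ultimately have "act M u k x \<in> {wt (b + of_int (a - k - 1)) x | x. x \<in> Wg (sum_mset (J + Q)) \<and> coarse (P (sum_mset (J + Q)) x) (J + Q)}"
      by blast
    then show ?case
      using step x y by (simp add: weights.subspace_add[OF module_action.subspace_carrier] module_action.act_add module_action.act_scale
          weights.subspace_scale[OF module_action.subspace_carrier] weights.span_add weights.span_scale weights.span_base)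
  qed
  then show ?thesis ..
qed

text \<open>The elements accessible to one reduction step: the block \<open>J\<close> of
  \<open>Q\<close> leaves with \<open>u\<close>, and the rest of \<open>Q\<close> stays with
  \<open>x\<close>.\<close>

definition reducible :: "'a multiset \<Rightarrow> complex \<Rightarrow> 'w set"
  where "reducible Q b = weights.span {act M u (-1) x | u x J Q' a. Q = J + Q' \<and> sum_mset J \<in> A \<and> a \<ge> 1 \<and>
    u \<in> vweight V a \<inter> Vg (sum_mset J) \<and> x \<in> pattern_space Q' (b - of_int a)}"

text \<open>All terms of the chosen decomposition of \<open>x\<close> have the pattern of
  \<open>x\<close>, up to zeros. Hence each term splits \<open>Q\<close> into a block with the
  degree of its \<open>u\<close> and a partition for the remaining factor, and its weight components
  inherit the splitting.\<close>

lemma wt_reducible: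
  assumes x: "x \<in> Wg (sum_mset Q)" "x \<in> C1 V M" "coarse (P (sum_mset Q) x) Q"
  shows "wt b x \<in> reducible Q b"
proof -
  let ?\<beta> = "sum_mset Q"
  have "pattern_of V A Vg M Wg P ?\<beta> x" using assignment x(1) unfolding pattern_assignment_def by blast
  then obtain N c u w' \<alpha> where dec:
    "x = (\<Sum>i<N::nat. scale M (c i) (act M (u i) (-1) (w' i)))"
    "\<And>i. i < N \<Longrightarrow> \<alpha> i \<in> A \<and> u i \<in> V_plus V \<inter> Vg (\<alpha> i) \<and> w' i \<in> Wg (?\<beta> - \<alpha> i)"
    "\<And>i. i < N \<Longrightarrow> same_partition (P ?\<beta> x) (add_mset (\<alpha> i) (P (?\<beta> - \<alpha> i) (w' i)))"
    using x(2) by (cases rule: pattern_of.cases) blast+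
  have w': "w' i \<in> carrier M" if "i < N" for i using dec(2)[OF that] degree_carrier by blast
  have "wt b x = (\<Sum>i<N. scale M (c i) (wt b (act M (u i) (-1) (w' i))))"
    unfolding dec(1) using w' module_action.act_closed
    by (subst weights.component_sum) (auto simp: weights.component_scale
        intro!: sum.cong weights.subspace_scale[OF module_action.subspace_carrier])
  moreover have "wt b (act M (u i) (-1) (w' i)) \<in> reducible Q b" if i: "i < N" for i
  proof -
    have "coarse (add_mset (\<alpha> i) (P (?\<beta> - \<alpha> i) (w' i))) Q"
      using coarse_same_partition[OF dec(3)[OF i]] x(3) by blast
    then obtain J Q' where J: "Q = J + Q'" "sum_mset J = \<alpha> i" "coarse (P (?\<beta> - \<alpha> i) (w' i)) Q'"
      using coarse_add_mset_elim by blast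
    have Q': "sum_mset Q' = ?\<beta> - \<alpha> i" using J by simp
    have "act M (component (vweight V) (u i) a) (-1) (wt (b - of_int a) (w' i)) \<in> reducible Q b"
      if a: "component (vweight V) (u i) a \<noteq> 0" for a
    proof -
      have "a \<ge> 1" using V_plus_component(2)[of "u i" a] dec(2)[OF i] a by force
      moreover have "component (vweight V) (u i) a \<in> vweight V a \<inter> Vg (sum_mset J)"
        using algebra_component_degree dec(2)[OF i] J by auto
      moreover have "wt (b - of_int a) (w' i) \<in> pattern_space Q' (b - of_int a)"
      proof -
        have "w' i \<in> Wg (sum_mset Q')" unfolding Q' using dec(2)[OF i] by blast
        moreover have "coarse (P (sum_mset Q') (w' i)) Q'" unfolding Q' by (rule J(3))
        ultimately show ?thesis unfolding pattern_space_def by (intro weights.span_base) blast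
      qed
      moreover have "sum_mset J \<in> A" using J dec(2)[OF i] by simp
      ultimately show ?thesis
        unfolding reducible_def using J(1) by (intro weights.span_base) blast
    qed
    then show ?thesis
      unfolding wt_act_minus1[OF w'[OF i]] by (intro weights.subspace_sum) (auto simp: reducible_def)
  qed
  ultimately show ?thesis
    by (auto simp: reducible_def intro!: weights.subspace_sum weights.span_scale)
qed

lemma Lop_degree: "x \<in> Wg \<beta> \<Longrightarrow> Lop V M k x \<in> Wg \<beta>"
  using act_degree[OF subgroup(1) conformal_degree, of x \<beta> "k + 1"] by (simp add: Lop_def)

lemma Lop_coarse: "x \<in> Wg \<beta> \<Longrightarrow> coarse (P \<beta> x) Q \<Longrightarrow> coarse (P \<beta> (Lop V M k x)) Q"
  using coarse_act[OF subgroup(1) conformal_degree, of x \<beta> Q "{#}" "k + 1"] by (simp add: Lop_def)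

lemma Lop_weight: "x \<in> gweight V M b \<Longrightarrow> Lop V M k x \<in> gweight V M (b - of_int k)"
  using act_weight[OF conformal_weight, of x b "k + 1"] by (simp add: Lop_def)

text \<open>The pattern of an element outside \<open>C1 V M\<close> is trivial, and adding \<open>x\<^sub>0 \<notin> C1 V M\<close> moves any element of
  \<open>C1 V M\<close> outside. Hence \<open>L(k) z\<close> is a combination of elements with trivial pattern once \<open>L(k) x\<^sub>0 \<in> C1 V M\<close>.\<close>

lemma Lop_reducible:
  assumes x0: "x0 \<in> Wg (sum_mset Q)" "x0 \<notin> C1 V M" "Lop V M k x0 \<in> C1 V M"
    and z: "z \<in> Wg (sum_mset Q)" "Lop V M k z \<in> C1 V M"
  shows "wt b (Lop V M k z) \<in> reducible Q b"
proof -
  let ?\<beta> = "sum_mset Q"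
  \<comment> \<open>The partition with a single entry is coarser than every partition of the degree,
    so the trivial pattern is compatible with \<open>Q\<close> whatever \<open>Q\<close> is.\<close>
  have triv: "coarse (P ?\<beta> x) Q" if "x \<in> Wg ?\<beta>" "x \<notin> C1 V M" for x
  proof -
    have "same_partition (P ?\<beta> x) {#?\<beta>#}"
      using assignment that unfolding pattern_assignment_def by (auto elim: pattern_of.cases)
    then show ?thesis using coarse_same_partition coarse_single by blast
  qed
  have out: "wt b (Lop V M k x) \<in> reducible Q b" if "x \<in> Wg ?\<beta>" "x \<notin> C1 V M" "Lop V M k x \<in> C1 V M" for x
    using that triv by (intro wt_reducible Lop_degree Lop_coarse) auto
  show ?thesis
  proof (cases "z \<in> C1 V M")
    case False
    then show ?thesis using out z by blast
  next
    case True
    have sum: "x0 + z \<in> Wg ?\<beta>" using x0 z weights.subspace_add[OF degrees.subspace_piece] by blast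
    have "x0 + z \<notin> C1 V M"
      using True x0(2) weights.subspace_diff[OF subspace_C1, of "x0 + z" z] by auto
    have Ladd: "Lop V M k (x0 + z) = Lop V M k x0 + Lop V M k z"
      unfolding Lop_def using x0 z degree_carrier by (intro module_action.act_add)
    then have "Lop V M k (x0 + z) \<in> C1 V M"
      using x0(3) z(2) weights.subspace_add[OF subspace_C1] by simp
    from out[OF sum \<open>x0 + z \<notin> C1 V M\<close> this] out[OF x0]
    have "wt b (Lop V M k (x0 + z)) - wt b (Lop V M k x0) \<in> reducible Q b"
      unfolding reducible_def by (rule weights.span_diff)
    moreover have "Lop V M k x0 \<in> carrier M" "Lop V M k z \<in> carrier M"
      using x0(3) z(2) C1_carrier by auto
    ultimately show ?thesis by (simp add: Ladd weights.component_add)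
  qed
qed

lemma pattern_space_reducible:
  assumes b: "b \<notin> exceptional (sum_mset Q)"
  shows "pattern_space Q b \<subseteq> reducible Q b"
proof (cases "Wg (sum_mset Q) \<subseteq> C1 V M")
  case True
  then show ?thesis
    unfolding pattern_space_def using wt_reducible
    by (intro weights.span_minimal) (auto simp: reducible_def)
next
  case False
  let ?\<beta> = "sum_mset Q"
  obtain x where x: "x \<in> Wg ?\<beta>" "x \<notin> C1 V M" using False by auto
  then have "x = (\<Sum>\<nu> | wt \<nu> x \<noteq> 0. wt \<nu> x)"
    using weights.sum_component degree_carrier by simp
  then have "\<exists>\<nu>. wt \<nu> x \<notin> C1 V M"
    using x(2) weights.subspace_sum[OF subspace_C1, of "{\<nu>. wt \<nu> x \<noteq> 0}" "\<lambda>\<nu>. wt \<nu> x"] by metis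
  then obtain \<nu> where \<nu>: "wt \<nu> x \<notin> C1 V M" ..
  \<comment> \<open>Homogeneity in weight is needed so that L(-N) \<open>x0\<close> has the single
    weight \<open>\<nu> + N\<close>, which is not exceptional for large N and thus puts this element
    into \<open>C1 V M\<close>.\<close>
  define x0 where "x0 = wt \<nu> x"
  have x0: "x0 \<in> Wg ?\<beta>" "x0 \<notin> C1 V M" "x0 \<in> gweight V M \<nu>"
    using \<nu> wt_degree[OF x(1)] by (auto simp: x0_def)
  have C1: "y \<in> C1 V M" if "y \<in> gweight V M c \<inter> Wg ?\<beta>" "c \<notin> exceptional ?\<beta>" for y c
    using that by (auto simp: exceptional_def)
  obtain N0 where N0: "\<forall>n\<ge>N0. act M (conformal V) n x0 = 0"
    using module_action.lower_truncation degree_carrier[OF x0(1)] by blast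
  have "finite ((\<lambda>N. \<nu> + of_int N) -` exceptional ?\<beta>)"
    using finite_exceptional[OF cofinite] by (rule finite_vimageI) (simp add: inj_def)
  then obtain N1 where N1: "\<And>N::int. N \<ge> N1 \<Longrightarrow> \<nu> + of_int N \<notin> exceptional ?\<beta>"
  proof -
    assume fin: "finite ((\<lambda>N. \<nu> + of_int N) -` exceptional ?\<beta>)"
    let ?X = "insert 0 ((\<lambda>N::int. \<nu> + of_int N) -` exceptional ?\<beta>)"
    have "\<nu> + of_int N \<notin> exceptional ?\<beta>" if "N \<ge> Max ?X + 1" for N :: int
    proof
      assume "\<nu> + of_int N \<in> exceptional ?\<beta>"
      then have "N \<le> Max ?X" using fin by (intro Max_ge) auto
      with \<open>N \<ge> Max ?X + 1\<close> show False by linarith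
    qed
    then show thesis by (rule that)
  qed
  have "b \<noteq> 0" using b by (auto simp: exceptional_def)
  \<comment> \<open>The scalar by which the bracket of L(N) and L(-N) acts on an eigenvector of L(0)
    with eigenvalue \<open>b\<close>.\<close>
  define d where "d N = 2 * of_int N * b + of_int (N ^ 3 - N) / 12 * central V" for N :: int
  define K where "K = max 1 (max N0 N1)"
  have "\<exists>N\<ge>K. d N \<noteq> 0"
  proof (rule ccontr)
    assume "\<not> (\<exists>N\<ge>K. d N \<noteq> 0)"
    \<comment> \<open>After division by N, the values at \<open>K\<close> and \<open>K + 1\<close>
      differ by (2K + 1)/12 times the central charge. If both vanish, the central charge is 0, and
      then \<open>b = 0\<close>.\<close>
    then have "d K = 0" "d (K + 1) = 0" by auto
    moreover have "d N = of_int N * (2 * b + of_int (N\<^sup>2 - 1) / 12 * central V)" for N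
      unfolding d_def by (simp add: field_simps power2_eq_square power3_eq_cube)
    moreover have "K \<noteq> 0" "K + 1 \<noteq> 0" unfolding K_def by auto
    ultimately have eq: "2 * b + of_int (K\<^sup>2 - 1) / 12 * central V = 0"
      "2 * b + of_int ((K + 1)\<^sup>2 - 1) / 12 * central V = 0"
      by (simp_all only: mult_eq_0_iff of_int_eq_0_iff) auto
    have "of_int ((K + 1)\<^sup>2 - 1) / 12 * central V - of_int (K\<^sup>2 - 1) / 12 * central V = 0"
      using eq by (metis add_diff_cancel_left diff_self)
    moreover have "of_int ((K + 1)\<^sup>2 - 1) / 12 * central V - of_int (K\<^sup>2 - 1) / 12 * central V
        = of_int (2 * K + 1) / 12 * central V"
      by (simp add: field_simps power2_eq_square)
    ultimately have "of_int (2 * K + 1) / 12 * central V = 0" by (simp only:)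
    then have "of_int (2 * K + 1) * central V = 0"
      by (simp only: times_divide_eq_left divide_eq_0_iff) auto
    moreover have "2 * K + 1 \<noteq> 0" unfolding K_def by auto
    ultimately have "central V = 0" by (simp only: mult_eq_0_iff of_int_eq_0_iff) simp
    with eq(1) \<open>b \<noteq> 0\<close> show False by simp
  qed
  then obtain N where N: "N \<ge> N0" "N \<ge> N1" "d N \<noteq> 0" unfolding K_def by auto
  have "Lop V M N x0 = 0" using N0 N(1) by (simp add: Lop_def)
  then have up: "Lop V M N x0 \<in> C1 V M" by (simp add: weights.subspace_0 subspace_C1)
  have down: "Lop V M (- N) x0 \<in> C1 V M"
    using Lop_weight[OF x0(3), of "- N"] Lop_degree[OF x0(1)] N1[OF N(2)] by (intro C1[of _ "\<nu> + of_int N"]) auto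
  \<comment> \<open>An element of weight \<open>b\<close> in this degree lies in
    \<open>C1 V M\<close> because \<open>b\<close> is not exceptional; this supplies the membership
    of L(k) z required for the reduction.\<close>
  have red: "y \<in> reducible Q b" if y: "y \<in> gweight V M b \<inter> Wg ?\<beta>"
    "y = Lop V M k z" "z \<in> Wg ?\<beta>" "k \<in> {N, - N}" for y k z
  proof -
    have "wt b (Lop V M k z) \<in> reducible Q b"
      using y C1[OF y(1) b] up down by (intro Lop_reducible[OF x0(1,2)]) auto
    then show ?thesis using y weights.component_homogeneous[of y b b] by simp
  qed
  have bracket: "scale M (d N) y + scale M (2 * of_int N) (Lop V M 0 y - scale M b y) \<in> reducible Q b"
    if y: "y \<in> gweight V M b \<inter> Wg ?\<beta>" for y
  proof -
    have yc: "y \<in> carrier M" using y gweight_carrier by auto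
    have "Lop V M N (Lop V M (- N) y) \<in> gweight V M b \<inter> Wg ?\<beta>"
      using y Lop_degree Lop_weight[OF Lop_weight[of y b "- N"], of N] by auto
    then have 1: "Lop V M N (Lop V M (- N) y) \<in> reducible Q b"
      using y Lop_degree by (intro red[of _ N]) auto
    have "Lop V M (- N) (Lop V M N y) \<in> gweight V M b \<inter> Wg ?\<beta>"
      using y Lop_degree Lop_weight[OF Lop_weight[of y b N], of "- N"] by auto
    then have 2: "Lop V M (- N) (Lop V M N y) \<in> reducible Q b"
      using y Lop_degree by (intro red[of _ "- N"]) auto
    have "Lop V M N (Lop V M (- N) y) - Lop V M (- N) (Lop V M N y) =
        scale M (of_int (2 * N)) (Lop V M 0 y) + scale M ((of_int (N ^ 3 - N) / 12) * central V) y"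
      using module_action.virasoro[OF yc, of N "- N"] by simp
    also have "\<dots> = scale M (d N) y + scale M (2 * of_int N) (Lop V M 0 y - scale M b y)"
      by (simp add: d_def weights.scale_left_distrib weights.scale_right_diff_distrib mult.assoc)
    finally show ?thesis
      using weights.span_diff[OF 1[unfolded reducible_def] 2[unfolded reducible_def]] by (simp add: reducible_def)
  qed
  \<comment> \<open>Induction on the order of nilpotency: the bracket relation involves
    \<open>y\<close> with the nonzero coefficient \<open>d N\<close>, and otherwise L(0) y - b y,
    whose order is smaller.\<close>
  have "y \<in> reducible Q b" if "y \<in> gweight V M b \<inter> Wg ?\<beta>" "((\<lambda>x. Lop V M 0 x - scale M b x) ^^ n) y = 0" for y n
    using that
  proof (induction n arbitrary: y)
    case 0
    then show ?case by (simp add: reducible_def weights.span_zero)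
  next
    case (Suc n)
    let ?y' = "Lop V M 0 y - scale M b y"
    have "?y' \<in> gweight V M b \<inter> Wg ?\<beta>"
      using Suc.prems(1) Lop_weight[of y b 0] Lop_degree[of y ?\<beta> 0]
      by (intro weights.subspace_diff[OF subspace_doubly_homogeneous] weights.subspace_scale[OF subspace_doubly_homogeneous]) auto
    then have "?y' \<in> reducible Q b"
      using Suc.prems(2) by (intro Suc.IH) (simp_all only: funpow_Suc_right o_apply)
    with bracket[OF Suc.prems(1)]
    have "scale M (d N) y \<in> reducible Q b"
      unfolding reducible_def using weights.span_add_eq2 weights.span_scale by blast
    then have "scale M (inverse (d N)) (scale M (d N) y) \<in> reducible Q b"
      unfolding reducible_def by (rule weights.span_scale)
    then show ?case using N(3) by simp
  qed
  then have "gweight V M b \<inter> Wg ?\<beta> \<subseteq> reducible Q b" by (auto simp: gweight_def)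
  then show ?thesis using pattern_space_subset by blast
qed

lemma pattern_space_bounded_below:
  "\<exists>K::int. \<forall>k<K. \<forall>Q. Q \<subseteq># Q0 \<longrightarrow> pattern_space Q (b + of_int k) \<subseteq> {0}"
proof -
  have "\<forall>Q. \<exists>K::int. \<forall>k<K. gweight V M (b + of_int k) \<inter> Wg (sum_mset Q) = {0}"
    using module_bounded_below by blast
  then obtain K :: "'a multiset \<Rightarrow> int"
    where K: "\<And>Q k. k < K Q \<Longrightarrow> gweight V M (b + of_int k) \<inter> Wg (sum_mset Q) = {0}" by metis
  have fin: "finite (K ` {Q. Q \<subseteq># Q0})" by (simp add: finite_submultisets)
  show ?thesis
  proof (intro exI[of _ "Min (K ` {Q. Q \<subseteq># Q0})"] allI impI)
    fix k Q assume "k < Min (K ` {Q. Q \<subseteq># Q0})" "Q \<subseteq># Q0"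
    then have "k < K Q" using fin by (subst (asm) Min_gr_iff) auto
    then show "pattern_space Q (b + of_int k) \<subseteq> {0}" using K pattern_space_subset[of Q] by blast
  qed
qed

end

section \<open>Relations between correlators\<close>

lemma vector_space_complex: "vector_space ((*) :: complex \<Rightarrow> complex \<Rightarrow> complex)"
  by unfold_locales (auto simp: algebra_simps)

text \<open>\<open>Wt i\<close> is the module on which the operator with index \<open>i\<close>
  acts, and \<open>Wt (i - 1)\<close> its target. Identifying the ends with outer modules gives all
  operators of the chain the same form.\<close>

locale intertwining_chain =
  fixes V :: "('v::ab_group_add, 'm) vertex_data_scheme"
    and n :: nat
    and W Wt :: "nat \<Rightarrow> ('v, 'w::ab_group_add, 'n) vmod_scheme"
    and Y :: "nat \<Rightarrow> 'w \<Rightarrow> complex \<Rightarrow> nat \<Rightarrow> 'w \<Rightarrow> 'w"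
  assumes outer_modules: "i \<in> {1..n+1} \<Longrightarrow> vertex_action V (W i)"
    and inner_modules: "i \<le> n \<Longrightarrow> vertex_action V (Wt i)"
    and last_module: "Wt n = W (n + 1)"
    and operators: "i \<in> {1..n} \<Longrightarrow> log_intertwining_operator V (W i) (Wt i) (Wt (i - 1)) (Y i)"
begin

abbreviation corr :: "('w \<Rightarrow> complex) \<Rightarrow> (nat \<Rightarrow> 'w) \<Rightarrow> log_series"
  where "corr f w \<equiv> correlator n f Y w"

definition valid :: "(nat \<Rightarrow> 'w) \<Rightarrow> bool"
  where "valid w \<longleftrightarrow> (\<forall>i\<in>{1..n+1}. w i \<in> carrier (W i))"

abbreviation functional :: "('w \<Rightarrow> complex) \<Rightarrow> bool"
  where "functional f \<equiv> linear_on (scale (Wt 0)) (*) (carrier (Wt 0)) f"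

text \<open>The product is cut behind the operator with index \<open>j\<close>: this is the vector
  in \<open>Wt j\<close> produced by the right part, and \<open>outer_fun\<close> is the functional
  on \<open>Wt j\<close> formed by the left part. The index \<open>- e i - 1\<close> selects the
  power with exponent \<open>e i\<close>.\<close>

definition inner_vec :: "nat \<Rightarrow> (nat \<Rightarrow> 'w) \<Rightarrow> (nat \<Rightarrow> complex) \<Rightarrow> (nat \<Rightarrow> nat) \<Rightarrow> 'w"
  where "inner_vec j w e k = foldr (\<lambda>i. Y i (w i) (- e i - 1) (k i)) [j + 1..<n + 1] (w (n + 1))"

definition outer_fun :: "nat \<Rightarrow> ('w \<Rightarrow> complex) \<Rightarrow> (nat \<Rightarrow> 'w) \<Rightarrow> (nat \<Rightarrow> complex) \<Rightarrow> (nat \<Rightarrow> nat) \<Rightarrow> 'w \<Rightarrow> complex"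
  where "outer_fun j f w e k v = f (foldr (\<lambda>i. Y i (w i) (- e i - 1) (k i)) [1..<j + 1] v)"

lemma vs_W: "i \<in> {1..n+1} \<Longrightarrow> vector_space (scale (W i))"
  and vs_Wt: "i \<le> n \<Longrightarrow> vector_space (scale (Wt i))"
  using outer_modules inner_modules vertex_action.vector_space_ambient by blast+

lemma sub_W: "i \<in> {1..n+1} \<Longrightarrow> module.subspace (scale (W i)) (carrier (W i))"
  and sub_Wt: "i \<le> n \<Longrightarrow> module.subspace (scale (Wt i)) (carrier (Wt i))"
  using outer_modules inner_modules vertex_action.subspace_carrier by blast+

lemma validD: "valid w \<Longrightarrow> i \<in> {1..n+1} \<Longrightarrow> w i \<in> carrier (W i)"
  by (simp add: valid_def)

lemma valid_update: "valid w \<Longrightarrow> x \<in> carrier (W i) \<Longrightarrow> valid (w(i := x))"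
  by (simp add: valid_def)

lemma valid_act: "valid w \<Longrightarrow> i \<in> {1..n+1} \<Longrightarrow> valid (w(i := act (W i) u m (w i)))"
  using vertex_action.act_closed[OF outer_modules] validD by (intro valid_update) auto

lemma inner_vec_last: "inner_vec n w e k = w (n + 1)"
  by (simp add: inner_vec_def)

lemma inner_vec_step:
  "j \<in> {1..n} \<Longrightarrow> inner_vec (j - 1) w e k = Y j (w j) (- e j - 1) (k j) (inner_vec j w e k)"
  by (simp add: inner_vec_def upt_conv_Cons del: upt_Suc)

lemma inner_vec_cong:
  assumes "\<And>i. j < i \<Longrightarrow> i \<le> n + 1 \<Longrightarrow> w i = w' i" "\<And>i. j < i \<Longrightarrow> i \<le> n \<Longrightarrow> e i = e' i \<and> k i = k' i" "j \<le> n"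
  shows "inner_vec j w e k = inner_vec j w' e' k'"
  unfolding inner_vec_def using assms by (intro foldr_cong) auto

lemma outer_fun_0: "outer_fun 0 f w e k v = f v"
  by (simp add: outer_fun_def)

lemma outer_fun_step:
  "j \<in> {1..n} \<Longrightarrow> outer_fun j f w e k v = outer_fun (j - 1) f w e k (Y j (w j) (- e j - 1) (k j) v)"
  by (cases j) (simp_all add: outer_fun_def)

lemma outer_fun_cong:
  assumes "\<And>i. i \<in> {1..j} \<Longrightarrow> w i = w' i \<and> e i = e' i \<and> k i = k' i"
  shows "outer_fun j f w e k v = outer_fun j f w' e' k' v"
proof -
  have "foldr (\<lambda>i. Y i (w i) (- e i - 1) (k i)) [1..<j + 1] v = foldr (\<lambda>i. Y i (w' i) (- e' i - 1) (k' i)) [1..<j + 1] v"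
    using assms by (intro foldr_cong) auto
  then show ?thesis by (simp add: outer_fun_def)
qed

lemma corr_split: "j \<le> n \<Longrightarrow> corr f w e k = outer_fun j f w e k (inner_vec j w e k)"
proof -
  assume "j \<le> n"
  then have "[1..<n + 1] = [1..<j + 1] @ [j + 1..<n + 1]"
    using upt_add_eq_append[of 1 "j + 1" "n - j"] by simp
  then show ?thesis by (simp add: correlator_def outer_fun_def inner_vec_def)
qed

lemma inner_vec_closed:
  assumes "valid w" "j \<le> n"
  shows "inner_vec j w e k \<in> carrier (Wt j)"
  using assms(2)
proof (induction j rule: inc_induct)
  case base
  then show ?case using assms(1) by (simp add: inner_vec_last last_module valid_def)
next
  case (step m)
  have m: "Suc m \<in> {1..n}" using step by auto
  have "w (Suc m) \<in> carrier (W (Suc m))" using validD[OF assms(1), of "Suc m"] m by auto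
  then show ?case
    using log_intertwining_operator.closed[OF operators[OF m] _ step.IH] inner_vec_step[OF m] by simp
qed

lemma outer_fun_linear:
  assumes f: "functional f" and w: "valid w" and "j \<le> n"
  shows "linear_on (scale (Wt j)) (*) (carrier (Wt j)) (outer_fun j f w e k)"
  using assms(3)
proof (induction j)
  case 0
  then show ?case using f by (simp add: outer_fun_def)
next
  case (Suc j)
  then have j: "Suc j \<in> {1..n}" by auto
  have wj: "w (Suc j) \<in> carrier (W (Suc j))" using validD[OF w, of "Suc j"] j by auto
  note lin = log_intertwining_operator.linear_right[OF operators[OF j] wj]
  note cl = log_intertwining_operator.closed[OF operators[OF j] wj]
  show ?case
    using Suc lin cl unfolding linear_on_def outer_fun_step[OF j] by simp
qed

lemma outer_fun_zero: "functional f \<Longrightarrow> valid w \<Longrightarrow> j \<le> n \<Longrightarrow> outer_fun j f w e k 0 = 0"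
  using linear_on_0[OF vs_Wt vector_space_complex outer_fun_linear inner_vec_closed] by blast

section \<open>Linearity, truncation and derivatives of correlators\<close>

lemma corr_linear_slot:
  assumes f: "functional f" and w: "valid w" and l: "l \<in> {1..n+1}"
  shows "linear_on (scale (W l)) (*) (carrier (W l)) (\<lambda>x. corr f (w(l := x)) e k)"
proof (cases "l = n + 1")
  case True
  have "corr f (w(l := x)) e k = outer_fun n f w e k x" for x
    using outer_fun_cong[of n "w(l := x)" w e e k k f] True
    by (simp add: corr_split[of n] inner_vec_last)
  then show ?thesis using outer_fun_linear[OF f w, of n e k] True by (simp add: last_module)
next
  case False
  then have l: "l \<in> {1..n}" using l by auto
  have eq: "corr f (w(l := x)) e k = outer_fun (l - 1) f w e k (Y l x (- e l - 1) (k l) (inner_vec l w e k))" for x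
  proof -
    have "corr f (w(l := x)) e k = outer_fun (l - 1) f (w(l := x)) e k (Y l x (- e l - 1) (k l) (inner_vec l (w(l := x)) e k))"
      using corr_split[of "l - 1" f "w(l := x)" e k] inner_vec_step[OF l, of "w(l := x)" e k] l by auto
    also have "inner_vec l (w(l := x)) e k = inner_vec l w e k" using l by (intro inner_vec_cong) auto
    also have "outer_fun (l - 1) f (w(l := x)) e k = outer_fun (l - 1) f w e k"
      using l by (intro ext outer_fun_cong) auto
    finally show ?thesis .
  qed
  have "l \<le> n" "l - 1 \<le> n" using l by auto
  note lin = outer_fun_linear[OF f w \<open>l - 1 \<le> n\<close>, of e k]
  note v = inner_vec_closed[OF w \<open>l \<le> n\<close>, of e k]
  note left = log_intertwining_operator.linear_left[OF operators[OF l] v]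
  note cl = log_intertwining_operator.closed[OF operators[OF l] _ v]
  show ?thesis
    unfolding eq using lin left cl unfolding linear_on_def by simp
qed

text \<open>Fixing the exponents behind slot \<open>j\<close> fixes the vector to which the operator
  in slot \<open>j\<close> is applied. Lower truncation on this vector does not involve the
  exponents in front, hence the uniformity.\<close>

lemma corr_truncated:
  assumes f: "functional f" and w: "valid w"
  shows "corr f w \<in> truncated n"
proof (rule truncatedI)
  fix k e j assume j: "j \<in> {1..n}"
  have wj: "w j \<in> carrier (W j)" and jn: "j \<le> n" "j - 1 \<le> n" using validD[OF w, of j] j by auto
  let ?x = "inner_vec j w e k"
  obtain N :: nat where N: "\<And>t k. t \<ge> N \<Longrightarrow> Y j (w j) (- e j - 1 + of_nat t) k ?x = 0"
    using log_intertwining_operator.lower_truncation[OF operators[OF j] wj inner_vec_closed[OF w jn(1)]] by blast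
  show "\<exists>B. \<forall>t\<ge>B. \<forall>e'. (\<forall>i>j. e' i = e i) \<longrightarrow> e' j = e j - of_nat t \<longrightarrow> corr f w e' k = 0"
  proof (intro exI[of _ N] allI impI)
    fix t e' assume t: "t \<ge> N" and e': "\<forall>i>j. e' i = e i" "e' j = e j - of_nat t"
    have "corr f w e' k = outer_fun (j - 1) f w e' k (Y j (w j) (- e' j - 1) (k j) (inner_vec j w e' k))"
      using corr_split[OF jn(2)] inner_vec_step[OF j] by simp
    also have "inner_vec j w e' k = ?x" using e' jn by (intro inner_vec_cong) auto
    also have "- e' j - 1 = - e j - 1 + of_nat t" using e' by simp
    finally show "corr f w e' k = 0" using N[OF t] outer_fun_zero[OF f w jn(2)] by simp
  qed
qed

lemma dz_corr:
  assumes f: "functional f" and w: "valid w" and l: "l \<in> {1..n}"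
  shows "dz l (corr f w) = corr f (w(l := Lop V (W l) (-1) (w l)))"
proof (intro ext)
  fix e k
  have wl: "w l \<in> carrier (W l)" and ln: "l \<le> n" "l - 1 \<le> n" using validD[OF w, of l] l by auto
  let ?x = "inner_vec l w e k"
  let ?F = "outer_fun (l - 1) f w e k"
  note v = inner_vec_closed[OF w ln(1), of e k]
  have eq: "corr f (w(l := y)) (e(l := a)) (k(l := b)) = ?F (Y l y (- a - 1) b ?x)" for y a b
  proof -
    let ?w = "w(l := y)" and ?e = "e(l := a)" and ?k = "k(l := b)"
    have "corr f ?w ?e ?k = outer_fun (l - 1) f ?w ?e ?k (Y l y (- a - 1) b (inner_vec l ?w ?e ?k))"
      using corr_split[OF ln(2), of f ?w ?e ?k] inner_vec_step[OF l, of ?w ?e ?k] by simp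
    also have "inner_vec l ?w ?e ?k = ?x" using l by (intro inner_vec_cong) auto
    also have "outer_fun (l - 1) f ?w ?e ?k = ?F" using l by (intro ext outer_fun_cong) auto
    finally show ?thesis .
  qed
  have cl: "Y l (w l) m c ?x \<in> carrier (Wt (l - 1))" for m c
    by (rule log_intertwining_operator.closed[OF operators[OF l] wl v])
  have sc: "scale (Wt (l - 1)) c y \<in> carrier (Wt (l - 1))" if "y \<in> carrier (Wt (l - 1))" for c y
  proof -
    interpret amb: vector_space "scale (Wt (l - 1))" by (rule vs_Wt[OF ln(2)])
    show ?thesis using amb.subspace_scale[OF sub_Wt[OF ln(2)] that] .
  qed
  have lin: "?F (x + y) = ?F x + ?F y" "?F (scale (Wt (l - 1)) c x) = c * ?F x"
    if "x \<in> carrier (Wt (l - 1))" "y \<in> carrier (Wt (l - 1))" for x y c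
    using outer_fun_linear[OF f w ln(2), of e k] that unfolding linear_on_def by auto
  have "corr f (w(l := Lop V (W l) (-1) (w l))) e k = ?F (Y l (Lop V (W l) (-1) (w l)) (- e l - 1) (k l) ?x)"
    using eq[of "Lop V (W l) (-1) (w l)" "e l" "k l"] by simp
  also have "Y l (Lop V (W l) (-1) (w l)) (- e l - 1) (k l) ?x =
      scale (Wt (l - 1)) (e l + 1) (Y l (w l) (- (e l + 1) - 1) (k l) ?x)
      + scale (Wt (l - 1)) (of_nat (k l + 1)) (Y l (w l) (- (e l + 1) - 1) (k l + 1) ?x)"
    using log_intertwining_operator.L_minus1_derivative[OF operators[OF l] wl v, of "- e l - 1" "k l"]
    by (simp add: algebra_simps)
  also have "?F \<dots> = (e l + 1) * ?F (Y l (w l) (- (e l + 1) - 1) (k l) ?x)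
      + of_nat (k l + 1) * ?F (Y l (w l) (- (e l + 1) - 1) (k l + 1) ?x)"
    by (simp only: lin[OF sc[OF cl] sc[OF cl]] lin(2)[OF cl cl])
  also have "\<dots> = dz l (corr f w) e k"
    using eq[of "w l" "e l + 1" "k l"] eq[of "w l" "e l + 1" "k l + 1"] by (simp add: dz_def)
  finally show "dz l (corr f w) e k = corr f (w(l := Lop V (W l) (-1) (w l))) e k" ..
qed

text \<open>\<open>ins f u m j w\<close> is the correlator with the mode \<open>u\<^sub>m\<close> inserted between the \<open>j\<close>-th and the \<open>(j+1)\<close>-st operator.\<close>

definition ins :: "('w \<Rightarrow> complex) \<Rightarrow> 'v \<Rightarrow> int \<Rightarrow> nat \<Rightarrow> (nat \<Rightarrow> 'w) \<Rightarrow> log_series"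
  where "ins f u m j w e k = outer_fun j f w e k (act (Wt j) u m (inner_vec j w e k))"

lemma ins_0: "ins f u m 0 w = corr (\<lambda>x. f (act (Wt 0) u m x)) w"
  using corr_split[of 0] by (simp add: ins_def fun_eq_iff outer_fun_0)

lemma ins_n: "ins f u m n w = corr f (w(n + 1 := act (W (n + 1)) u m (w (n + 1))))"
proof (intro ext)
  fix e k
  have "outer_fun n f w e k v = outer_fun n f (w(n + 1 := act (W (n + 1)) u m (w (n + 1)))) e k v" for v
    by (rule outer_fun_cong) auto
  then show "ins f u m n w e k = corr f (w(n + 1 := act (W (n + 1)) u m (w (n + 1)))) e k"
    using corr_split[of n f] by (simp add: ins_def inner_vec_last last_module)
qed

text \<open>Moving the mode across one operator costs the commutator terms, in which nonnegative
  modes of \<open>u\<close> act on \<open>w p\<close>; these are finitely many by lower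
  truncation.\<close>

lemma ins_commutator:
  assumes f: "functional f" and w: "valid w" and p: "p \<in> {1..n}"
    and I: "\<And>i. i \<ge> I \<Longrightarrow> act (W p) u (int i) (w p) = 0"
  shows "ins f u m (p - 1) w e k = ins f u m p w e k +
    (\<Sum>i<I. (of_int m gchoose i) *
      mulz (Poly_Mapping.single p (m - int i)) (corr f (w(p := act (W p) u (int i) (w p)))) e k)"
proof -
  have wp: "w p \<in> carrier (W p)" and pn: "p \<le> n" "p - 1 \<le> n" and p1: "p \<in> {1..n+1}"
    using validD[OF w, of p] p by auto
  let ?x = "inner_vec p w e k" and ?h = "- e p - 1"
  let ?F = "outer_fun (p - 1) f w e k"
  note v = inner_vec_closed[OF w pn(1), of e k]
  interpret amb: vector_space "scale (Wt (p - 1))" by (rule vs_Wt[OF pn(2)])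
  let ?y = "act (Wt (p - 1)) u m (Y p (w p) ?h (k p) ?x)" and ?z = "Y p (w p) ?h (k p) (act (Wt p) u m ?x)"
  define g where "g i = scale (Wt (p - 1)) (of_int m gchoose i) (Y p (act (W p) u (int i) (w p)) (of_int m + ?h - of_nat i) (k p) ?x)" for i
  note left = log_intertwining_operator.linear_left[OF operators[OF p] v]
  have Y0: "Y p 0 c b ?x = 0" for c b
    using linear_on_0[OF vs_W[OF p1] vs_Wt[OF pn(2)] left wp] .
  have "?y - ?z = Sum_any g"
    using jacobi_coeff_commutator[OF vs_Wt[OF pn(2)] log_intertwining_operator.jacobi[OF operators[OF p] wp v, of 0 m u ?h "k p"]]
    unfolding g_def by simp
  also have "\<dots> = (\<Sum>i<I. g i)"
    by (rule Sum_any_eq_lessThan) (simp add: g_def I Y0 del: One_nat_def)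
  finally have "?y = ?z + (\<Sum>i<I. g i)" by (simp add: algebra_simps)
  moreover have z: "?z \<in> carrier (Wt (p - 1))"
    by (rule log_intertwining_operator.closed[OF operators[OF p] wp vertex_action.act_closed[OF inner_modules[OF pn(1)] v]])
  moreover have Yc: "Y p (act (W p) u (int i) (w p)) c b ?x \<in> carrier (Wt (p - 1))" for i c b
    by (rule log_intertwining_operator.closed[OF operators[OF p] vertex_action.act_closed[OF outer_modules[OF p1] wp] v])
  moreover have g: "g i \<in> carrier (Wt (p - 1))" for i
    unfolding g_def by (rule amb.subspace_scale[OF sub_Wt[OF pn(2)] Yc])
  moreover note lin = outer_fun_linear[OF f w pn(2), of e k]
  ultimately have "?F ?y = ?F ?z + ?F (\<Sum>i<I. g i)"
    using amb.subspace_sum[OF sub_Wt[OF pn(2)], of "{..<I}" g] unfolding linear_on_def by simp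
  also have "?F (\<Sum>i<I. g i) = (\<Sum>i<I. ?F (g i))"
    by (rule linear_on_sum[OF vs_Wt[OF pn(2)] vector_space_complex sub_Wt[OF pn(2)] lin g])
  also have "\<dots> = (\<Sum>i<I. (of_int m gchoose i) *
      mulz (Poly_Mapping.single p (m - int i)) (corr f (w(p := act (W p) u (int i) (w p)))) e k)"
  proof (rule sum.cong)
    fix i
    let ?w = "w(p := act (W p) u (int i) (w p))" and ?e = "e(p := e p - of_int (m - int i))"
    have e: "(\<lambda>j. e j - of_int (Poly_Mapping.lookup (Poly_Mapping.single p (m - int i)) j)) = ?e"
      by (auto simp: lookup_single when_def fun_eq_iff)
    have "corr f ?w ?e k = outer_fun (p - 1) f ?w ?e k (Y p (?w p) (- ?e p - 1) (k p) (inner_vec p ?w ?e k))"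
      using corr_split[OF pn(2), of f ?w ?e k] inner_vec_step[OF p, of ?w ?e k] by simp
    also have "inner_vec p ?w ?e k = ?x" using p by (intro inner_vec_cong) auto
    also have "outer_fun (p - 1) f ?w ?e k = ?F" using p by (intro ext outer_fun_cong) auto
    also have "- ?e p - 1 = of_int m + ?h - of_nat i" by simp
    also have "?w p = act (W p) u (int i) (w p)" by simp
    finally have *: "corr f ?w ?e k = ?F (Y p (act (W p) u (int i) (w p)) (of_int m + ?h - of_nat i) (k p) ?x)" .
    have "?F (g i) = (of_int m gchoose i) * ?F (Y p (act (W p) u (int i) (w p)) (of_int m + ?h - of_nat i) (k p) ?x)"
      unfolding g_def using lin Yc unfolding linear_on_def by blast
    then show "?F (g i) = (of_int m gchoose i) * mulz (Poly_Mapping.single p (m - int i)) (corr f ?w) e k"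
      unfolding mulz_def e * .
  qed simp
  finally show ?thesis
    using outer_fun_step[OF p] inner_vec_step[OF p] by (simp add: ins_def)
qed

text \<open>The operator of \<open>u_{-1} w_l\<close> is a normally ordered product: modes with
  negative index stand to the left and the others to the right. For a fixed coefficient both sums
  are finite; any sufficiently large \<open>B\<close> is allowed so that it can be chosen together
  with the bounds of later expansions.\<close>

lemma corr_iterate:
  assumes f: "functional f" and w: "valid w" and l: "l \<in> {1..n}"
  shows "\<exists>B0. \<forall>B\<ge>B0. corr f (w(l := act (W l) u (-1) (w l))) e k =
    (\<Sum>t<B. mulz (Poly_Mapping.single l (int t)) (ins f u (- 1 - int t) (l - 1) w) e k) +
    (\<Sum>t<B. mulz (Poly_Mapping.single l (- 1 - int t)) (ins f u (int t) l w) e k)"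
proof -
  have wl: "w l \<in> carrier (W l)" and ln: "l \<le> n" "l - 1 \<le> n" and l1: "l \<in> {1..n+1}"
    using validD[OF w, of l] l by auto
  let ?x = "inner_vec l w e k" and ?h = "- e l - 1"
  let ?F = "outer_fun (l - 1) f w e k"
  note v = inner_vec_closed[OF w ln(1), of e k]
  interpret amb: vector_space "scale (Wt (l - 1))" by (rule vs_Wt[OF ln(2)])
  note lin = outer_fun_linear[OF f w ln(2), of e k]
  define p where "p t = act (Wt (l - 1)) u (- 1 - int t) (Y l (w l) (?h + of_nat t) (k l) ?x)" for t
  define q where "q t = Y l (w l) (?h - 1 - of_nat t) (k l) (act (Wt l) u (int t) ?x)" for t
  have eq: "Sum_any p + Sum_any q = Y l (act (W l) u (-1) (w l)) ?h (k l) ?x"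
    using jacobi_coeff_iterate[OF vs_Wt[OF ln(2)] log_intertwining_operator.jacobi[OF operators[OF l] wl v, of "-1" 0 u ?h "k l"]]
    unfolding p_def q_def by simp
  obtain N1 :: nat where N1: "\<And>t. t \<ge> N1 \<Longrightarrow> Y l (w l) (?h + of_nat t) (k l) ?x = 0"
    using log_intertwining_operator.lower_truncation[OF operators[OF l] wl v] by blast
  obtain N2 where N2: "\<And>m. m \<ge> N2 \<Longrightarrow> act (Wt l) u m ?x = 0"
    using vertex_action.lower_truncation[OF inner_modules[OF ln(1)] v] by blast
  have p0: "p t = 0" if "t \<ge> N1" for t
    using N1[OF that] vertex_action.act_zero[OF inner_modules[OF ln(2)]] by (simp add: p_def)
  have Yz: "Y l (w l) c b 0 = 0" for c b
    using linear_on_0[OF vs_Wt[OF ln(1)] vs_Wt[OF ln(2)] log_intertwining_operator.linear_right[OF operators[OF l] wl] v] .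
  have q0: "q t = 0" if "t \<ge> nat N2" for t
    using N2[of "int t"] that Yz by (simp add: q_def)
  have Yc: "Y l (w l) c b x \<in> carrier (Wt (l - 1))" if "x \<in> carrier (Wt l)" for c b x
    by (rule log_intertwining_operator.closed[OF operators[OF l] wl that])
  have pc: "p t \<in> carrier (Wt (l - 1))" for t
    unfolding p_def by (rule vertex_action.act_closed[OF inner_modules[OF ln(2)] Yc[OF v]])
  have qc: "q t \<in> carrier (Wt (l - 1))" for t
    unfolding q_def by (rule Yc[OF vertex_action.act_closed[OF inner_modules[OF ln(1)] v]])
  have shift: "(\<lambda>j. e j - of_int (Poly_Mapping.lookup (Poly_Mapping.single l a) j)) = e(l := e l - of_int a)" for a
    by (auto simp: lookup_single when_def fun_eq_iff)
  have inner: "inner_vec l w (e(l := a)) k = ?x" for a using l by (intro inner_vec_cong) auto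
  have outer: "outer_fun (l - 1) f w (e(l := a)) k = ?F" for a using l by (intro ext outer_fun_cong) auto
  have Fp: "mulz (Poly_Mapping.single l (int t)) (ins f u (- 1 - int t) (l - 1) w) e k = ?F (p t)" for t
    unfolding mulz_def shift ins_def inner_vec_step[OF l] inner outer p_def by (simp add: algebra_simps)
  have Fq: "mulz (Poly_Mapping.single l (- 1 - int t)) (ins f u (int t) l w) e k = ?F (q t)" for t
  proof -
    have ex: "- (e l - of_int (- 1 - int t)) - 1 = ?h - 1 - of_nat t" by simp
    show ?thesis unfolding mulz_def shift ins_def outer_fun_step[OF l] inner outer q_def fun_upd_same ex ..
  qed
  show ?thesis
  proof (intro exI[of _ "max N1 (nat N2)"] allI impI)
    fix B assume B: "B \<ge> max N1 (nat N2)"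
    have "Sum_any p = (\<Sum>t<B. p t)" "Sum_any q = (\<Sum>t<B. q t)"
      using B by (auto intro!: Sum_any_eq_lessThan p0 q0)
    moreover have "corr f (w(l := act (W l) u (-1) (w l))) e k = ?F (Y l (act (W l) u (-1) (w l)) ?h (k l) ?x)"
    proof -
      let ?w = "w(l := act (W l) u (-1) (w l))"
      have "corr f ?w e k = outer_fun (l - 1) f ?w e k (Y l (?w l) ?h (k l) (inner_vec l ?w e k))"
        using corr_split[OF ln(2), of f ?w e k] inner_vec_step[OF l, of ?w e k] by simp
      also have "inner_vec l ?w e k = ?x" using l by (intro inner_vec_cong) auto
      also have "outer_fun (l - 1) f ?w e k = ?F" using l by (intro ext outer_fun_cong) auto
      also have "?w l = act (W l) u (-1) (w l)" by simp
      finally show ?thesis .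
    qed
    moreover have "(\<Sum>t<B. p t) \<in> carrier (Wt (l - 1))" "(\<Sum>t<B. q t) \<in> carrier (Wt (l - 1))"
      by (intro amb.subspace_sum[OF sub_Wt[OF ln(2)]] pc qc)+
    ultimately have "corr f (w(l := act (W l) u (-1) (w l))) e k = ?F (\<Sum>t<B. p t) + ?F (\<Sum>t<B. q t)"
      using lin eq unfolding linear_on_def by metis
    also have "?F (\<Sum>t<B. p t) = (\<Sum>t<B. ?F (p t))"
      by (rule linear_on_sum[OF vs_Wt[OF ln(2)] vector_space_complex sub_Wt[OF ln(2)] lin pc])
    also have "?F (\<Sum>t<B. q t) = (\<Sum>t<B. ?F (q t))"
      by (rule linear_on_sum[OF vs_Wt[OF ln(2)] vector_space_complex sub_Wt[OF ln(2)] lin qc])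
    finally show "corr f (w(l := act (W l) u (-1) (w l))) e k =
        (\<Sum>t<B. mulz (Poly_Mapping.single l (int t)) (ins f u (- 1 - int t) (l - 1) w) e k) +
        (\<Sum>t<B. mulz (Poly_Mapping.single l (- 1 - int t)) (ins f u (int t) l w) e k)"
      by (simp only: Fp Fq)
  qed
qed

lemma ins_left:
  assumes f: "functional f" and w: "valid w" and "j \<le> n"
    and I: "\<And>p i. p \<in> {1..n} \<Longrightarrow> i \<ge> I \<Longrightarrow> act (W p) u (int i) (w p) = 0"
  shows "ins f u m j w e k = corr (\<lambda>x. f (act (Wt 0) u m x)) w e k -
    (\<Sum>p\<in>{1..j}. \<Sum>i<I. (of_int m gchoose i) *
      mulz (Poly_Mapping.single p (m - int i)) (corr f (w(p := act (W p) u (int i) (w p)))) e k)"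
proof -
  define \<phi> where "\<phi> p i = corr f (w(p := act (W p) u (int i) (w p)))" for p i
  have "ins f u m j w e k = corr (\<lambda>x. f (act (Wt 0) u m x)) w e k -
    (\<Sum>p\<in>{1..j}. \<Sum>i<I. (of_int m gchoose i) * mulz (Poly_Mapping.single p (m - int i)) (\<phi> p i) e k)"
    using assms(3)
  proof (induction j)
    case 0
    then show ?case by (simp add: ins_0)
  next
    case (Suc j)
    then have p: "Suc j \<in> {1..n}" by auto
    have "ins f u m (Suc j - 1) w e k = ins f u m (Suc j) w e k +
        (\<Sum>i<I. (of_int m gchoose i) * mulz (Poly_Mapping.single (Suc j) (m - int i)) (\<phi> (Suc j) i) e k)"
      unfolding \<phi>_def by (rule ins_commutator[OF f w p]) (rule I[OF p])
    then show ?case using Suc by (simp add: algebra_simps)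
  qed
  then show ?thesis unfolding \<phi>_def .
qed

lemma ins_right:
  assumes f: "functional f" and w: "valid w" and "j \<le> n"
    and I: "\<And>p i. p \<in> {1..n} \<Longrightarrow> i \<ge> I \<Longrightarrow> act (W p) u (int i) (w p) = 0"
  shows "ins f u m j w e k = corr f (w(n + 1 := act (W (n + 1)) u m (w (n + 1)))) e k +
    (\<Sum>p\<in>{j+1..n}. \<Sum>i<I. (of_int m gchoose i) *
      mulz (Poly_Mapping.single p (m - int i)) (corr f (w(p := act (W p) u (int i) (w p)))) e k)"
proof -
  define \<phi> where "\<phi> p i = corr f (w(p := act (W p) u (int i) (w p)))" for p i
  have "ins f u m j w e k = corr f (w(n + 1 := act (W (n + 1)) u m (w (n + 1)))) e k +
    (\<Sum>p\<in>{j+1..n}. \<Sum>i<I. (of_int m gchoose i) * mulz (Poly_Mapping.single p (m - int i)) (\<phi> p i) e k)"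
    using assms(3)
  proof (induction j rule: inc_induct)
    case base
    have "{n + 1..n} = {}" by simp
    then show ?case by (simp only: ins_n sum.empty add_0_right)
  next
    case (step j)
    then have p: "Suc j \<in> {1..n}" by auto
    have "ins f u m (Suc j - 1) w e k = ins f u m (Suc j) w e k +
        (\<Sum>i<I. (of_int m gchoose i) * mulz (Poly_Mapping.single (Suc j) (m - int i)) (\<phi> (Suc j) i) e k)"
      unfolding \<phi>_def by (rule ins_commutator[OF f w p]) (rule I[OF p])
    moreover have "{j + 1..n} = insert (Suc j) {Suc j + 1..n}" using p by auto
    ultimately show ?case using step by (simp add: algebra_simps)
  qed
  then show ?thesis unfolding \<phi>_def .
qed

end

section \<open>Assembling the commutator terms into expansions, and the reduction of one
  slot\<close>

lemma sum_series_apply: "(\<Sum>x\<in>X. f x) e k = (\<Sum>x\<in>X. f x e k)" for f :: "'z \<Rightarrow> log_series"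
  by (induction X rule: infinite_finite_induct) auto

text \<open>Up to sign, the coefficient with which \<open>u_i\<close> arises from commuting the mode
  of index -1 - t is the coefficient of index \<open>t\<close> in the expansion of a negative power
  with exponent -(i + 1).\<close>

lemma gchoose_minus: "((of_int (- 1 - int t) :: complex) gchoose i) = (-1) ^ i * of_nat ((Suc i + t - 1) choose t)"
proof -
  have "((of_int (- 1 - int t) :: complex) gchoose i) = (- (of_nat (Suc t))) gchoose i" by simp
  also have "\<dots> = (-1) ^ i * ((of_nat (Suc t) + of_nat i - 1) gchoose i)" by (rule gbinomial_minus)
  also have "of_nat (Suc t) + of_nat i - 1 = (of_nat (t + i) :: complex)" by simp
  also have "(of_nat (t + i) gchoose i) = (of_nat ((t + i) choose i) :: complex)"
    by (rule binomial_gbinomial[symmetric])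
  also have "(t + i) choose i = (Suc i + t - 1) choose t"
    using binomial_symmetric[of i "t + i"] by (simp add: add.commute)
  finally show ?thesis .
qed

lemma sum_lessThan_shift:
  fixes f :: "nat \<Rightarrow> complex"
  assumes "\<And>t. t < i \<Longrightarrow> f t = 0" "i \<le> B"
  shows "(\<Sum>t<B. f t) = (\<Sum>s<B - i. f (s + i))"
proof -
  have "(\<Sum>t<B. f t) = (\<Sum>t\<in>{0 + i..<(B - i) + i}. f t)"
    using assms by (intro sum.mono_neutral_right) auto
  also have "\<dots> = (\<Sum>s\<in>{0..<B - i}. f (s + i))" by (rule sum.shift_bounds_nat_ivl)
  finally show ?thesis by (simp add: atLeast0LessThan)
qed

context intertwining_chain
begin

text \<open>Summed over \<open>t\<close>, the monomials z_l^t z_p^(-1-t-i) form the expansion of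
  (z_p - z_l)^(-1-i). Since the mode moves to the left, p < l, and this is the expansion belonging
  to the region.\<close>

lemma ins_left_sum:
  assumes f: "functional f" and w: "valid w" and l: "l \<in> {1..n}"
    and I: "\<And>p i. p \<in> {1..n} \<Longrightarrow> i \<ge> I \<Longrightarrow> act (W p) u (int i) (w p) = 0"
    and B: "\<And>p i t. p \<in> {1..l-1} \<Longrightarrow> i < I \<Longrightarrow> t \<ge> B \<Longrightarrow>
      mulz (pexp (p, l) (Suc i) t) (corr f (w(p := act (W p) u (int i) (w p)))) e k = 0"
  shows "(\<Sum>t<B. mulz (Poly_Mapping.single l (int t)) (ins f u (- 1 - int t) (l - 1) w) e k) =
    (\<Sum>t<B. mulz (Poly_Mapping.single l (int t)) (corr (\<lambda>x. f (act (Wt 0) u (- 1 - int t) x)) w) e k) -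
    (\<Sum>p\<in>{1..l-1}. \<Sum>i<I. (-1) ^ i * Dop (p, l) (Suc i) (corr f (w(p := act (W p) u (int i) (w p)))) e k)"
proof -
  define \<phi> where "\<phi> p i = corr f (w(p := act (W p) u (int i) (w p)))" for p i
  define c where "c i t = complex_of_nat ((Suc i + t - 1) choose t)" for i t
  have ln: "l - 1 \<le> n" using l by auto
  have "mulz (Poly_Mapping.single l (int t)) (ins f u (- 1 - int t) (l - 1) w) e k =
    mulz (Poly_Mapping.single l (int t)) (corr (\<lambda>x. f (act (Wt 0) u (- 1 - int t) x)) w) e k -
    (\<Sum>p\<in>{1..l-1}. \<Sum>i<I. (-1) ^ i * (c i t * mulz (pexp (p, l) (Suc i) t) (\<phi> p i) e k))" for t
  proof -
    let ?e = "\<lambda>j. e j - of_int (Poly_Mapping.lookup (Poly_Mapping.single l (int t)) j)"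
    have sw: "mulz (Poly_Mapping.single p (- 1 - int t - int i)) (\<phi> p i) ?e k = mulz (pexp (p, l) (Suc i) t) (\<phi> p i) e k" for p i
    proof -
      have 1: "mulz (Poly_Mapping.single p (- 1 - int t - int i)) (\<phi> p i) ?e k =
          mulz (Poly_Mapping.single l (int t)) (mulz (Poly_Mapping.single p (- 1 - int t - int i)) (\<phi> p i)) e k"
        by (simp add: mulz_def)
      have 2: "- 1 - int t - int i = - int (Suc i) - int t" by simp
      show ?thesis unfolding 1 by (simp only: 2 mulz_mulz pexp_def fst_conv snd_conv add.commute)
    qed
    have "mulz (Poly_Mapping.single l (int t)) (ins f u (- 1 - int t) (l - 1) w) e k = ins f u (- 1 - int t) (l - 1) w ?e k"
      by (simp only: mulz_def)
    also have "\<dots> = corr (\<lambda>x. f (act (Wt 0) u (- 1 - int t) x)) w ?e k -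
        (\<Sum>p\<in>{1..l-1}. \<Sum>i<I. (of_int (- 1 - int t) gchoose i) *
          mulz (Poly_Mapping.single p (- 1 - int t - int i)) (\<phi> p i) ?e k)"
      unfolding \<phi>_def by (rule ins_left[OF f w ln I])
    also have "corr (\<lambda>x. f (act (Wt 0) u (- 1 - int t) x)) w ?e k =
        mulz (Poly_Mapping.single l (int t)) (corr (\<lambda>x. f (act (Wt 0) u (- 1 - int t) x)) w) e k"
      by (simp only: mulz_def)
    finally show ?thesis unfolding sw gchoose_minus c_def by (simp only: mult.assoc)
  qed
  then have "(\<Sum>t<B. mulz (Poly_Mapping.single l (int t)) (ins f u (- 1 - int t) (l - 1) w) e k) =
    (\<Sum>t<B. mulz (Poly_Mapping.single l (int t)) (corr (\<lambda>x. f (act (Wt 0) u (- 1 - int t) x)) w) e k) -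
    (\<Sum>t<B. \<Sum>p\<in>{1..l-1}. \<Sum>i<I. (-1) ^ i * (c i t * mulz (pexp (p, l) (Suc i) t) (\<phi> p i) e k))"
    by (simp only: sum_subtractf)
  also have "(\<Sum>t<B. \<Sum>p\<in>{1..l-1}. \<Sum>i<I. (-1) ^ i * (c i t * mulz (pexp (p, l) (Suc i) t) (\<phi> p i) e k)) =
      (\<Sum>p\<in>{1..l-1}. \<Sum>i<I. (-1) ^ i * (\<Sum>t<B. c i t * mulz (pexp (p, l) (Suc i) t) (\<phi> p i) e k))"
    unfolding sum_distrib_left by (subst sum.swap, rule sum.cong[OF refl], rule sum.swap)
  also have "\<dots> = (\<Sum>p\<in>{1..l-1}. \<Sum>i<I. (-1) ^ i * Dop (p, l) (Suc i) (\<phi> p i) e k)"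
  proof (intro sum.cong refl)
    fix p i assume "p \<in> {1..l-1}" "i \<in> {..<I}"
    then have "Dop (p, l) (Suc i) (\<phi> p i) e k = (\<Sum>t<B. c i t * mulz (pexp (p, l) (Suc i) t) (\<phi> p i) e k)"
      unfolding c_def by (intro Dop_eq_sum) (auto simp: \<phi>_def intro: B)
    then show "(-1) ^ i * (\<Sum>t<B. c i t * mulz (pexp (p, l) (Suc i) t) (\<phi> p i) e k) = (-1) ^ i * Dop (p, l) (Suc i) (\<phi> p i) e k"
      by (simp only:)
  qed
  finally show ?thesis unfolding \<phi>_def .
qed

text \<open>The coefficient \<open>t choose i\<close> vanishes for \<open>t < i\<close>.
  Substituting \<open>t = s + i\<close> turns the sum into the expansion of (z_l - z_p)^(-1-i),
  again in the right region because p > l.\<close>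

lemma ins_right_sum:
  assumes f: "functional f" and w: "valid w" and l: "l \<in> {1..n}"
    and I: "\<And>p i. p \<in> {1..n} \<Longrightarrow> i \<ge> I \<Longrightarrow> act (W p) u (int i) (w p) = 0"
    and B: "\<And>p i t. p \<in> {l+1..n} \<Longrightarrow> i < I \<Longrightarrow> t + i \<ge> B \<Longrightarrow>
      mulz (pexp (l, p) (Suc i) t) (corr f (w(p := act (W p) u (int i) (w p)))) e k = 0" "I \<le> B"
  shows "(\<Sum>t<B. mulz (Poly_Mapping.single l (- 1 - int t)) (ins f u (int t) l w) e k) =
    (\<Sum>t<B. mulz (Poly_Mapping.single l (- 1 - int t)) (corr f (w(n + 1 := act (W (n + 1)) u (int t) (w (n + 1))))) e k) +
    (\<Sum>p\<in>{l+1..n}. \<Sum>i<I. Dop (l, p) (Suc i) (corr f (w(p := act (W p) u (int i) (w p)))) e k)"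
proof -
  define \<phi> where "\<phi> p i = corr f (w(p := act (W p) u (int i) (w p)))" for p i
  define g where "g p i t = (of_int (int t) gchoose i) *
    mulz (Poly_Mapping.single l (- 1 - int t) + Poly_Mapping.single p (int t - int i)) (\<phi> p i) e k" for p i t
  have ln: "l \<le> n" using l by auto
  have "mulz (Poly_Mapping.single l (- 1 - int t)) (ins f u (int t) l w) e k =
    mulz (Poly_Mapping.single l (- 1 - int t)) (corr f (w(n + 1 := act (W (n + 1)) u (int t) (w (n + 1))))) e k +
    (\<Sum>p\<in>{l+1..n}. \<Sum>i<I. g p i t)" for t
  proof -
    let ?e = "\<lambda>j. e j - of_int (Poly_Mapping.lookup (Poly_Mapping.single l (- 1 - int t)) j)"
    have sw: "(of_int (int t) gchoose i) * mulz (Poly_Mapping.single p (int t - int i)) (\<phi> p i) ?e k = g p i t" for p i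
    proof -
      have "mulz (Poly_Mapping.single p (int t - int i)) (\<phi> p i) ?e k =
          mulz (Poly_Mapping.single l (- 1 - int t)) (mulz (Poly_Mapping.single p (int t - int i)) (\<phi> p i)) e k"
        by (simp add: mulz_def)
      then show ?thesis by (simp only: mulz_mulz g_def)
    qed
    have "mulz (Poly_Mapping.single l (- 1 - int t)) (ins f u (int t) l w) e k = ins f u (int t) l w ?e k"
      by (simp only: mulz_def)
    also have "\<dots> = corr f (w(n + 1 := act (W (n + 1)) u (int t) (w (n + 1)))) ?e k +
        (\<Sum>p\<in>{l+1..n}. \<Sum>i<I. (of_int (int t) gchoose i) * mulz (Poly_Mapping.single p (int t - int i)) (\<phi> p i) ?e k)"
      unfolding \<phi>_def by (rule ins_right[OF f w ln I])
    also have "corr f (w(n + 1 := act (W (n + 1)) u (int t) (w (n + 1)))) ?e k =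
        mulz (Poly_Mapping.single l (- 1 - int t)) (corr f (w(n + 1 := act (W (n + 1)) u (int t) (w (n + 1))))) e k"
      by (simp only: mulz_def)
    finally show ?thesis unfolding sw .
  qed
  then have "(\<Sum>t<B. mulz (Poly_Mapping.single l (- 1 - int t)) (ins f u (int t) l w) e k) =
    (\<Sum>t<B. mulz (Poly_Mapping.single l (- 1 - int t)) (corr f (w(n + 1 := act (W (n + 1)) u (int t) (w (n + 1))))) e k) +
    (\<Sum>t<B. \<Sum>p\<in>{l+1..n}. \<Sum>i<I. g p i t)"
    by (simp only: sum.distrib)
  also have "(\<Sum>t<B. \<Sum>p\<in>{l+1..n}. \<Sum>i<I. g p i t) = (\<Sum>p\<in>{l+1..n}. \<Sum>i<I. \<Sum>t<B. g p i t)"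
    by (subst sum.swap, rule sum.cong[OF refl], rule sum.swap)
  also have "\<dots> = (\<Sum>p\<in>{l+1..n}. \<Sum>i<I. Dop (l, p) (Suc i) (\<phi> p i) e k)"
  proof (intro sum.cong refl)
    fix p i assume p: "p \<in> {l+1..n}" and i: "i \<in> {..<I}"
    have g0: "g p i t = 0" if "t < i" for t
    proof -
      have "(of_int (int t) :: complex) gchoose i = of_nat (t choose i)" by (simp add: binomial_gbinomial)
      then show ?thesis using that by (simp add: g_def)
    qed
    have gs: "g p i (s + i) = of_nat ((Suc i + s - 1) choose s) * mulz (pexp (l, p) (Suc i) s) (\<phi> p i) e k" for s
    proof -
      have "(of_int (int (s + i)) :: complex) gchoose i = of_nat ((s + i) choose i)"
        by (simp add: binomial_gbinomial del: of_nat_add)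
      also have "(s + i) choose i = (Suc i + s - 1) choose s"
        using binomial_symmetric[of i "s + i"] by (simp add: add.commute)
      finally have 1: "(of_int (int (s + i)) :: complex) gchoose i = of_nat ((Suc i + s - 1) choose s)" .
      have 2: "- 1 - int (s + i) = - int (Suc i) - int s" "int (s + i) - int i = int s" by simp_all
      show ?thesis unfolding g_def 1 2 pexp_def fst_conv snd_conv ..
    qed
    have "(\<Sum>t<B. g p i t) = (\<Sum>s<B - i. g p i (s + i))"
      using i B(2) g0 by (intro sum_lessThan_shift) auto
    also have "\<dots> = Dop (l, p) (Suc i) (\<phi> p i) e k"
      unfolding gs using p i by (intro Dop_eq_sum[symmetric]) (auto simp: \<phi>_def intro!: B)
    finally show "(\<Sum>t<B. g p i t) = Dop (l, p) (Suc i) (\<phi> p i) e k" .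
  qed
  finally show ?thesis unfolding \<phi>_def .
qed

lemma eventually_act_zero:
  assumes w: "valid w"
  shows "\<exists>I. \<forall>p\<in>{1..n+1}. \<forall>i\<ge>I. act (W p) u (int i) (w p) = 0"
proof -
  have "\<exists>N. \<forall>m\<ge>N. act (W p) u m (w p) = 0" if "p \<in> {1..n+1}" for p
    using vertex_action.lower_truncation[OF outer_modules[OF that] validD[OF w that]] .
  then obtain N where N: "\<And>p m. p \<in> {1..n+1} \<Longrightarrow> m \<ge> N p \<Longrightarrow> act (W p) u m (w p) = 0" by metis
  define I where "I = Max (insert 0 ((\<lambda>p. nat (N p)) ` {1..n+1}))"
  have "N p \<le> int i" if "p \<in> {1..n+1}" "i \<ge> I" for p i
  proof -
    have "nat (N p) \<le> I" unfolding I_def using that(1) by (intro Max_ge) auto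
    then show ?thesis using that(2) by linarith
  qed
  then show ?thesis using N by (intro exI[of _ I]) auto
qed

text \<open>The last slot holds a vector and not an operator. The mode -1 standing at the far right
  is simply moved to the far left, which costs only monomial coefficients.\<close>

lemma opspan_corr_last:
  assumes f: "functional f" and w: "valid w"
    and left: "corr (\<lambda>x. f (act (Wt 0) u (-1) x)) w \<in> opspan sscale (ring_ops n) S"
    and others: "\<And>p i. p \<in> {1..n} \<Longrightarrow> corr f (w(p := act (W p) u (int i) (w p))) \<in> opspan sscale (ring_ops n) S"
  shows "corr f (w(n + 1 := act (W (n + 1)) u (-1) (w (n + 1)))) \<in> opspan sscale (ring_ops n) S"
proof -
  obtain I where I: "\<And>p i. p \<in> {1..n+1} \<Longrightarrow> i \<ge> I \<Longrightarrow> act (W p) u (int i) (w p) = 0"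
    using eventually_act_zero[OF w, of u] by blast
  let ?\<phi> = "\<lambda>p i. corr f (w(p := act (W p) u (int i) (w p)))"
  have "corr f (w(n + 1 := act (W (n + 1)) u (-1) (w (n + 1)))) =
      corr (\<lambda>x. f (act (Wt 0) u (-1) x)) w -
      (\<Sum>p\<in>{1..n}. \<Sum>i<I. sscale (of_int (-1) gchoose i) (mulz (Poly_Mapping.single p (- 1 - int i)) (?\<phi> p i)))"
  proof (intro ext)
    fix e k
    have "corr f (w(n + 1 := act (W (n + 1)) u (-1) (w (n + 1)))) e k = ins f u (-1) n w e k"
      by (simp only: ins_n)
    also have "\<dots> = corr (\<lambda>x. f (act (Wt 0) u (-1) x)) w e k -
      (\<Sum>p\<in>{1..n}. \<Sum>i<I. (of_int (-1) gchoose i) * mulz (Poly_Mapping.single p (- 1 - int i)) (?\<phi> p i) e k)"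
      using I by (intro ins_left[OF f w]) auto
    finally show "corr f (w(n + 1 := act (W (n + 1)) u (-1) (w (n + 1)))) e k =
        (corr (\<lambda>x. f (act (Wt 0) u (-1) x)) w -
        (\<Sum>p\<in>{1..n}. \<Sum>i<I. sscale (of_int (-1) gchoose i) (mulz (Poly_Mapping.single p (- 1 - int i)) (?\<phi> p i)))) e k"
      by (simp only: minus_apply sum_series_apply sscale_apply)
  qed
  also have "\<dots> \<in> opspan sscale (ring_ops n) S"
    by (intro opspan_diff[OF vector_space_sscale] left opspan_sum opspan.scale opspan_mulz others) auto
  finally show ?thesis .
qed

text \<open>Modes with arbitrarily negative index reach the functional. The bound \<open>T\<close>
  on those that act nontrivially there, and \<open>I\<close> for the modes in the slots, leave
  finitely many series, independently of the coefficient considered.\<close>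

lemma opspan_corr_middle:
  assumes f: "functional f" and w: "valid w" and l: "l \<in> {1..n}" and S: "S \<subseteq> truncated n"
    and T: "\<And>t x. t \<ge> T \<Longrightarrow> x \<in> carrier (Wt 0) \<Longrightarrow> f (act (Wt 0) u (- 1 - int t) x) = 0"
    and left: "\<And>t. corr (\<lambda>x. f (act (Wt 0) u (- 1 - int t) x)) w \<in> opspan sscale (ring_ops n) S"
    and others: "\<And>p i. p \<in> {1..n+1} \<Longrightarrow> p \<noteq> l \<Longrightarrow>
      corr f (w(p := act (W p) u (int i) (w p))) \<in> opspan sscale (ring_ops n) S"
  shows "corr f (w(l := act (W l) u (-1) (w l))) \<in> opspan sscale (ring_ops n) S"
proof -
  obtain I where I: "\<And>p i. p \<in> {1..n+1} \<Longrightarrow> i \<ge> I \<Longrightarrow> act (W p) u (int i) (w p) = 0"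
    using eventually_act_zero[OF w, of u] by blast
  define \<phi> where "\<phi> p i = corr f (w(p := act (W p) u (int i) (w p)))" for p i
  define \<psi> where "\<psi> t = corr (\<lambda>x. f (act (Wt 0) u (- 1 - int t) x)) w" for t
  have \<phi>_trunc: "\<phi> p i \<in> truncated n" if "p \<in> {1..n+1}" for p i
    unfolding \<phi>_def by (rule corr_truncated[OF f valid_act[OF w that]])
  have \<psi>0: "\<psi> t e k = 0" if "t \<ge> T" for t e k
    using T[OF that inner_vec_closed[OF w, of 0]] corr_split[of 0] by (simp add: \<psi>_def outer_fun_0)
  have \<phi>0: "\<phi> (n + 1) i e k = 0" if "i \<ge> I" for i e k
  proof -
    have n1: "n + 1 \<in> {1..n+1}" by simp
    have "\<phi> (n + 1) i e k = corr f (w(n + 1 := 0)) e k" unfolding \<phi>_def using I[OF n1 that] by (simp only:)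
    also have "\<dots> = 0"
      using linear_on_0[OF vs_W[OF n1] vector_space_complex corr_linear_slot[OF f w n1] validD[OF w n1]] .
    finally show ?thesis .
  qed
  have "corr f (w(l := act (W l) u (-1) (w l))) =
      ((\<Sum>t<T. mulz (Poly_Mapping.single l (int t)) (\<psi> t)) -
        (\<Sum>p\<in>{1..l-1}. \<Sum>i<I. sscale ((-1) ^ i) (Dop (p, l) (Suc i) (\<phi> p i)))) +
      ((\<Sum>t<I. mulz (Poly_Mapping.single l (- 1 - int t)) (\<phi> (n + 1) t)) +
        (\<Sum>p\<in>{l+1..n}. \<Sum>i<I. Dop (l, p) (Suc i) (\<phi> p i)))" (is "_ = ?rhs")
  proof (intro ext)
    fix e k
    obtain B0 where B0: "\<And>B. B \<ge> B0 \<Longrightarrow> corr f (w(l := act (W l) u (-1) (w l))) e k =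
      (\<Sum>t<B. mulz (Poly_Mapping.single l (int t)) (ins f u (- 1 - int t) (l - 1) w) e k) +
      (\<Sum>t<B. mulz (Poly_Mapping.single l (- 1 - int t)) (ins f u (int t) l w) e k)"
      using corr_iterate[OF f w l, where u = u and e = e and k = k] by blast
    have "\<forall>p i. \<exists>b. p \<in> {1..n} \<longrightarrow> p \<noteq> l \<longrightarrow> (\<forall>t\<ge>b. mulz (pexp (if p < l then (p, l) else (l, p)) (Suc i) t) (\<phi> p i) e k = 0)"
    proof (intro allI)
      fix p i
      show "\<exists>b. p \<in> {1..n} \<longrightarrow> p \<noteq> l \<longrightarrow> (\<forall>t\<ge>b. mulz (pexp (if p < l then (p, l) else (l, p)) (Suc i) t) (\<phi> p i) e k = 0)"
      proof (cases "p \<in> {1..n} \<and> p \<noteq> l")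
        case True
        then have "(if p < l then (p, l) else (l, p)) \<in> pairs n" using l by (auto simp: pairs_def)
        from pexp_vanish[OF \<phi>_trunc this, of p "Suc i" i e k] True show ?thesis by auto
      qed auto
    qed
    then obtain b where b: "\<And>p i t. p \<in> {1..n} \<Longrightarrow> p \<noteq> l \<Longrightarrow> t \<ge> b p i \<Longrightarrow>
        mulz (pexp (if p < l then (p, l) else (l, p)) (Suc i) t) (\<phi> p i) e k = 0"
      by metis
    \<comment> \<open>The additional \<open>I\<close> is for the sums on the right, where
      \<open>t + i \<ge> B\<close> with \<open>i < I\<close> must still imply that \<open>t\<close>
      exceeds the bound for the expansion.\<close>
    define B where "B = Max (insert 0 ((\<lambda>(p, i). b p i) ` ({1..n} \<times> {..<I}))) + B0 + T + I"
    have bB: "b p i + I \<le> B" if "p \<in> {1..n}" "i < I" for p i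
    proof -
      have "b p i \<le> Max (insert 0 ((\<lambda>(p, i). b p i) ` ({1..n} \<times> {..<I})))"
        using that by (intro Max_ge) auto
      then show ?thesis unfolding B_def by linarith
    qed
    have "B \<ge> B0" "B \<ge> T" "B \<ge> I" unfolding B_def by auto
    have 1: "(\<Sum>t<B. mulz (Poly_Mapping.single l (int t)) (ins f u (- 1 - int t) (l - 1) w) e k) =
      (\<Sum>t<B. mulz (Poly_Mapping.single l (int t)) (\<psi> t) e k) -
      (\<Sum>p\<in>{1..l-1}. \<Sum>i<I. (-1) ^ i * Dop (p, l) (Suc i) (\<phi> p i) e k)"
      unfolding \<phi>_def \<psi>_def
    proof (rule ins_left_sum[OF f w l])
      fix p i t assume *: "p \<in> {1..l-1}" "i < I" "t \<ge> B"
      then have "p < l" "p \<in> {1..n}" "p \<noteq> l" using l by auto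
      moreover from this * have "b p i \<le> t" using bB[of p i] by simp
      ultimately show "mulz (pexp (p, l) (Suc i) t) (corr f (w(p := act (W p) u (int i) (w p)))) e k = 0"
        using b[of p i t] unfolding \<phi>_def by simp
    qed (use I in auto)
    have 2: "(\<Sum>t<B. mulz (Poly_Mapping.single l (- 1 - int t)) (ins f u (int t) l w) e k) =
      (\<Sum>t<B. mulz (Poly_Mapping.single l (- 1 - int t)) (\<phi> (n + 1) t) e k) +
      (\<Sum>p\<in>{l+1..n}. \<Sum>i<I. Dop (l, p) (Suc i) (\<phi> p i) e k)"
      unfolding \<phi>_def
    proof (rule ins_right_sum[OF f w l])
      fix p i t assume *: "p \<in> {l+1..n}" "i < I" "t + i \<ge> B"
      then have "\<not> p < l" "p \<in> {1..n}" "p \<noteq> l" using l by auto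
      moreover from this * have "b p i \<le> t" using bB[of p i] by simp
      ultimately show "mulz (pexp (l, p) (Suc i) t) (corr f (w(p := act (W p) u (int i) (w p)))) e k = 0"
        using b[of p i t] unfolding \<phi>_def by simp
    qed (use I \<open>B \<ge> I\<close> in auto)
    have 3: "(\<Sum>t<B. mulz (Poly_Mapping.single l (int t)) (\<psi> t) e k) = (\<Sum>t<T. mulz (Poly_Mapping.single l (int t)) (\<psi> t) e k)"
      using \<open>B \<ge> T\<close> by (intro sum.mono_neutral_right) (auto simp: mulz_def \<psi>0)
    have 4: "(\<Sum>t<B. mulz (Poly_Mapping.single l (- 1 - int t)) (\<phi> (n + 1) t) e k) =
        (\<Sum>t<I. mulz (Poly_Mapping.single l (- 1 - int t)) (\<phi> (n + 1) t) e k)"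
      using \<open>B \<ge> I\<close> \<phi>0 by (intro sum.mono_neutral_right) (auto simp: mulz_def)
    show "corr f (w(l := act (W l) u (-1) (w l))) e k = ?rhs e k"
      unfolding B0[OF \<open>B \<ge> B0\<close>] 1 2 3 4
      by (simp only: minus_apply plus_fun_apply sum_series_apply sscale_apply)
  qed
  also have "?rhs \<in> opspan sscale (ring_ops n) S"
  proof -
    have \<phi>: "\<phi> p i \<in> opspan sscale (ring_ops n) S" if "p \<in> {1..n+1}" "p \<noteq> l" for p i
      unfolding \<phi>_def by (rule others[OF that])
    have \<psi>: "\<psi> t \<in> opspan sscale (ring_ops n) S" for t unfolding \<psi>_def by (rule left)
    show ?thesis
      using l by (intro opspan.add opspan_diff[OF vector_space_sscale] opspan_sum opspan.scale
          opspan_mulz opspan_Dop[OF _ S] \<phi> \<psi>) (auto simp: pairs_def)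
  qed
  finally show ?thesis .
qed

end

section \<open>Functionals on doubly homogeneous components\<close>

text \<open>The finite set provided by \<open>finite_dim\<close> need not lie in \<open>F\<close>;
  it only bounds the size of a basis of \<open>F\<close>.\<close>

lemma finite_dim_basis:
  assumes "vector_space s" "finite_dim s F" "module.subspace s F"
  shows "\<exists>B. finite B \<and> B \<subseteq> F \<and> \<not> module.dependent s B \<and> F \<subseteq> module.span s B"
proof -
  interpret vector_space s by fact
  obtain C where C: "finite C" "F \<subseteq> span C" using assms(2) unfolding finite_dim_def by blast
  obtain B where B: "B \<subseteq> F" "independent B" "F \<subseteq> span B" using basis_exists[of F] by metis
  have "finite B" using independent_span_bound[OF C(1) B(2)] B(1) C(2) by auto
  then show ?thesis using B by blast
qed

context strongly_graded_module
begin

text \<open>The dual of one doubly homogeneous subspace, extended by 0. The index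
  \<open>\<gamma>\<close> is the degree of the subspace, so it is the negative of the contragredient
  degree.\<close>

definition functional_space :: "'a \<Rightarrow> complex \<Rightarrow> ('w \<Rightarrow> complex) set"
  where "functional_space \<gamma> \<nu> = {f. linear_on (scale M) (*) (carrier M) f \<and>
    (\<forall>\<gamma>' \<nu>'. (\<gamma>', \<nu>') \<noteq> (\<gamma>, \<nu>) \<longrightarrow> (\<forall>x\<in>gweight V M \<nu>' \<inter> Wg \<gamma>'. f x = 0))}"

lemma linear_functional_sum:
  assumes "linear_on (scale M) (*) (carrier M) f" "\<And>x. x \<in> X \<Longrightarrow> g x \<in> carrier M"
  shows "f (sum g X) = (\<Sum>x\<in>X. f (g x))"
  by (rule linear_on_sum[OF module_action.vector_space_ambient vector_space_complex module_action.subspace_carrier assms])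

lemma linear_functional_0:
  assumes "linear_on (scale M) (*) (carrier M) f"
  shows "f 0 = 0"
  using linear_functional_sum[OF assms, of "{}" "\<lambda>_. 0"] by simp

definition projection :: "'a \<Rightarrow> complex \<Rightarrow> 'w \<Rightarrow> 'w"
  where "projection \<gamma> \<nu> x = wt \<nu> (component Wg x \<gamma>)"

lemma projection_mem: "x \<in> carrier M \<Longrightarrow> projection \<gamma> \<nu> x \<in> gweight V M \<nu> \<inter> Wg \<gamma>"
  unfolding projection_def by (intro wt_degree degrees.component_mem)

lemma projection_carrier: "x \<in> carrier M \<Longrightarrow> projection \<gamma> \<nu> x \<in> carrier M"
  using projection_mem gweight_carrier by blast

lemma projection_add: "x \<in> carrier M \<Longrightarrow> y \<in> carrier M \<Longrightarrow>
    projection \<gamma> \<nu> (x + y) = projection \<gamma> \<nu> x + projection \<gamma> \<nu> y"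
  and projection_scale: "x \<in> carrier M \<Longrightarrow> projection \<gamma> \<nu> (scale M c x) = scale M c (projection \<gamma> \<nu> x)"
  by (simp_all add: projection_def degrees.component_add degrees.component_scale
      weights.component_add weights.component_scale degrees.component_in_total)

lemma projection_homogeneous:
  "x \<in> gweight V M \<nu>' \<inter> Wg \<gamma>' \<Longrightarrow> projection \<gamma> \<nu> x = (if (\<gamma>', \<nu>') = (\<gamma>, \<nu>) then x else 0)"
  using degrees.component_homogeneous[of x \<gamma>' \<gamma>] weights.component_homogeneous[of x \<nu>' \<nu>]
  by (auto simp: projection_def weights.component_0)

lemma functional_eq_degree_component:
  assumes f: "linear_on (scale M) (*) (carrier M) f" "\<And>\<gamma>' y. \<gamma>' \<noteq> \<gamma> \<Longrightarrow> y \<in> Wg \<gamma>' \<Longrightarrow> f y = 0"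
    and x: "x \<in> carrier M"
  shows "f x = f (component Wg x \<gamma>)"
proof -
  let ?F = "{\<gamma>'. component Wg x \<gamma>' \<noteq> 0}"
  have "f x = f (\<Sum>\<gamma>'\<in>?F. component Wg x \<gamma>')" by (simp only: degrees.sum_component[OF x])
  also have "\<dots> = (\<Sum>\<gamma>'\<in>?F. f (component Wg x \<gamma>'))"
    by (rule linear_functional_sum[OF f(1) degrees.component_in_total[OF x]])
  also have "\<dots> = (\<Sum>\<gamma>'\<in>?F. if \<gamma>' = \<gamma> then f (component Wg x \<gamma>) else 0)"
    using f(2) degrees.component_mem[OF x] by (intro sum.cong) auto
  also have "\<dots> = f (component Wg x \<gamma>)"
    using degrees.finite_component[OF x] linear_functional_0[OF f(1)] by (auto simp: sum.delta')
  finally show ?thesis .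
qed

lemma functional_sum_weights:
  assumes f: "linear_on (scale M) (*) (carrier M) f" and y: "y \<in> carrier M"
  shows "f y = (\<Sum>\<nu> | wt \<nu> y \<noteq> 0. f (wt \<nu> y))"
proof -
  have "f y = f (\<Sum>\<nu> | wt \<nu> y \<noteq> 0. wt \<nu> y)" by (simp only: weights.sum_component[OF y])
  then show ?thesis
    using linear_functional_sum[OF f weights.component_in_total[OF y]] by simp
qed

lemma functional_space_projection:
  assumes f: "f \<in> functional_space \<gamma> \<nu>" and x: "x \<in> carrier M"
  shows "f x = f (projection \<gamma> \<nu> x)"
proof -
  have lin: "linear_on (scale M) (*) (carrier M) f" using f by (simp add: functional_space_def)
  have zero: "f y = 0" if "(\<gamma>', \<nu>') \<noteq> (\<gamma>, \<nu>)" "y \<in> gweight V M \<nu>' \<inter> Wg \<gamma>'" for y \<gamma>' \<nu>'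
    using f that unfolding functional_space_def by blast
  have "f x = f (component Wg x \<gamma>)"
  proof (rule functional_eq_degree_component[OF lin _ x])
    fix \<gamma>' y assume *: "\<gamma>' \<noteq> \<gamma>" "y \<in> Wg \<gamma>'"
    have "f (wt b y) = 0" for b
      using zero[OF _ wt_degree[OF *(2)], of b] *(1) by simp
    then show "f y = 0"
      using functional_sum_weights[OF lin degree_carrier[OF *(2)]] by simp
  qed
  also have "\<dots> = (\<Sum>\<nu>' | wt \<nu>' (component Wg x \<gamma>) \<noteq> 0. f (wt \<nu>' (component Wg x \<gamma>)))"
    by (rule functional_sum_weights[OF lin degrees.component_in_total[OF x]])
  also have "\<dots> = (\<Sum>\<nu>' | wt \<nu>' (component Wg x \<gamma>) \<noteq> 0. if \<nu>' = \<nu> then f (wt \<nu> (component Wg x \<gamma>)) else 0)"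
    using zero[of \<gamma>] wt_degree[OF degrees.component_mem[OF x]] by (intro sum.cong) auto
  also have "\<dots> = f (projection \<gamma> \<nu> x)"
    using weights.finite_component[OF degrees.component_in_total[OF x]] linear_functional_0[OF lin]
    by (auto simp: projection_def sum.delta')
  finally show ?thesis .
qed

lemma functional_space_act:
  assumes f: "f \<in> functional_space \<gamma> \<nu>" and \<alpha>: "\<alpha> \<in> A" and u: "u \<in> vweight V a \<inter> Vg \<alpha>"
  shows "(\<lambda>x. f (act M u k x)) \<in> functional_space (\<gamma> - \<alpha>) (\<nu> - of_int (a - k - 1))"
  unfolding functional_space_def
proof (intro CollectI conjI allI impI ballI)
  show "linear_on (scale M) (*) (carrier M) (\<lambda>x. f (act M u k x))"
    using f module_action.act_add module_action.act_scale module_action.act_closed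
    unfolding functional_space_def linear_on_def by simp
  fix \<gamma>' \<nu>' x
  assume *: "(\<gamma>', \<nu>') \<noteq> (\<gamma> - \<alpha>, \<nu> - of_int (a - k - 1))" "x \<in> gweight V M \<nu>' \<inter> Wg \<gamma>'"
  have "act M u k x \<in> gweight V M (\<nu>' + of_int (a - k - 1)) \<inter> Wg (\<alpha> + \<gamma>')"
    using act_weight act_degree[OF \<alpha>] u *(2) by auto
  moreover have "(\<alpha> + \<gamma>', \<nu>' + of_int (a - k - 1)) \<noteq> (\<gamma>, \<nu>)" using *(1) by (auto simp: algebra_simps)
  ultimately show "f (act M u k x) = 0" using f unfolding functional_space_def by blast
qed

lemma functional_space_zero:
  assumes "f \<in> functional_space \<gamma> \<nu>" "gweight V M \<nu> \<inter> Wg \<gamma> = {0}" "x \<in> carrier M"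
  shows "f x = 0"
proof -
  have "projection \<gamma> \<nu> x = 0" using projection_mem[OF assms(3), of \<gamma> \<nu>] assms(2) by auto
  then show ?thesis
    using functional_space_projection[OF assms(1,3)] linear_functional_0 assms(1) by (auto simp: functional_space_def)
qed

text \<open>Composing \<open>f\<close> with the mode -1 - t gives a functional supported in weight
  \<nu> - a - t, where the module is 0 for large t. This is lower truncation on the dual
  side.\<close>

lemma functional_space_act_vanish:
  assumes f: "f \<in> functional_space \<gamma> \<nu>" and \<alpha>: "\<alpha> \<in> A" and u: "u \<in> vweight V a \<inter> Vg \<alpha>"
  shows "\<exists>T. \<forall>t\<ge>T. \<forall>x\<in>carrier M. f (act M u (- 1 - int t) x) = 0"
proof -
  obtain K :: int where K: "\<And>k. k < K \<Longrightarrow> gweight V M (\<nu> - of_int a + of_int k) \<inter> Wg (\<gamma> - \<alpha>) = {0}"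
    using module_bounded_below by blast
  have "f (act M u (- 1 - int t) x) = 0" if "t \<ge> nat (- K) + 1" "x \<in> carrier M" for t x
  proof -
    have "- int t < K" using that(1) by linarith
    from K[OF this] have "gweight V M (\<nu> - of_int (a - (- 1 - int t) - 1)) \<inter> Wg (\<gamma> - \<alpha>) = {0}"
      by (simp add: algebra_simps)
    from functional_space_zero[OF functional_space_act[OF f \<alpha> u] this that(2)] show ?thesis .
  qed
  then show ?thesis by blast
qed

text \<open>The functionals \<open>h b\<close> are the coordinates of the projection with respect to
  a basis. Values outside the carrier are arbitrary, so finite dimension is expressed through values
  on the carrier.\<close>

lemma functional_space_finite:
  "\<exists>(B :: 'w set) h. finite B \<and> (\<forall>b\<in>B. linear_on (scale M) (*) (carrier M) (h b)) \<and>
    (\<forall>f\<in>functional_space \<gamma> \<nu>. \<exists>c. \<forall>x\<in>carrier M. f x = (\<Sum>b\<in>B. c b * h b x))"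
proof -
  let ?F = "gweight V M \<nu> \<inter> Wg \<gamma>"
  have F: "weights.subspace ?F" by (rule weights.subspace_inter[OF weights.subspace_piece degrees.subspace_piece])
  obtain B where B: "finite B" "B \<subseteq> ?F" "weights.independent B" "?F \<subseteq> weights.span B"
    using finite_dim_basis[OF module_action.vector_space_ambient module_finite_dim_homogeneous F] by blast
  define h where "h b x = weights.representation B (projection \<gamma> \<nu> x) b" for b x
  have span: "projection \<gamma> \<nu> x \<in> weights.span B" if "x \<in> carrier M" for x
    using projection_mem[OF that] B(4) by blast
  have lin: "linear_on (scale M) (*) (carrier M) (h b)" for b
    unfolding linear_on_def h_def
    using span B(3) by (auto simp: projection_add projection_scale weights.representation_add weights.representation_scale)
  have "f x = (\<Sum>b\<in>B. f b * h b x)" if f: "f \<in> functional_space \<gamma> \<nu>" and x: "x \<in> carrier M" for f x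
  proof -
    have flin: "linear_on (scale M) (*) (carrier M) f" using f by (simp add: functional_space_def)
    have Bc: "b \<in> carrier M" if "b \<in> B" for b using that B(2) gweight_carrier by blast
    have "projection \<gamma> \<nu> x = (\<Sum>b\<in>B. scale M (h b x) b)"
      unfolding h_def
      by (rule weights.sum_representation_eq[OF B(3) span[OF x] B(1) subset_refl, symmetric])
    then have "f x = f (\<Sum>b\<in>B. scale M (h b x) b)" using functional_space_projection[OF f x] by simp
    also have "\<dots> = (\<Sum>b\<in>B. f (scale M (h b x) b))"
      using Bc by (intro linear_functional_sum[OF flin] weights.subspace_scale[OF module_action.subspace_carrier])
    also have "\<dots> = (\<Sum>b\<in>B. f b * h b x)"
      using flin Bc by (intro sum.cong) (auto simp: linear_on_def mult.commute)
    finally show ?thesis .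
  qed
  then show ?thesis using B(1) lin by (intro exI[of _ B] exI[of _ h]) blast
qed

lemma contragredient_decomposition:
  assumes f: "f \<in> contragredient_degree V M Wg \<beta>"
  shows "\<exists>F g. finite F \<and> (\<forall>\<nu>\<in>F. g \<nu> \<in> functional_space (- \<beta>) \<nu>) \<and>
    (\<forall>x\<in>carrier M. f x = (\<Sum>\<nu>\<in>F. g \<nu> x))"
proof -
  have lin: "linear_on (scale M) (*) (carrier M) f"
    and fin: "finite {(\<beta>, \<nu>). \<exists>w \<in> gweight V M \<nu> \<inter> Wg \<beta>. f w \<noteq> 0}"
    and supp: "\<And>\<gamma> x. \<gamma> \<noteq> - \<beta> \<Longrightarrow> x \<in> Wg \<gamma> \<Longrightarrow> f x = 0"
    using f unfolding contragredient_degree_def contragredient_def by blast+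
  define F where "F = {\<nu>. \<exists>w \<in> gweight V M \<nu> \<inter> Wg (- \<beta>). f w \<noteq> 0}"
  have "F \<subseteq> snd ` {(\<beta>, \<nu>). \<exists>w \<in> gweight V M \<nu> \<inter> Wg \<beta>. f w \<noteq> 0}"
    unfolding F_def by force
  then have finF: "finite F" using fin finite_subset by blast
  define g where "g \<nu> x = f (projection (- \<beta>) \<nu> x)" for \<nu> x
  have "g \<nu> \<in> functional_space (- \<beta>) \<nu>" for \<nu>
    unfolding functional_space_def
  proof (intro CollectI conjI allI impI ballI)
    show "linear_on (scale M) (*) (carrier M) (g \<nu>)"
      using lin projection_carrier unfolding linear_on_def g_def by (simp add: projection_add projection_scale)
    fix \<gamma>' \<nu>' x assume "(\<gamma>', \<nu>') \<noteq> (- \<beta>, \<nu>)" "x \<in> gweight V M \<nu>' \<inter> Wg \<gamma>'"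
    then show "g \<nu> x = 0"
      unfolding g_def by (simp only: projection_homogeneous if_False linear_functional_0[OF lin])
  qed
  moreover have "f x = (\<Sum>\<nu>\<in>F. g \<nu> x)" if x: "x \<in> carrier M" for x
  proof -
    let ?y = "component Wg x (- \<beta>)"
    have y: "?y \<in> Wg (- \<beta>)" "?y \<in> carrier M"
      using degrees.component_mem[OF x] degrees.component_in_total[OF x] by auto
    have "f x = f ?y" by (rule functional_eq_degree_component[OF lin supp x])
    also have "\<dots> = (\<Sum>\<nu> | wt \<nu> ?y \<noteq> 0. f (wt \<nu> ?y))" by (rule functional_sum_weights[OF lin y(2)])
    also have "\<dots> = (\<Sum>\<nu>\<in>F. f (wt \<nu> ?y))"
    proof (rule sum.mono_neutral_cong[OF finF weights.finite_component[OF y(2)]])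
      fix \<nu> assume "\<nu> \<in> {\<nu>. wt \<nu> ?y \<noteq> 0} - F"
      then show "f (wt \<nu> ?y) = 0" using wt_degree[OF y(1), of \<nu>] unfolding F_def by blast
    qed (auto simp: linear_functional_0[OF lin])
    finally show ?thesis by (simp add: g_def projection_def)
  qed
  ultimately show ?thesis using finF by (intro exI[of _ F] exI[of _ g]) blast
qed

end

context intertwining_chain
begin

section \<open>Correlators as multilinear functions of their entries\<close>

lemma corr_cong: "(\<And>i. i \<in> {1..n+1} \<Longrightarrow> w i = w' i) \<Longrightarrow> corr f w = corr f w'"
proof (intro ext)
  fix e k
  assume *: "\<And>i. i \<in> {1..n+1} \<Longrightarrow> w i = w' i"
  have "inner_vec 0 w e k = inner_vec 0 w' e k" using * by (intro inner_vec_cong) auto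
  then show "corr f w e k = corr f w' e k" using corr_split[of 0 f] by (simp add: outer_fun_0)
qed

lemma corr_functional_sum:
  assumes "valid w" "\<And>x. x \<in> carrier (Wt 0) \<Longrightarrow> f x = (\<Sum>b\<in>B. c b * h b x)"
  shows "corr f w = (\<Sum>b\<in>B. sscale (c b) (corr (h b) w))"
proof (intro ext)
  fix e k
  have "inner_vec 0 w e k \<in> carrier (Wt 0)" by (rule inner_vec_closed[OF assms(1)]) simp
  then show "corr f w e k = (\<Sum>b\<in>B. sscale (c b) (corr (h b) w)) e k"
    using corr_split[of 0] assms(2) by (simp add: sum_series_apply sscale_apply outer_fun_0)
qed

lemma opspan_slot:
  assumes f: "functional f" and w: "valid w" and l: "l \<in> {1..n+1}" and B: "B \<subseteq> carrier (W l)"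
    and x: "x \<in> module.span (scale (W l)) B"
    and base: "\<And>y. y \<in> B \<Longrightarrow> corr f (w(l := y)) \<in> opspan sscale (ring_ops n) S"
  shows "corr f (w(l := x)) \<in> opspan sscale (ring_ops n) S"
proof -
  interpret amb: vector_space "scale (W l)" by (rule vs_W[OF l])
  have sub: "amb.subspace (carrier (W l))" by (rule sub_W[OF l])
  note lin = corr_linear_slot[OF f w l]
  have "corr f (w(l := x)) \<in> opspan sscale (ring_ops n) S \<and> x \<in> carrier (W l)"
    using x
  proof (induction rule: amb.span_induct_alt)
    case base
    have "corr f (w(l := 0)) = 0"
      using linear_on_0[OF vs_W[OF l] vector_space_complex lin validD[OF w l]] by (intro ext) simp
    then show ?case using amb.subspace_0[OF sub] opspan.zero by (simp only: simp_thms)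
  next
    case (step c x y)
    then have xy: "x \<in> carrier (W l)" "y \<in> carrier (W l)" using B by auto
    have cx: "scale (W l) c x \<in> carrier (W l)" using amb.subspace_scale[OF sub xy(1)] .
    have "corr f (w(l := scale (W l) c x + y)) = sscale c (corr f (w(l := x))) + corr f (w(l := y))"
    proof (intro ext)
      fix e k
      have "corr f (w(l := scale (W l) c x + y)) e k = corr f (w(l := scale (W l) c x)) e k + corr f (w(l := y)) e k"
        using lin[of e k] cx xy(2) unfolding linear_on_def by blast
      also have "corr f (w(l := scale (W l) c x)) e k = c * corr f (w(l := x)) e k"
        using lin[of e k] xy(1) unfolding linear_on_def by blast
      finally show "corr f (w(l := scale (W l) c x + y)) e k = (sscale c (corr f (w(l := x))) + corr f (w(l := y))) e k"
        by (simp only: plus_fun_apply sscale_apply)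
    qed
    moreover have "sscale c (corr f (w(l := x))) + corr f (w(l := y)) \<in> opspan sscale (ring_ops n) S"
      by (rule opspan.add[OF opspan.scale[OF base[OF step(1)]] conjunct1[OF step(2)]])
    ultimately show ?case using amb.subspace_add[OF sub cx xy(2)] by (simp only: simp_thms)
  qed
  then show ?thesis ..
qed

lemma opspan_multilinear:
  assumes f: "functional f" and B: "\<And>i. i \<in> {1..n+1} \<Longrightarrow> B i \<subseteq> carrier (W i)"
    and base: "\<And>w. (\<And>i. i \<in> {1..n+1} \<Longrightarrow> w i \<in> B i) \<Longrightarrow> corr f w \<in> opspan sscale (ring_ops n) S"
    and w: "\<And>i. i \<in> {1..n+1} \<Longrightarrow> w i \<in> module.span (scale (W i)) (B i)"
  shows "corr f w \<in> opspan sscale (ring_ops n) S"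
proof -
  have span: "x \<in> carrier (W i)" if "i \<in> {1..n+1}" "x \<in> module.span (scale (W i)) (B i)" for i x
  proof -
    interpret amb: vector_space "scale (W i)" by (rule vs_W[OF that(1)])
    show ?thesis using amb.span_minimal[OF B[OF that(1)] sub_W[OF that(1)]] that(2) by blast
  qed
  \<comment> \<open>The slots are released one at a time: those up to \<open>j\<close> range over
    the spans, the later ones still over the sets \<open>B i\<close>.\<close>
  have "corr f w \<in> opspan sscale (ring_ops n) S"
    if "\<And>i. i \<in> {1..n+1} \<Longrightarrow> i \<le> j \<Longrightarrow> w i \<in> module.span (scale (W i)) (B i)"
      "\<And>i. i \<in> {1..n+1} \<Longrightarrow> i > j \<Longrightarrow> w i \<in> B i" for w j
    using that
  proof (induction j arbitrary: w)
    case 0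
    then show ?case by (intro base) auto
  next
    case (Suc j)
    show ?case
    proof (cases "Suc j \<in> {1..n+1}")
      case True
      have valid: "valid w"
        unfolding valid_def
      proof
        fix i assume i: "i \<in> {1..n+1}"
        show "w i \<in> carrier (W i)"
          using Suc.prems[OF i] span[OF i] B[OF i] by (cases "i \<le> Suc j") auto
      qed
      have "corr f (w(Suc j := w (Suc j))) \<in> opspan sscale (ring_ops n) S"
      proof (rule opspan_slot[OF f valid True B[OF True]])
        show "w (Suc j) \<in> module.span (scale (W (Suc j))) (B (Suc j))" using Suc.prems(1)[OF True] by simp
        fix y assume "y \<in> B (Suc j)"
        then show "corr f (w(Suc j := y)) \<in> opspan sscale (ring_ops n) S"
          using Suc.prems by (intro Suc.IH) auto
      qed
      then show ?thesis by simp
    next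
      case False
      then show ?thesis using Suc.prems by (intro Suc.IH) auto
    qed
  qed
  from this[of "n + 1"] w show ?thesis by auto
qed

end

section \<open>Finite generation\<close>

text \<open>Bookkeeping for a transfer between two slots. It is stated without subtraction so that
  it applies to partitions as well as to weights.\<close>

lemma sum_update2:
  fixes g :: "'i \<Rightarrow> 'b::comm_monoid_add"
  assumes "finite S" "l \<in> S" "p \<in> S" "l \<noteq> p"
  shows "sum (g(l := a, p := b)) S + (g l + g p) = sum g S + (a + b)"
proof -
  have "S = insert l (insert p (S - {l, p}))" using assms by auto
  then have *: "sum h S = h l + (h p + sum h (S - {l, p}))" for h :: "'i \<Rightarrow> 'b"
    using assms by (metis Diff_iff finite_Diff finite_insert insertCI insertE singletonD sum.insert)
  define h where "h = g(l := a, p := b)"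
  have h: "h l = a" "h p = b" using assms(4) by (simp_all add: h_def)
  have "sum h (S - {l, p}) = sum g (S - {l, p})" by (intro sum.cong) (auto simp: h_def)
  then show ?thesis unfolding h_def[symmetric] by (simp add: *[of g] *[of h] h ac_simps)
qed

lemma (in pattern_module) exceptional_finite_span:
  "\<exists>B. finite B \<and> B \<subseteq> carrier M \<and> (\<forall>Q b. Q \<subseteq># Q0 \<longrightarrow> b \<in> exceptional (sum_mset Q) \<longrightarrow>
    pattern_space Q b \<subseteq> weights.span B)"
proof -
  define D where "D b \<beta> = gweight V M b \<inter> Wg \<beta>" for b \<beta>
  define B where "B b \<beta> = (SOME B. finite B \<and> B \<subseteq> D b \<beta> \<and> weights.independent B \<and> D b \<beta> \<subseteq> weights.span B)" for b \<beta>
  have B: "finite (B b \<beta>) \<and> B b \<beta> \<subseteq> D b \<beta> \<and> weights.independent (B b \<beta>) \<and> D b \<beta> \<subseteq> weights.span (B b \<beta>)" for b \<beta>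
    unfolding B_def
    by (rule someI_ex, unfold D_def, rule finite_dim_basis[OF module_action.vector_space_ambient
        module_finite_dim_homogeneous subspace_doubly_homogeneous])
  define C where "C = (\<Union>Q\<in>{Q. Q \<subseteq># Q0}. \<Union>b\<in>exceptional (sum_mset Q). B b (sum_mset Q))"
  have "finite C" unfolding C_def using B finite_exceptional[OF cofinite] by (auto simp: finite_submultisets)
  moreover have "C \<subseteq> carrier M"
  proof
    fix x assume "x \<in> C"
    then obtain b \<beta> where "x \<in> B b \<beta>" unfolding C_def by blast
    then show "x \<in> carrier M" using B[of b \<beta>] gweight_carrier unfolding D_def by blast
  qed
  moreover have "pattern_space Q b \<subseteq> weights.span C" if "Q \<subseteq># Q0" "b \<in> exceptional (sum_mset Q)" for Q b
  proof -
    have "B b (sum_mset Q) \<subseteq> C" unfolding C_def using that by blast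
    then have "weights.span (B b (sum_mset Q)) \<subseteq> weights.span C" by (rule weights.span_mono)
    then show ?thesis using pattern_space_subset[of Q b] B[of b "sum_mset Q"] unfolding D_def by blast
  qed
  ultimately show ?thesis by (intro exI[of _ C]) simp
qed

locale graded_chain = intertwining_chain V n W Wt Y
  for V :: "('v::ab_group_add, 'm) vertex_data_scheme"
    and n :: nat
    and W Wt :: "nat \<Rightarrow> ('v, 'w::ab_group_add, 'n) vmod_scheme"
    and Y :: "nat \<Rightarrow> 'w \<Rightarrow> complex \<Rightarrow> nat \<Rightarrow> 'w \<Rightarrow> 'w" +
  fixes A :: "'a::ab_group_add set"
    and Vg :: "'a \<Rightarrow> 'v set"
    and Wg :: "nat \<Rightarrow> 'a \<Rightarrow> 'w set"
    and P :: "nat \<Rightarrow> 'a \<Rightarrow> 'w \<Rightarrow> 'a multiset"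
  assumes patterns: "i \<in> {1..n+1} \<Longrightarrow> pattern_module V A Vg (W i) (Wg i) (P i)"
    and first_graded: "strongly_graded_module V A Vg (W 0) (Wg 0)"
    and first_module: "Wt 0 = W 0"
begin

abbreviation Fn where "Fn \<equiv> strongly_graded_module.functional_space V (W 0) (Wg 0)"

abbreviation G where "G i \<equiv> pattern_module.pattern_space V (W i) (Wg i) (P i)"

text \<open>The partition \<open>Qtot\<close> is distributed over the \<open>n + 2\<close> slots (\<open>Q 0\<close> counts what has been moved onto the functional),
  and the weight in slot \<open>i\<close> is \<open>\<mu> i + k i\<close>.\<close>

definition state :: "'a multiset \<Rightarrow> 'a \<Rightarrow> (nat \<Rightarrow> complex) \<Rightarrow> (nat \<Rightarrow> 'a multiset) \<Rightarrow> (nat \<Rightarrow> int) \<Rightarrow> ('w \<Rightarrow> complex) \<Rightarrow> (nat \<Rightarrow> 'w) \<Rightarrow> bool"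
  where "state Qtot \<gamma> \<mu> Q k f x \<longleftrightarrow> sum Q {0..n+1} = Qtot \<and>
    f \<in> Fn (\<gamma> - sum_mset (Q 0)) (\<mu> 0 + of_int (k 0)) \<and> k 0 \<le> 0 \<and>
    (\<forall>i\<in>{1..n+1}. x i \<in> G i (Q i) (\<mu> i + of_int (k i)))"

lemma Fn_functional: "f \<in> Fn \<gamma> \<nu> \<Longrightarrow> functional f"
  by (simp add: strongly_graded_module.functional_space_def[OF first_graded] first_module)

lemma G_carrier: "i \<in> {1..n+1} \<Longrightarrow> x \<in> G i Q b \<Longrightarrow> x \<in> carrier (W i)"
  by (rule pattern_module.pattern_space_carrier[OF patterns])

text \<open>Every term that arises has smaller total weight. If \<open>u\<close> goes to another
  slot through mode \<open>i\<close>, that slot gains a - i - 1 and slot \<open>l\<close> loses a, a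
  drop by i + 1. If it goes onto the functional through mode -1 - t, the drop is 2a + t. In both
  cases the block \<open>J\<close> moves along, and the total partition is unchanged.\<close>

lemma opspan_reduce:
  assumes Q: "sum Q {0..n+1} = Qtot" and f: "f \<in> Fn (\<gamma> - sum_mset (Q 0)) (\<mu> 0 + of_int (k 0))" and k0: "k 0 \<le> 0"
    and x: "\<And>i. i \<in> {1..n+1} \<Longrightarrow> i \<noteq> l \<Longrightarrow> x i \<in> G i (Q i) (\<mu> i + of_int (k i))"
    and l: "l \<in> {1..n+1}" and Ql: "Q l = J + Q'" and J: "sum_mset J \<in> A" and a: "a \<ge> 1"
    and u: "u \<in> vweight V a \<inter> Vg (sum_mset J)" and y: "y \<in> G l Q' (\<mu> l + of_int (k l) - of_int a)"
    and S: "S \<subseteq> truncated n"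
    and IH: "\<And>Q' k' f' x'. state Qtot \<gamma> \<mu> Q' k' f' x' \<Longrightarrow> sum k' {0..n+1} < sum k {0..n+1} \<Longrightarrow>
      corr f' x' \<in> opspan sscale (ring_ops n) S"
  shows "corr f (x(l := act (W l) u (-1) y)) \<in> opspan sscale (ring_ops n) S"
proof -
  \<comment> \<open>The configuration before \<open>u\<close> acts: slot \<open>l\<close> has
    partition \<open>Q'\<close> and weight offset \<open>k l - a\<close>.\<close>
  define w where "w = x(l := y)"
  have w_l: "w l = y" and w_other: "\<And>i. i \<noteq> l \<Longrightarrow> w i = x i" by (simp_all add: w_def)
  have w_mem: "w i \<in> G i (if i = l then Q' else Q i) (\<mu> i + of_int (if i = l then k l - a else k i))"
    if "i \<in> {1..n+1}" for i
    using x[OF that] y by (simp add: w_def algebra_simps)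
  have valid: "valid w" unfolding valid_def using w_mem G_carrier by blast
  have lin: "functional f" by (rule Fn_functional[OF f])
  have Qsum: "sum (Q(l := Q', p := J + Q p)) {0..n+1} = Qtot" if "p \<in> {0..n+1}" "p \<noteq> l" for p
  proof -
    have "sum (Q(l := Q', p := J + Q p)) {0..n+1} + (Q l + Q p) = sum Q {0..n+1} + (Q' + (J + Q p))"
      using that l by (intro sum_update2) auto
    then have "sum (Q(l := Q', p := J + Q p)) {0..n+1} + (J + (Q' + Q p)) = Qtot + (J + (Q' + Q p))"
      unfolding Q Ql by (simp only: ac_simps)
    then show ?thesis by (rule add_right_imp_eq)
  qed
  have ksum: "sum (k(l := k l - a, p := b)) {0..n+1} = sum k {0..n+1} - a + b - k p" if "p \<in> {0..n+1}" "p \<noteq> l" for p b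
  proof -
    have "sum (k(l := k l - a, p := b)) {0..n+1} + (k l + k p) = sum k {0..n+1} + (k l - a + b)"
      using that l by (intro sum_update2) auto
    then show ?thesis by linarith
  qed
  have others: "corr f (w(p := act (W p) u (int i) (w p))) \<in> opspan sscale (ring_ops n) S"
    if p: "p \<in> {1..n+1}" "p \<noteq> l" for p i
  proof (rule IH)
    let ?Q = "Q(l := Q', p := J + Q p)" and ?k = "k(l := k l - a, p := k p + (a - int i - 1))"
    show "state Qtot \<gamma> \<mu> ?Q ?k f (w(p := act (W p) u (int i) (w p)))"
      unfolding state_def
    proof (intro conjI ballI)
      show "sum ?Q {0..n+1} = Qtot" using p by (intro Qsum) auto
      show "f \<in> Fn (\<gamma> - sum_mset (?Q 0)) (\<mu> 0 + of_int (?k 0))" "?k 0 \<le> 0" using f k0 p l by auto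
      fix j assume j: "j \<in> {1..n+1}"
      show "(w(p := act (W p) u (int i) (w p))) j \<in> G j (?Q j) (\<mu> j + of_int (?k j))"
      proof (cases "j = p")
        case True
        have "act (W p) u (int i) (w p) \<in> G p (J + Q p) (\<mu> p + of_int (k p) + of_int (a - int i - 1))"
          using w_mem[OF p(1)] p(2) by (intro pattern_module.act_pattern_space[OF patterns[OF p(1)] J u]) simp
        then show ?thesis using True by (simp add: algebra_simps)
      next
        case False
        then show ?thesis using w_mem[OF j] by (cases "j = l") (simp_all add: p(2))
      qed
    qed
    show "sum ?k {0..n+1} < sum k {0..n+1}" using ksum[of p] p by simp
  qed
  have left: "corr (\<lambda>x. f (act (Wt 0) u (- 1 - int t) x)) w \<in> opspan sscale (ring_ops n) S" for t
  proof (rule IH)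
    let ?Q = "Q(l := Q', 0 := J + Q 0)" and ?k = "k(l := k l - a, 0 := k 0 - a - int t)"
    have l0: "l \<noteq> 0" using l by auto
    show "state Qtot \<gamma> \<mu> ?Q ?k (\<lambda>x. f (act (Wt 0) u (- 1 - int t) x)) w"
      unfolding state_def
    proof (intro conjI ballI)
      show "sum ?Q {0..n+1} = Qtot" using l0 by (intro Qsum) auto
      show "(\<lambda>x. f (act (Wt 0) u (- 1 - int t) x)) \<in> Fn (\<gamma> - sum_mset (?Q 0)) (\<mu> 0 + of_int (?k 0))"
        using strongly_graded_module.functional_space_act[OF first_graded f J u, of "- 1 - int t"]
        by (simp add: first_module algebra_simps)
      show "?k 0 \<le> 0" using k0 a by simp
      fix j assume j: "j \<in> {1..n+1}"
      then show "w j \<in> G j (?Q j) (\<mu> j + of_int (?k j))"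
        using w_mem[OF j] by (cases "j = l") auto
    qed
    show "sum ?k {0..n+1} < sum k {0..n+1}" using ksum[of 0] l0 a by simp
  qed
  obtain T where T: "\<And>t x. t \<ge> T \<Longrightarrow> x \<in> carrier (Wt 0) \<Longrightarrow> f (act (Wt 0) u (- 1 - int t) x) = 0"
    using strongly_graded_module.functional_space_act_vanish[OF first_graded f J u] unfolding first_module by blast
  have "corr f (w(l := act (W l) u (-1) (w l))) \<in> opspan sscale (ring_ops n) S"
  proof (cases "l = n + 1")
    case True
    have "corr (\<lambda>x. f (act (Wt 0) u (-1) x)) w \<in> opspan sscale (ring_ops n) S" using left[of 0] by simp
    then show ?thesis unfolding True
      by (rule opspan_corr_last[OF lin valid]) (use True others in auto)
  next
    case False
    then have "l \<in> {1..n}" using l by auto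
    then show ?thesis by (rule opspan_corr_middle[OF lin valid _ S T left others])
  qed
  moreover have "w(l := act (W l) u (-1) (w l)) = x(l := act (W l) u (-1) y)" by (simp add: w_def)
  ultimately show ?thesis by (simp only:)
qed

lemma state_subset:
  assumes "state Qtot \<gamma> \<mu> Q k f x" "i \<in> {0..n+1}"
  shows "Q i \<subseteq># Qtot"
proof -
  have "Qtot = sum Q {0..n+1}" using assms(1) by (simp only: state_def)
  also have "\<dots> = Q i + sum Q ({0..n+1} - {i})" using assms(2) by (intro sum.remove) auto
  finally show ?thesis by (simp only: mset_subset_eq_add_left)
qed

lemma state_valid: "state Qtot \<gamma> \<mu> Q k f x \<Longrightarrow> valid x"
  unfolding valid_def state_def using G_carrier by blast

lemma state_functional: "state Qtot \<gamma> \<mu> Q k f x \<Longrightarrow> functional f"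
  unfolding state_def using Fn_functional by blast

lemma corr_zero_functional:
  assumes "valid x" "\<And>v. v \<in> carrier (W 0) \<Longrightarrow> f v = 0"
  shows "corr f x = 0"
  using corr_functional_sum[OF assms(1), where f = f and B = "{}"] assms(2) by (simp add: first_module)

text \<open>The generating set is fixed before \<open>Q\<close> and \<open>k\<close> are chosen. It
  therefore covers all integer offsets, however large; only the length of the reduction depends on
  them.\<close>

lemma finite_generation:
  "\<exists>S. finite S \<and> S \<subseteq> truncated n \<and>
    (\<forall>Q k f x. state Qtot \<gamma> \<mu> Q k f x \<longrightarrow> corr f x \<in> opspan sscale (ring_ops n) S)"
proof -
  have "\<forall>i\<in>{1..n+1}. \<exists>K::int. \<forall>k<K. \<forall>Q. Q \<subseteq># Qtot \<longrightarrow> G i Q (\<mu> i + of_int k) \<subseteq> {0}"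
  proof
    fix i assume "i \<in> {1..n+1}"
    then show "\<exists>K::int. \<forall>k<K. \<forall>Q. Q \<subseteq># Qtot \<longrightarrow> G i Q (\<mu> i + of_int k) \<subseteq> {0}"
      by (rule pattern_module.pattern_space_bounded_below[OF patterns])
  qed
  from bchoice[OF this] obtain K :: "nat \<Rightarrow> int" where K: "\<And>i k Q. i \<in> {1..n+1} \<Longrightarrow> k < K i \<Longrightarrow> Q \<subseteq># Qtot \<Longrightarrow>
      G i Q (\<mu> i + of_int k) \<subseteq> {0}"
    by blast
  have "\<forall>Q. \<exists>K::int. \<forall>k<K. gweight V (W 0) (\<mu> 0 + of_int k) \<inter> Wg 0 (\<gamma> - sum_mset Q) = {0}"
    using strongly_graded_module.module_bounded_below[OF first_graded] by simp
  from choice[OF this] obtain K0' :: "'a multiset \<Rightarrow> int" where K0': "\<And>Q k. k < K0' Q \<Longrightarrow>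
      gweight V (W 0) (\<mu> 0 + of_int k) \<inter> Wg 0 (\<gamma> - sum_mset Q) = {0}"
    by blast
  define K0 where "K0 = Min (K0' ` {Q. Q \<subseteq># Qtot})"
  have K0: "gweight V (W 0) (\<mu> 0 + of_int k) \<inter> Wg 0 (\<gamma> - sum_mset Q) = {0}" if "k < K0" "Q \<subseteq># Qtot" for k Q
  proof -
    have "K0 \<le> K0' Q" unfolding K0_def using that(2) by (intro Min_le) (auto simp: finite_submultisets)
    then show ?thesis using that(1) by (intro K0') simp
  qed
  have "\<forall>i\<in>{1..n+1}. \<exists>B. finite B \<and> B \<subseteq> carrier (W i) \<and> (\<forall>Q b. Q \<subseteq># Qtot \<longrightarrow>
      b \<in> strongly_graded_module.exceptional V (W i) (Wg i) (sum_mset Q) \<longrightarrow> G i Q b \<subseteq> module.span (scale (W i)) B)"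
  proof
    fix i assume i: "i \<in> {1..n+1}"
    show "\<exists>B. finite B \<and> B \<subseteq> carrier (W i) \<and> (\<forall>Q b. Q \<subseteq># Qtot \<longrightarrow>
      b \<in> strongly_graded_module.exceptional V (W i) (Wg i) (sum_mset Q) \<longrightarrow> G i Q b \<subseteq> module.span (scale (W i)) B)"
      by (rule pattern_module.exceptional_finite_span[OF patterns[OF i]])
  qed
  from bchoice[OF this] obtain B where B': "\<forall>i\<in>{1..n+1}. finite (B i) \<and> B i \<subseteq> carrier (W i) \<and> (\<forall>Q b. Q \<subseteq># Qtot \<longrightarrow>
      b \<in> strongly_graded_module.exceptional V (W i) (Wg i) (sum_mset Q) \<longrightarrow> G i Q b \<subseteq> module.span (scale (W i)) (B i))" ..
  have B: "finite (B i)" "B i \<subseteq> carrier (W i)"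
    "Q \<subseteq># Qtot \<Longrightarrow> b \<in> strongly_graded_module.exceptional V (W i) (Wg i) (sum_mset Q) \<Longrightarrow>
      G i Q b \<subseteq> module.span (scale (W i)) (B i)" if "i \<in> {1..n+1}" for i Q b
    using bspec[OF B' that] by simp_all
  define H where "H \<delta> \<nu> = (SOME H. finite H \<and> (\<forall>h\<in>H. functional h) \<and>
    (\<forall>f\<in>Fn \<delta> \<nu>. \<forall>w. valid w \<longrightarrow> corr f w \<in> series.span {corr h w | h. h \<in> H}))" for \<delta> \<nu>
  have H: "finite (H \<delta> \<nu>) \<and> (\<forall>h\<in>H \<delta> \<nu>. functional h) \<and>
    (\<forall>f\<in>Fn \<delta> \<nu>. \<forall>w. valid w \<longrightarrow> corr f w \<in> series.span {corr h w | h. h \<in> H \<delta> \<nu>})" for \<delta> \<nu>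
    unfolding H_def
  proof (rule someI_ex)
    obtain C :: "'w set" and h where C: "finite C" "\<And>b. b \<in> C \<Longrightarrow> functional (h b)"
      "\<And>f. f \<in> Fn \<delta> \<nu> \<Longrightarrow> \<exists>c. \<forall>x\<in>carrier (W 0). f x = (\<Sum>b\<in>C. c b * h b x)"
      using strongly_graded_module.functional_space_finite[OF first_graded, of \<delta> \<nu>] unfolding first_module by blast
    have "corr f w \<in> series.span {corr g w | g. g \<in> h ` C}" if "f \<in> Fn \<delta> \<nu>" "valid w" for f w
    proof -
      obtain c where "\<forall>x\<in>carrier (W 0). f x = (\<Sum>b\<in>C. c b * h b x)" using C(3)[OF \<open>f \<in> Fn \<delta> \<nu>\<close>] ..
      then have "corr f w = (\<Sum>b\<in>C. sscale (c b) (corr (h b) w))"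
        by (intro corr_functional_sum[OF \<open>valid w\<close>]) (simp add: first_module)
      then show ?thesis
        by (simp only:) (intro series.span_sum series.span_scale series.span_base, blast)
    qed
    then show "\<exists>H. finite H \<and> (\<forall>h\<in>H. functional h) \<and>
      (\<forall>f\<in>Fn \<delta> \<nu>. \<forall>w. valid w \<longrightarrow> corr f w \<in> series.span {corr h w | h. h \<in> H})"
      using C(1,2) by (intro exI[of _ "h ` C"] conjI ballI allI impI) auto
  qed
  \<comment> \<open>Below \<open>K0\<close> the functional is 0, and a state has
    \<open>k 0 \<le> 0\<close>, so finitely many weights of functionals are left.\<close>
  define HH where "HH = (\<Union>Q\<in>{Q. Q \<subseteq># Qtot}. \<Union>k\<in>{K0..0}. H (\<gamma> - sum_mset Q) (\<mu> 0 + of_int k))"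
  define S where "S = (\<lambda>(h, w). corr h w) ` (HH \<times> PiE {1..n+1} B)"
  have finHH: "finite HH" unfolding HH_def using H by (auto simp: finite_submultisets)
  have HHfun: "functional h" if "h \<in> HH" for h using that H unfolding HH_def by blast
  have "finite S"
    unfolding S_def using finHH B(1) by (intro finite_imageI finite_cartesian_product finite_PiE) auto
  have S: "S \<subseteq> truncated n"
  proof
    fix \<phi> assume "\<phi> \<in> S"
    then obtain h w where hw: "\<phi> = corr h w" "h \<in> HH" "w \<in> PiE {1..n+1} B" unfolding S_def by auto
    have "valid w" unfolding valid_def using hw(3) B(2) by (blast dest: PiE_mem)
    then show "\<phi> \<in> truncated n" unfolding hw(1) by (rule corr_truncated[OF HHfun[OF hw(2)]])
  qed
  let ?O = "opspan sscale (ring_ops n) S"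
  have gen: "corr h w \<in> ?O" if h: "h \<in> HH" and w: "\<And>i. i \<in> {1..n+1} \<Longrightarrow> w i \<in> module.span (scale (W i)) (B i)" for h w
  proof (rule opspan_multilinear[OF HHfun[OF h] B(2) _ w])
    fix w assume w: "\<And>i. i \<in> {1..n+1} \<Longrightarrow> w i \<in> B i"
    have "corr h w = corr h (restrict w {1..n+1})" by (rule corr_cong) simp
    moreover have "restrict w {1..n+1} \<in> PiE {1..n+1} B" using w by auto
    ultimately have "corr h w \<in> S" unfolding S_def using h by (intro image_eqI[of _ _ "(h, restrict w {1..n+1})"]) auto
    then show "corr h w \<in> ?O" by (rule opspan.base)
  qed
  \<comment> \<open>The sum of the individual lower bounds: a total below \<open>L\<close> forces
    the functional or some slot below its own bound, where the correlator is 0.\<close>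
  define L where "L = K0 + sum K {1..n+1}"
  have sum_split: "sum k {0..n+1} = k 0 + sum k {1..n+1}" for k :: "nat \<Rightarrow> int"
    by (simp add: sum.atLeast_Suc_atMost)
  have zero_functional: "corr f x = 0" if "state Qtot \<gamma> \<mu> Q k f x" "k 0 < K0" for Q k f x
  proof (rule corr_zero_functional[OF state_valid[OF that(1)]])
    fix v assume "v \<in> carrier (W 0)"
    moreover have "f \<in> Fn (\<gamma> - sum_mset (Q 0)) (\<mu> 0 + of_int (k 0))" using that(1) by (simp only: state_def)
    moreover have "gweight V (W 0) (\<mu> 0 + of_int (k 0)) \<inter> Wg 0 (\<gamma> - sum_mset (Q 0)) = {0}"
      using state_subset[OF that(1), of 0] by (intro K0 that(2)) simp
    ultimately show "f v = 0" using strongly_graded_module.functional_space_zero[OF first_graded] by blast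
  qed
  have main: "corr f x \<in> ?O" if "state Qtot \<gamma> \<mu> Q k f x" "sum k {0..n+1} < L + int m" for m Q k f x
    using that
  proof (induction m arbitrary: Q k f x)
    case (0 Q k f x)
    note st = 0(1)[unfolded state_def] and sub = state_subset[OF 0(1)]
    have "k 0 < K0 \<or> (\<exists>i\<in>{1..n+1}. k i < K i)"
    proof (rule ccontr)
      assume "\<not> ?thesis"
      then have "K0 \<le> k 0" "\<And>i. i \<in> {1..n+1} \<Longrightarrow> K i \<le> k i" by force+
      moreover from this(2) have "sum K {1..n+1} \<le> sum k {1..n+1}" by (rule sum_mono)
      ultimately show False using 0(2) sum_split[of k] by (simp add: L_def)
    qed
    then have "corr f x = 0"
    proof (elim disjE bexE)
      assume "k 0 < K0"
      then show ?thesis using zero_functional[OF 0(1)] by simp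
    next
      fix i assume i: "i \<in> {1..n+1}" "k i < K i"
      then have "G i (Q i) (\<mu> i + of_int (k i)) \<subseteq> {0}" using sub[of i] by (intro K) auto
      then have "x i = 0" using st i(1) by blast
      moreover have "corr f (x(i := 0)) = 0"
        using linear_on_0[OF vs_W[OF i(1)] vector_space_complex corr_linear_slot[OF state_functional[OF 0(1)]
            state_valid[OF 0(1)] i(1)] validD[OF state_valid[OF 0(1)] i(1)]]
        by (intro ext) simp
      ultimately show ?thesis by (metis fun_upd_triv)
    qed
    then show ?case by (simp only: opspan.zero)
  next
    case (Suc m Q k f x)
    note st = Suc.prems(1)[unfolded state_def] and Qsub = state_subset[OF Suc.prems(1)]
      and valid = state_valid[OF Suc.prems(1)] and lin = state_functional[OF Suc.prems(1)]
    show ?case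
    proof (cases "\<forall>i\<in>{1..n+1}. \<mu> i + of_int (k i) \<in> strongly_graded_module.exceptional V (W i) (Wg i) (sum_mset (Q i))")
      case True
      show ?thesis
      proof (cases "k 0 < K0")
        case True
        then show ?thesis using zero_functional[OF Suc.prems(1)] by (simp only: opspan.zero)
      next
        case False
        have span: "x i \<in> module.span (scale (W i)) (B i)" if i: "i \<in> {1..n+1}" for i
        proof -
          have "G i (Q i) (\<mu> i + of_int (k i)) \<subseteq> module.span (scale (W i)) (B i)"
            using True i Qsub[of i] by (intro B(3)) auto
          then show ?thesis using st i by blast
        qed
        let ?H = "H (\<gamma> - sum_mset (Q 0)) (\<mu> 0 + of_int (k 0))"
        have HH: "?H \<subseteq> HH" unfolding HH_def using False st Qsub[of 0] by force
        have "corr f x \<in> series.span {corr h x | h. h \<in> ?H}" using H valid st by blast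
        moreover have "series.span {corr h x | h. h \<in> ?H} \<subseteq> ?O"
          using HH gen[OF _ span] opspan_invariant[OF vector_space_sscale, of "ring_ops n" S]
          by (intro series.span_minimal) (auto simp: invariant_subspace_def)
        ultimately show ?thesis by blast
      qed
    next
      case False
      then obtain l where l: "l \<in> {1..n+1}"
        "\<mu> l + of_int (k l) \<notin> strongly_graded_module.exceptional V (W l) (Wg l) (sum_mset (Q l))" by blast
      interpret pm: pattern_module V A Vg "W l" "Wg l" "P l" by (rule patterns[OF l(1)])
      define R where "R = {act (W l) u (-1) y | u y J Q' a. Q l = J + Q' \<and> sum_mset J \<in> A \<and> a \<ge> 1 \<and>
        u \<in> vweight V a \<inter> Vg (sum_mset J) \<and> y \<in> G l Q' (\<mu> l + of_int (k l) - of_int a)}"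
      have xR: "x l \<in> pm.weights.span R"
        using pm.pattern_space_reducible[OF l(2)] st l(1) unfolding pm.reducible_def R_def by blast
      have RC: "R \<subseteq> carrier (W l)"
        unfolding R_def using pm.module_action.act_closed pm.pattern_space_carrier by blast
      have Rz: "corr f (x(l := z)) \<in> ?O" if "z \<in> R" for z
      proof -
        obtain u y J Q' a where R: "z = act (W l) u (-1) y" "Q l = J + Q'" "sum_mset J \<in> A" "a \<ge> 1"
          "u \<in> vweight V a \<inter> Vg (sum_mset J)" "y \<in> G l Q' (\<mu> l + of_int (k l) - of_int a)"
          using \<open>z \<in> R\<close> unfolding R_def by blast
        show ?thesis
          unfolding R(1)
        proof (rule opspan_reduce[where Q = Q and k = k and \<mu> = \<mu> and \<gamma> = \<gamma> and Qtot = Qtot, OF _ _ _ _ l(1) R(2-6) S])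
          fix Q' k' f' x' assume "state Qtot \<gamma> \<mu> Q' k' f' x'" "sum k' {0..n+1} < sum k {0..n+1}"
          then show "corr f' x' \<in> ?O" using Suc.prems(2) by (intro Suc.IH) auto
        qed (use st in auto)
      qed
      have "corr f (x(l := x l)) \<in> ?O" by (rule opspan_slot[OF lin valid l(1) RC xR Rz])
      then show ?thesis by (simp only: fun_upd_triv)
    qed
  qed
  have "corr f x \<in> ?O" if "state Qtot \<gamma> \<mu> Q k f x" for Q k f x
    using main[OF that, of "nat (sum k {0..n+1} - L + 1)"] by simp
  then show ?thesis using \<open>finite S\<close> S by blast
qed

section \<open>Derivatives of the given series\<close>

lemma Lop_pattern_space:
  assumes i: "i \<in> {1..n+1}" and x: "x \<in> G i Q b"
  shows "(Lop V (W i) (-1) ^^ j) x \<in> G i Q (b + of_nat j)"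
proof (induction j)
  case (Suc j)
  interpret pm: pattern_module V A Vg "W i" "Wg i" "P i" by (rule patterns[OF i])
  \<comment> \<open>L(-1) is mode 0 of the conformal vector, which has degree 0 and weight 2: the
    block moved is empty and the weight rises by 2 - 0 - 1.\<close>
  have "act (W i) (conformal V) 0 ((Lop V (W i) (-1) ^^ j) x) \<in> G i ({#} + Q) (b + of_nat j + of_int (2 - 0 - 1))"
    using pm.subgroup(1) pm.conformal_weight pm.conformal_degree Suc
    by (intro pm.act_pattern_space) auto
  then show ?case by (simp add: Lop_def algebra_simps)
qed (use x in simp)

lemma Lop_closed: "i \<in> {1..n+1} \<Longrightarrow> x \<in> carrier (W i) \<Longrightarrow> (Lop V (W i) (-1) ^^ j) x \<in> carrier (W i)"
  by (induction j) (auto simp: Lop_def intro: vertex_action.act_closed[OF outer_modules])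

lemma Lop_linear:
  assumes i: "i \<in> {1..n+1}"
  shows "linear_on (scale (W i)) (scale (W i)) (carrier (W i)) (Lop V (W i) (-1) ^^ j)"
proof (induction j)
  case (Suc j)
  then show ?case
    using vertex_action.act_linear[OF outer_modules[OF i], of "conformal V" 0] Lop_closed[OF i]
    unfolding linear_on_def by (simp add: Lop_def)
qed (simp add: linear_on_def)

lemma dz_pow_corr:
  assumes f: "functional f" and w: "valid w" and l: "l \<in> {1..n}"
  shows "(dz l ^^ j) (corr f w) = corr f (w(l := (Lop V (W l) (-1) ^^ j) (w l)))"
proof (induction j)
  case (Suc j)
  let ?w = "w(l := (Lop V (W l) (-1) ^^ j) (w l))"
  have l1: "l \<in> {1..n+1}" using l by auto
  have "valid ?w" by (rule valid_update[OF w Lop_closed[OF l1 validD[OF w l1]]])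
  from dz_corr[OF f this l] have "dz l (corr f ?w) = corr f (?w(l := Lop V (W l) (-1) (?w l)))" .
  also have "?w(l := Lop V (W l) (-1) (?w l)) = w(l := (Lop V (W l) (-1) ^^ Suc j) (w l))" by simp
  finally show ?case using Suc by (simp only: funpow.simps o_apply)
qed simp

text \<open>Splitting the functional and the vectors into weight components leaves finitely many
  tuples of initial weights, the same for every order of derivative. Differentiating
  \<open>j\<close> times only changes the integer offset in slot \<open>l\<close> by
  \<open>j\<close>, and all offsets are covered by one generating set per tuple.\<close>

lemma corr_derivatives_finite:
  assumes w0: "w0 \<in> contragredient_degree V (W 0) (Wg 0) \<beta>0"
    and w: "\<And>i. i \<in> {1..n+1} \<Longrightarrow> w i \<in> Wg i (\<beta> i)"
  shows "\<exists>S. finite S \<and> S \<subseteq> truncated n \<and>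
    (\<forall>l\<in>{1..n}. \<forall>j. corr w0 (w(l := (Lop V (W l) (-1) ^^ j) (w l))) \<in> opspan sscale (ring_ops n) S)"
proof -
  obtain F g where F: "finite F" "\<And>\<nu>. \<nu> \<in> F \<Longrightarrow> g \<nu> \<in> Fn (- \<beta>0) \<nu>"
    "\<And>x. x \<in> carrier (W 0) \<Longrightarrow> w0 x = (\<Sum>\<nu>\<in>F. g \<nu> x)"
    using strongly_graded_module.contragredient_decomposition[OF first_graded w0] by blast
  define wt where "wt i b x = component (gweight V (W i)) x b" for i b x
  define C where "C i = (if i = 0 then F else {b. wt i b (w i) \<noteq> 0})" for i
  \<comment> \<open>Initially nothing has been moved onto the functional.\<close>
  define Q where "Q i = (if i = 0 then {#} else P i (\<beta> i) (w i))" for i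
  define Qtot where "Qtot = sum Q {0..n+1}"
  have wc: "w i \<in> carrier (W i)" if i: "i \<in> {1..n+1}" for i
  proof -
    interpret pm: pattern_module V A Vg "W i" "Wg i" "P i" by (rule patterns[OF i])
    show ?thesis using w[OF i] by (rule pm.degree_carrier)
  qed
  have valid: "valid w" using wc by (simp add: valid_def)
  have finC: "finite (C i)" if i: "i \<in> {0..n+1}" for i
  proof (cases "i = 0")
    case False
    then have i: "i \<in> {1..n+1}" using i by auto
    interpret pm: pattern_module V A Vg "W i" "Wg i" "P i" by (rule patterns[OF i])
    show ?thesis using pm.weights.finite_component[OF wc[OF i]] False by (simp add: C_def wt_def)
  qed (simp add: C_def F)
  have wtG: "wt i b (w i) \<in> G i (Q i) b" if i: "i \<in> {1..n+1}" for i b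
  proof -
    interpret pm: pattern_module V A Vg "W i" "Wg i" "P i" by (rule patterns[OF i])
    show ?thesis using pm.wt_in_pattern_space[OF w[OF i]] i by (simp add: wt_def Q_def)
  qed
  have wt_sum: "w i = (\<Sum>b\<in>C i. wt i b (w i))" if i: "i \<in> {1..n+1}" for i
  proof -
    interpret pm: pattern_module V A Vg "W i" "Wg i" "P i" by (rule patterns[OF i])
    show ?thesis using pm.weights.sum_component[OF wc[OF i]] i by (simp add: wt_def C_def)
  qed
  have wt_c: "wt i b (w i) \<in> carrier (W i)" if i: "i \<in> {1..n+1}" for i b
    by (rule G_carrier[OF i wtG[OF i]])
  have "\<forall>\<mu>. \<exists>S. finite S \<and> S \<subseteq> truncated n \<and>
    (\<forall>Q k f x. state Qtot (- \<beta>0) \<mu> Q k f x \<longrightarrow> corr f x \<in> opspan sscale (ring_ops n) S)"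
    using finite_generation by blast
  then obtain S where S: "\<And>\<mu>. finite (S \<mu>)" "\<And>\<mu>. S \<mu> \<subseteq> truncated n"
    "\<And>\<mu> Q k f x. state Qtot (- \<beta>0) \<mu> Q k f x \<Longrightarrow> corr f x \<in> opspan sscale (ring_ops n) (S \<mu>)"
    by metis
  define T where "T = (\<Union>\<mu>\<in>PiE {0..n+1} C. S \<mu>)"
  let ?O = "opspan sscale (ring_ops n) T"
  have "finite T" unfolding T_def using finC S(1) by (intro finite_UN_I finite_PiE) auto
  moreover have "T \<subseteq> truncated n" unfolding T_def using S(2) by blast
  moreover have "corr w0 (w(l := (Lop V (W l) (-1) ^^ j) (w l))) \<in> ?O" if l: "l \<in> {1..n}" for l j
  proof -
    let ?L = "Lop V (W l) (-1) ^^ j"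
    have l1: "l \<in> {1..n+1}" using l by auto
    define z where "z i b = (if i = l then ?L (wt i b (w i)) else wt i b (w i))" for i b
    let ?w = "w(l := ?L (w l))"
    have zG: "z i b \<in> G i (Q i) (b + of_int (if i = l then int j else 0))" if i: "i \<in> {1..n+1}" for i b
      using Lop_pattern_space[OF i wtG[OF i], of j b] wtG[OF i] by (auto simp: z_def)
    have zc: "z i b \<in> carrier (W i)" if i: "i \<in> {1..n+1}" for i b
      by (rule G_carrier[OF i zG[OF i]])
    have z_sum: "?w i = (\<Sum>b\<in>C i. z i b)" if i: "i \<in> {1..n+1}" for i
    proof (cases "i = l")
      case True
      have "?L (w l) = ?L (\<Sum>b\<in>C l. wt l b (w l))" by (simp only: wt_sum[OF l1, symmetric])
      also have "\<dots> = (\<Sum>b\<in>C l. ?L (wt l b (w l)))"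
        by (rule linear_on_sum[OF vs_W[OF l1] vs_W[OF l1] sub_W[OF l1] Lop_linear[OF l1] wt_c[OF l1]])
      finally show ?thesis using True by (simp add: z_def)
    next
      case False
      then show ?thesis using wt_sum[OF i] by (simp add: z_def)
    qed
    have "corr (g \<nu>) ?w \<in> ?O" if \<nu>: "\<nu> \<in> F" for \<nu>
    proof (rule opspan_multilinear[OF Fn_functional[OF F(2)[OF \<nu>]], of "\<lambda>i. z i ` C i"])
      fix i assume i: "i \<in> {1..n+1}"
      show "z i ` C i \<subseteq> carrier (W i)" using zc[OF i] by auto
      interpret amb: vector_space "scale (W i)" by (rule vs_W[OF i])
      show "?w i \<in> amb.span (z i ` C i)"
        unfolding z_sum[OF i] by (intro amb.span_sum amb.span_base) auto
    next
      fix x assume x: "\<And>i. i \<in> {1..n+1} \<Longrightarrow> x i \<in> z i ` C i"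
      then have "\<forall>i\<in>{1..n+1}. \<exists>b. b \<in> C i \<and> x i = z i b" by blast
      then obtain b where b: "\<And>i. i \<in> {1..n+1} \<Longrightarrow> b i \<in> C i" "\<And>i. i \<in> {1..n+1} \<Longrightarrow> x i = z i (b i)" by metis
      \<comment> \<open>The restriction puts the tuple into the extensional product, which is
        finite.\<close>
      define \<mu> where "\<mu> = restrict (\<lambda>i. if i = 0 then \<nu> else b i) {0..n+1}"
      have \<mu>: "\<mu> \<in> PiE {0..n+1} C"
        using b(1) \<nu> by (auto simp: \<mu>_def C_def[of 0])
      have "state Qtot (- \<beta>0) \<mu> Q (\<lambda>i. if i = l then int j else 0) (g \<nu>) x"
        unfolding state_def
      proof (intro conjI ballI)
        show "sum Q {0..n+1} = Qtot" by (simp add: Qtot_def)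
        show "g \<nu> \<in> Fn (- \<beta>0 - sum_mset (Q 0)) (\<mu> 0 + of_int (if 0 = l then int j else 0))"
          using F(2)[OF \<nu>] l by (simp add: Q_def \<mu>_def)
        show "(if 0 = l then int j else 0) \<le> 0" using l by auto
        fix i assume i: "i \<in> {1..n+1}"
        have "\<mu> i = b i" using i by (simp add: \<mu>_def)
        then show "x i \<in> G i (Q i) (\<mu> i + of_int (if i = l then int j else 0))"
          using zG[OF i, of "b i"] b(2)[OF i] by simp
      qed
      from S(3)[OF this] show "corr (g \<nu>) x \<in> ?O"
        by (rule opspan_mono[OF subset_refl, rotated]) (use \<mu> in \<open>auto simp: T_def\<close>)
    qed
    moreover have "corr w0 ?w = (\<Sum>\<nu>\<in>F. sscale 1 (corr (g \<nu>) ?w))"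
      using F(3) by (intro corr_functional_sum valid_update[OF valid Lop_closed[OF l1 wc[OF l1]]])
        (simp add: first_module)
    ultimately show ?thesis
      by (simp only:) (intro opspan_sum opspan.scale)
  qed
  ultimately show ?thesis by blast
qed

end

theorem theorem5p6:
  fixes V :: "'v::ab_group_add vertex_data"
    and A :: "'a::ab_group_add set"
    and Vg :: "'a \<Rightarrow> 'v set"
    and n :: nat
    and W :: "nat \<Rightarrow> ('v, 'w::ab_group_add) vmod"
    and Wg :: "nat \<Rightarrow> 'a \<Rightarrow> 'w set"
    and P :: "nat \<Rightarrow> 'a \<Rightarrow> 'w \<Rightarrow> 'a multiset"
    and Wt :: "nat \<Rightarrow> ('v, 'w) vmod"
    and Y :: "nat \<Rightarrow> 'w \<Rightarrow> complex \<Rightarrow> nat \<Rightarrow> 'w \<Rightarrow> 'w"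
    and w0 :: "'w \<Rightarrow> complex"
    and w :: "nat \<Rightarrow> 'w"
  assumes "n \<ge> 1"
    and "strongly_graded_algebra V A Vg"
    and "\<forall>i\<in>{0..n+1}. strongly_graded_module V A Vg (W i) (Wg i)"
    and "\<forall>i\<in>{0..n+1}. real_weights V (W i)"
    and "\<forall>i\<in>{0..n+1}. C1_cofinite V (W i) (Wg i)"
    and "\<forall>i\<in>{0..n+1}. pattern_assignment V A Vg (W i) (Wg i) (P i)"
    and "\<forall>i\<in>{0..n+1}. patterns_preserved A Vg (W i) (Wg i) (P i)"
    and "\<forall>i\<in>{1..<n}. generalized_module V (Wt i)"
    and "Wt 0 = W 0" and "Wt n = W (n + 1)"
    and "\<forall>i\<in>{1..n}. log_intertwining_operator V (W i) (Wt i) (Wt (i - 1)) (Y i)"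
    and "\<exists>\<beta>. w0 \<in> contragredient_degree V (W 0) (Wg 0) \<beta>"
    and "\<forall>i\<in>{1..n+1}. \<exists>\<beta>. w i \<in> Wg i \<beta>"
  shows "\<exists>m. \<exists>a :: nat \<Rightarrow> nat \<Rightarrow> ring_expr.
    (\<forall>k\<in>{1..m}. \<forall>l\<in>{1..n}. a k l \<in> coeff_ring n) \<and>
    satisfies_system n m a (correlator n w0 Y w)"
proof -
  have act: "vertex_action V (W i)" if "i \<in> {0..n+1}" for i
  proof -
    interpret strongly_graded_module V A Vg "W i" "Wg i" using assms(3) that by blast
    show ?thesis by (rule module_action.vertex_action_axioms)
  qed
  have act': "vertex_action V (Wt i)" if i: "i \<le> n" for i
  proof -
    consider "i = 0" | "i = n" | "i \<in> {1..<n}" using i by fastforce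
    then show ?thesis
    proof cases
      case 3
      interpret generalized_module V "Wt i" using assms(8) 3 by blast
      show ?thesis by (rule module_action.vertex_action_axioms)
    qed (use act[of 0] act[of "n + 1"] assms(9,10) in auto)
  qed
  have pat: "pattern_module V A Vg (W i) (Wg i) (P i)" if "i \<in> {1..n+1}" for i
    using assms(3,5-7) that by (auto simp: pattern_module_def pattern_module_axioms_def)
  interpret graded_chain V n W Wt Y A Vg Wg P
    by (intro graded_chain.intro intertwining_chain.intro graded_chain_axioms.intro)
      (use assms(3,9-11) act act' pat in auto)
  obtain \<beta>0 where \<beta>0: "w0 \<in> contragredient_degree V (W 0) (Wg 0) \<beta>0" using assms(12) by blast
  obtain \<beta> where \<beta>: "\<And>i. i \<in> {1..n+1} \<Longrightarrow> w i \<in> Wg i (\<beta> i)" using assms(13) by metis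
  have f: "functional w0"
    using \<beta>0 unfolding contragredient_degree_def contragredient_def first_module by blast
  have valid: "valid w"
    unfolding valid_def
  proof
    fix i assume i: "i \<in> {1..n+1}"
    interpret pm: pattern_module V A Vg "W i" "Wg i" "P i" by (rule patterns[OF i])
    show "w i \<in> carrier (W i)" by (rule pm.degree_carrier[OF \<beta>[OF i]])
  qed
  obtain S where S: "finite S" "S \<subseteq> truncated n"
    "\<And>l j. l \<in> {1..n} \<Longrightarrow> corr w0 (w(l := (Lop V (W l) (-1) ^^ j) (w l))) \<in> opspan sscale (ring_ops n) S"
    using corr_derivatives_finite[OF \<beta>0 \<beta>] by blast
  show ?thesis
  proof (rule exists_system)
    fix l k assume l: "l \<in> {1..n}"
    then have l1: "l \<in> {1..n+1}" by auto
    show "(dz l ^^ k) (corr w0 w) \<in> truncated n"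
      unfolding dz_pow_corr[OF f valid l]
      by (rule corr_truncated[OF f valid_update[OF valid Lop_closed[OF l1 validD[OF valid l1]]]])
  next
    fix l assume l: "l \<in> {1..n}"
    show "\<exists>S. finite S \<and> S \<subseteq> truncated n \<and> (\<forall>k. (dz l ^^ k) (corr w0 w) \<in> opspan sscale (ring_ops n) S)"
      using S dz_pow_corr[OF f valid l] l by (intro exI[of _ S]) simp
  qed
qed

end
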